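(* Let $k$ be an algebraically closed field of characteristic $p\ge 0$, let $\delta\in k$ and let $r,s\ge 0$ be integers. The walled Brauer algebra $B_{r,s}(\delta)$ is semisimple if and only if $k$ is $\Sigma$-semisimple (i.e. $p=0$ or $p>\max(r,s)$) and one of the following conditions holds: (i) $\delta\notin\mathbb{Z}$; or (ii) $\delta\in\mathbb{Z}$ and $|\delta|>r+s-2$; or (iii) $r=0$ or $s=0$; or (iv) $\delta=0$ and $(r,s)\in\{(1,2),(1,3),(2,1),(3,1)\}$.
   Context: The walled Brauer algebra $B_{r,s}(\delta)$ has $k$-basis the diagrams defined as follows. There are northern nodes $1,\dots,r+s$ and southern nodes $\overline{1},\dots,\overline{r+s}$; a wall separates the nodes $i,\overline{i}$ with $i\le r$ (left) from those with $i>r$ (right). A diagram is a partition of all nodes into pairs such that every pair consisting of a northern and a southern node has both nodes on the same side of the wall, and every pair of two northern nodes, or of two southern nodes, has one node on each side of the wall. The product $AB$ is obtained by placing $A$ above $B$ and identifying the node $\overline{i}$ of $A$ with the node $i$ of $B$; $AB=\delta^{t}C$, where $t$ is the number of connected components not connected to any remaining outer node and $C$ is the diagram obtained after removing these components. Convention: "$\delta\in\mathbb{Z}$" means that $\delta$ lies in the image of the ring homomorphism $\mathbb{Z}\to k$, and "$|\delta|>r+s-2$" means that no integer $m$ with $|m|\le r+s-2$ has image $\delta$ in $k$ (in characteristic zero this is the usual absolute value condition). *)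

theory Defs
  imports
    "HOL-Algebra.Ideal"
    "HOL-Computational_Algebra.Polynomial"
    "HOL-Library.Disjoint_Sets"
    "HOL-Library.FuncSet"
begin

section \<open>Semisimple rings\<close>

definition left_ideal :: "('a, 'm) ring_scheme \<Rightarrow> 'a set \<Rightarrow> bool" where
  "left_ideal R I \<longleftrightarrow> additive_subgroup I R \<and> (\<forall>a\<in>carrier R. \<forall>x\<in>I. a \<otimes>\<^bsub>R\<^esub> x \<in> I)"

text \<open>Left ideals are the submodules of the left regular module.\<close>

definition simple_left_ideal :: "('a, 'm) ring_scheme \<Rightarrow> 'a set \<Rightarrow> bool" where
  "simple_left_ideal R I \<longleftrightarrow>
     left_ideal R I \<and> I \<noteq> {\<zero>\<^bsub>R\<^esub>} \<and>
     (\<forall>J. left_ideal R J \<longrightarrow> J \<subseteq> I \<longrightarrow> J = {\<zero>\<^bsub>R\<^esub>} \<or> J = I)"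

text \<open>
  A ring (with unit, not necessarily commutative) is semisimple if its left regular module is
  an internal direct sum of simple submodules. Finitely many summands suffice, since the unit
  already lies in a finite partial sum. Using a set rather than an indexed family of summands
  loses nothing, because the summands are nonzero and hence pairwise distinct.
\<close>

definition semisimple_ring :: "('a, 'm) ring_scheme \<Rightarrow> bool" where
  "semisimple_ring R \<longleftrightarrow>
     (\<exists>F. finite F \<and> (\<forall>I\<in>F. simple_left_ideal R I) \<and>
          (\<forall>x\<in>carrier R. \<exists>!f. f \<in> (\<Pi>\<^sub>E I\<in>F. I) \<and> x = (\<Oplus>\<^bsub>R\<^esub>I\<in>F. f I)))"


section \<open>Walled Brauer diagrams\<close>

datatype node = North nat | South nat

definition nodes :: "nat \<Rightarrow> nat \<Rightarrow> node set" where
  "nodes r s = North ` {1..r + s} \<union> South ` {1..r + s}"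

text \<open>The condition \<open>i \<le> r\<close> says that the nodes with number \<open>i\<close> are to the left of the wall.\<close>

definition walled_diagrams :: "nat \<Rightarrow> nat \<Rightarrow> node set set set" where
  "walled_diagrams r s =
     {d. partition_on (nodes r s) d \<and> (\<forall>e\<in>d. card e = 2) \<and>
         (\<forall>i j. {North i, South j} \<in> d \<longrightarrow> (i \<le> r \<longleftrightarrow> j \<le> r)) \<and>
         (\<forall>i j. {North i, North j} \<in> d \<longrightarrow> (i \<le> r \<longleftrightarrow> \<not> j \<le> r)) \<and>
         (\<forall>i j. {South i, South j} \<in> d \<longrightarrow> (i \<le> r \<longleftrightarrow> \<not> j \<le> r))}"

definition identity_diagram :: "nat \<Rightarrow> nat \<Rightarrow> node set set" where
  "identity_diagram r s = (\<lambda>i. {North i, South i}) ` {1..r + s}"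

text \<open>
  When \<open>A\<close> is placed above \<open>B\<close>, the northern nodes of \<open>A\<close> become \<open>Top\<close>, the southern nodes
  of \<open>B\<close> become \<open>Bottom\<close>, and the southern nodes of \<open>A\<close> are identified with the northern
  nodes of \<open>B\<close> as \<open>Middle\<close>.
\<close>

datatype vertex = Top nat | Middle nat | Bottom nat

fun upper :: "node \<Rightarrow> vertex" where
  "upper (North i) = Top i"
| "upper (South i) = Middle i"

fun lower :: "node \<Rightarrow> vertex" where
  "lower (North i) = Middle i"
| "lower (South i) = Bottom i"

fun outer :: "node \<Rightarrow> vertex" where
  "outer (North i) = Top i"
| "outer (South i) = Bottom i"

definition stacked :: "node set set \<Rightarrow> node set set \<Rightarrow> vertex set set" where
  "stacked A B = (`) upper ` A \<union> (`) lower ` B"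

definition components :: "'v set set \<Rightarrow> 'v set set" where
  "components E = \<Union>E // {(u, v). {u, v} \<in> E}\<^sup>*"

definition loops :: "node set set \<Rightarrow> node set set \<Rightarrow> nat" where
  "loops A B = card {K \<in> components (stacked A B). K \<subseteq> range Middle}"

definition concat_diagram :: "node set set \<Rightarrow> node set set \<Rightarrow> node set set" where
  "concat_diagram A B =
     (\<lambda>K. outer -` K) ` {K \<in> components (stacked A B). \<not> K \<subseteq> range Middle}"


section \<open>The walled Brauer algebra\<close>

text \<open>
  Linear combinations of diagrams are represented by their coefficient functions, which vanish
  outside the finite set of diagrams. The scalar \<open>c\<close> acts as multiplication by \<open>c\<close> times the
  unit, so the left ideals of this ring are exactly the submodules of the regular module of
  the algebra.
\<close>

definition walled_brauer :: "nat \<Rightarrow> nat \<Rightarrow> 'k::field \<Rightarrow> (node set set \<Rightarrow> 'k) ring" where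
  "walled_brauer r s \<delta> =
     \<lparr> carrier = {a. \<forall>d. d \<notin> walled_diagrams r s \<longrightarrow> a d = 0},
       monoid.mult = (\<lambda>a b C. \<Sum>(A, B)\<in>{(A, B). A \<in> walled_diagrams r s \<and> B \<in> walled_diagrams r s \<and>
                                              concat_diagram A B = C}. a A * b B * \<delta> ^ loops A B),
       one = (\<lambda>d. if d = identity_diagram r s then 1 else 0),
       zero = (\<lambda>_. 0),
       add = (\<lambda>a b d. a d + b d) \<rparr>"

end

theory Submission
  imports Defs "HOL-Combinatorics.Permutations" "HOL-Library.Function_Algebras" "HOL-Computational_Algebra.Primes"
begin

text \<open>Cutting the wall, an edge is oriented from the north to the south on the left of the wall and from
  the south to the north on the right; a walled diagram then becomes a permutation, and composing with the
  diagram of a transposition across the wall (a hook) becomes a multiplication by a transposition.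
  A finite-dimensional algebra is semisimple iff it is semiprime, i.e. \<open>x b x = 0\<close> for all \<open>b\<close> forces \<open>x = 0\<close>.

  If all hooks kill a vector supported on the diagrams with \<open>l\<close> arcs, up to diagrams with more arcs, then
  \<open>\<delta> + X + Y\<close> kills it, where \<open>X\<close> and \<open>Y\<close> are Jucys-Murphy elements on the two sides of the wall. Their
  eigenvalues are contents of boxes, so if \<open>\<delta> + c + c' \<noteq> 0\<close> for all contents in question, a nonzero \<open>x\<close> can
  be contracted by hooks to a nonzero element of the group algebra of a product of two symmetric groups. By Maschke's theorem
  this is semiprime if the characteristic exceeds \<open>r\<close> and \<open>s\<close>, and hence so is the whole algebra.

  Conversely, let \<open>\<delta> + c + c' = 0\<close> for two contents. Eigenvectors of the Jucys-Murphy elements for \<open>c\<close> and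
  \<open>c'\<close> give a vector supported on diagrams with one arc which all hooks kill up to diagrams with two arcs.
  It generates an ideal which is nilpotent modulo the diagrams with at least two arcs. Contents with sum \<open>-\<delta>\<close> exist for all
  integers \<open>\<delta>\<close> of absolute value at most \<open>r + s - 2\<close> except in case (iv) and for \<open>r = s = 2\<close>, \<open>\<delta> = 1, -1\<close>,
  where a vector supported on diagrams with two arcs does the same.\<close>

section \<open>Semisimple and semiprime rings\<close>

text \<open>Paths through stacked diagrams are never traced. A diagram is determined by the
  two-colourings of its nodes that are constant on edges, and those of a stacked pair with given
  outer colours number 2^t, for t closed loops, or 0. Composition becomes composition of relations
  between colourings; associativity, loop exponents included, is a double count. As \<delta> may be
  0, the nested-hook element e need not be proportional to an idempotent (its square is
  \<open>\<delta> ^ k\<close> times itself), so instead of a corner algebra the proof compares e b e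
  with f e, for f in a group algebra, modulo diagrams with more arcs. The eigenvalues of
  Jucys-Murphy elements are confined by annihilating polynomials with integer roots, built one point
  at a time from the relation of the degenerate affine Hecke algebra; this works over every field.
  The exceptional cases come from one gap: no partition of 2 or 3 has a removable box of content 0.
  Hence 0 is no sum of two contents for the pairs in (iv), while for r = s = 2 the sums 1 and -1 are
  missing with one arc but appear with two.\<close>

lemma left_idealI:
  fixes R (structure)
  assumes "ring R" "I \<subseteq> carrier R" "\<zero>\<^bsub>R\<^esub> \<in> I" "\<And>a b. a \<in> I \<Longrightarrow> b \<in> I \<Longrightarrow> a \<oplus>\<^bsub>R\<^esub> b \<in> I"
    "\<And>a x. a \<in> carrier R \<Longrightarrow> x \<in> I \<Longrightarrow> a \<otimes>\<^bsub>R\<^esub> x \<in> I"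
  shows "left_ideal R I"
proof -
  interpret ring R by fact
  have neg: "\<ominus> x \<in> I" if "x \<in> I" for x
  proof -
    have "\<ominus> x = (\<ominus> \<one>) \<otimes> x" using that assms(2) by (auto simp: l_minus)
    with assms(5)[of "\<ominus> \<one>" x] that show ?thesis by simp
  qed
  have "subgroup I (add_monoid R)"
    by (rule add.subgroupI) (use assms neg in \<open>auto simp: a_inv_def\<close>)
  then show ?thesis
    using assms by (auto simp: left_ideal_def additive_subgroup_def)
qed

lemma left_idealD:
  fixes R (structure)
  assumes "ring R" "left_ideal R I"
  shows "I \<subseteq> carrier R" "\<zero>\<^bsub>R\<^esub> \<in> I" "\<And>a b. a \<in> I \<Longrightarrow> b \<in> I \<Longrightarrow> a \<oplus>\<^bsub>R\<^esub> b \<in> I"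
    "\<And>a b. a \<in> I \<Longrightarrow> b \<in> I \<Longrightarrow> a \<ominus>\<^bsub>R\<^esub> b \<in> I"
    "\<And>a x. a \<in> carrier R \<Longrightarrow> x \<in> I \<Longrightarrow> a \<otimes>\<^bsub>R\<^esub> x \<in> I"
proof -
  interpret ring R by fact
  interpret additive_subgroup I R using assms by (simp add: left_ideal_def)
  show "I \<subseteq> carrier R" "\<zero>\<^bsub>R\<^esub> \<in> I" "\<And>a b. a \<in> I \<Longrightarrow> b \<in> I \<Longrightarrow> a \<oplus>\<^bsub>R\<^esub> b \<in> I"
    using a_subset by auto
  show "\<And>a b. a \<in> I \<Longrightarrow> b \<in> I \<Longrightarrow> a \<ominus>\<^bsub>R\<^esub> b \<in> I"
    by (simp add: minus_eq)
  show "\<And>a x. a \<in> carrier R \<Longrightarrow> x \<in> I \<Longrightarrow> a \<otimes>\<^bsub>R\<^esub> x \<in> I"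
    using assms by (simp add: left_ideal_def)
qed

lemma left_ideal_finsum:
  fixes R (structure)
  assumes "ring R" "left_ideal R I" "finite F" "\<And>i. i \<in> F \<Longrightarrow> f i \<in> I"
  shows "(\<Oplus>\<^bsub>R\<^esub>i\<in>F. f i) \<in> I"
proof -
  interpret ring R by fact
  note I = left_idealD[OF assms(1,2)]
  show ?thesis using assms(3,4)
  proof (induction F rule: finite_induct)
    case empty show ?case by (simp add: I(2))
  next
    case (insert x F)
    then have "f \<in> F \<rightarrow> carrier R" "f x \<in> carrier R" using I(1) by auto
    then show ?case using insert I(3) by simp
  qed
qed

lemma left_ideal_Int:
  fixes R (structure)
  assumes "ring R" "left_ideal R I" "left_ideal R J"
  shows "left_ideal R (I \<inter> J)"
  by (rule left_idealI[OF assms(1)])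
     (use left_idealD[OF assms(1,2)] left_idealD[OF assms(1,3)] in auto)

lemma left_ideal_mult:
  fixes R (structure)
  assumes "ring R" "left_ideal R I" "w \<in> carrier R"
  shows "left_ideal R ((\<lambda>b. b \<otimes>\<^bsub>R\<^esub> w) ` I)"
proof -
  interpret ring R by fact
  note I = left_idealD[OF assms(1,2)]
  show ?thesis
  proof (rule left_idealI[OF assms(1)])
    show "\<zero> \<in> (\<lambda>b. b \<otimes> w) ` I" using I(2) assms(3) by (intro image_eqI[of _ _ \<zero>]) auto
    show "a \<oplus> b \<in> (\<lambda>b. b \<otimes> w) ` I" if ab: "a \<in> (\<lambda>b. b \<otimes> w) ` I" "b \<in> (\<lambda>b. b \<otimes> w) ` I" for a b
    proof -
      obtain a' b' where "a' \<in> I" "b' \<in> I" "a = a' \<otimes> w" "b = b' \<otimes> w" using ab by blast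
      then show ?thesis using I assms(3)
        by (intro image_eqI[of _ _ "a' \<oplus> b'"]) (auto simp: l_distr subset_iff)
    qed
    show "a \<otimes> x \<in> (\<lambda>b. b \<otimes> w) ` I" if ax: "a \<in> carrier R" "x \<in> (\<lambda>b. b \<otimes> w) ` I" for a x
    proof -
      obtain x' where "x' \<in> I" "x = x' \<otimes> w" using ax by auto
      then show ?thesis using I assms(3) ax
        by (intro image_eqI[of _ _ "a \<otimes> x'"]) (auto simp: m_assoc subset_iff)
    qed
  qed (use I(1) assms(3) in auto)
qed

lemma left_ideal_annihilator:
  fixes R (structure)
  assumes "ring R" "left_ideal R I" "w \<in> carrier R"
  shows "left_ideal R {y \<in> I. y \<otimes>\<^bsub>R\<^esub> w = \<zero>\<^bsub>R\<^esub>}"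
proof -
  interpret ring R by fact
  note I = left_idealD[OF assms(1,2)]
  show ?thesis
    by (rule left_idealI[OF assms(1)]) (use I assms(3) in \<open>auto simp: l_distr m_assoc subset_iff\<close>)
qed

lemma left_ideal_carrier: "ring R \<Longrightarrow> left_ideal R (carrier R)"
  by (rule left_idealI) (auto simp: ring.ring_simprules)

text \<open>Semiprimeness of the quotient by J, without forming it. Split the unit into parts v in
  simple left ideals I. Either I lies in J, or I meets J in 0; in that case an x v outside J would
  be nonzero and generate I, so that v = b x v and x v = (x b x) v would lie in J after all.\<close>

lemma semisimple_imp_semiprime_mod:
  fixes R (structure)
  assumes R: "ring R" and ss: "semisimple_ring R" and J: "ideal J R" and x: "x \<in> carrier R"
    and xbx: "\<And>b. b \<in> carrier R \<Longrightarrow> x \<otimes>\<^bsub>R\<^esub> b \<otimes>\<^bsub>R\<^esub> x \<in> J"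
  shows "x \<in> J"
proof -
  interpret ring R by fact
  interpret J: ideal J R by fact
  have lJ: "left_ideal R J"
    by (rule left_idealI) (use R J.a_subset in \<open>auto intro: J.I_l_closed\<close>)
  obtain F where F: "finite F" "\<And>I. I \<in> F \<Longrightarrow> simple_left_ideal R I"
    and dec: "\<And>x. x \<in> carrier R \<Longrightarrow> \<exists>f. f \<in> (\<Pi>\<^sub>E I\<in>F. I) \<and> x = (\<Oplus>I\<in>F. f I)"
    using ss unfolding semisimple_ring_def by (metis (no_types, lifting))
  obtain f where f: "f \<in> (\<Pi>\<^sub>E I\<in>F. I)" "\<one> = (\<Oplus>I\<in>F. f I)" using dec[of \<one>] by auto
  have fc: "f I \<in> carrier R" if "I \<in> F" for I
    using f(1) F(2)[OF that] left_idealD(1)[OF R, of I] that unfolding simple_left_ideal_def by (auto simp: PiE_iff)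
  have "x = x \<otimes> (\<Oplus>I\<in>F. f I)" using f(2) x by (metis r_one)
  also have "\<dots> = (\<Oplus>I\<in>F. x \<otimes> f I)"
    by (rule finsum_rdistr) (use F x fc in auto)
  also have "\<dots> \<in> J"
  proof (rule left_ideal_finsum[OF R lJ F(1)])
    fix I assume I: "I \<in> F"
    have lI: "left_ideal R I" and min: "\<And>K. left_ideal R K \<Longrightarrow> K \<subseteq> I \<Longrightarrow> K = {\<zero>} \<or> K = I"
      using F(2)[OF I] by (auto simp: simple_left_ideal_def)
    note I' = left_idealD[OF R lI]
    define v where "v = f I"
    have v: "v \<in> I" "v \<in> carrier R" using f(1) I fc by (auto simp: v_def)
    have xv: "x \<otimes> v \<in> I" "x \<otimes> v \<in> carrier R" using I' v x by auto
    consider "I \<inter> J = {\<zero>}" | "I \<subseteq> J" using min[OF left_ideal_Int[OF R lI lJ]] by blast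
    then show "x \<otimes> f I \<in> J"
    proof cases
      case 2
      then show ?thesis using I'(5)[OF x] v by (auto simp: v_def)
    next
      case 1
      show ?thesis
      proof (rule ccontr)
        assume nJ: "x \<otimes> f I \<notin> J"
        let ?K = "(\<lambda>b. b \<otimes> (x \<otimes> v)) ` carrier R"
        have "left_ideal R ?K" by (rule left_ideal_mult[OF R left_ideal_carrier[OF R] xv(2)])
        moreover have "?K \<subseteq> I" using I' xv by auto
        moreover have "x \<otimes> v \<in> ?K" using xv by (intro image_eqI[of _ _ \<one>]) auto
        moreover have "x \<otimes> v \<noteq> \<zero>" using nJ by (auto simp: v_def)
        ultimately have "?K = I" using min[of ?K] by auto
        then obtain b where b: "b \<in> carrier R" "v = b \<otimes> (x \<otimes> v)" using v by auto
        have "x \<otimes> v = (x \<otimes> b \<otimes> x) \<otimes> v" using b v x by (metis m_assoc m_closed)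
        also have "\<dots> \<in> J" using xbx[OF b(1)] v by (simp add: J.I_r_closed)
        finally show False using nJ by (simp add: v_def)
      qed
    qed
  qed
  finally show ?thesis .
qed

text \<open>Brauer's lemma on minimal left ideals: for u in I with x u nonzero, right multiplication
  by u is bijective on I as in Schur's lemma, and the e in I with e u = u is a right unit of
  I.\<close>

lemma semiprime_imp_idempotent:
  fixes R (structure)
  assumes R: "ring R" and min: "simple_left_ideal R I"
    and semiprime: "\<And>x. x \<in> carrier R \<Longrightarrow> x \<noteq> \<zero>\<^bsub>R\<^esub> \<Longrightarrow> \<exists>b\<in>carrier R. x \<otimes>\<^bsub>R\<^esub> b \<otimes>\<^bsub>R\<^esub> x \<noteq> \<zero>\<^bsub>R\<^esub>"
  shows "\<exists>e\<in>I. e \<noteq> \<zero>\<^bsub>R\<^esub> \<and> (\<forall>y\<in>I. y \<otimes>\<^bsub>R\<^esub> e = y)"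
proof -
  interpret ring R by fact
  have lI: "left_ideal R I" and ne: "I \<noteq> {\<zero>}"
    and min: "\<And>K. left_ideal R K \<Longrightarrow> K \<subseteq> I \<Longrightarrow> K = {\<zero>} \<or> K = I"
    using min by (auto simp: simple_left_ideal_def)
  note I = left_idealD[OF R lI]
  obtain x where x: "x \<in> I" "x \<noteq> \<zero>" using ne I(2) by auto
  then have xc: "x \<in> carrier R" using I by auto
  obtain b where b: "b \<in> carrier R" "x \<otimes> b \<otimes> x \<noteq> \<zero>" using semiprime[OF xc x(2)] by auto
  \<comment> \<open>Some x b x is nonzero, so u = b x is an element of I that x does not
    annihilate.\<close>
  define u where "u = b \<otimes> x"
  have u: "u \<in> I" "u \<in> carrier R" "x \<otimes> u \<noteq> \<zero>" using b xc x I by (auto simp: u_def m_assoc)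
  have "left_ideal R ((\<lambda>y. y \<otimes> u) ` I)" by (rule left_ideal_mult[OF R lI u(2)])
  moreover have "(\<lambda>y. y \<otimes> u) ` I \<subseteq> I" using I u by auto
  moreover have "x \<otimes> u \<in> (\<lambda>y. y \<otimes> u) ` I" using x by auto
  ultimately have "(\<lambda>y. y \<otimes> u) ` I = I" using min[of "(\<lambda>y. y \<otimes> u) ` I"] u(3) by auto
  then obtain e where e: "e \<in> I" "u = e \<otimes> u" using u by auto
  have ec: "e \<in> carrier R" using e I by auto
  have "left_ideal R {y \<in> I. y \<otimes> u = \<zero>}" by (rule left_ideal_annihilator[OF R lI u(2)])
  moreover have "{y \<in> I. y \<otimes> u = \<zero>} \<noteq> I" using x u(3) by auto
  ultimately have ann: "{y \<in> I. y \<otimes> u = \<zero>} = {\<zero>}" using min by blast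
  have "(y \<ominus> y \<otimes> e) \<otimes> u = \<zero>" if y: "y \<in> I" for y
  proof -
    have yc: "y \<in> carrier R" using y I by auto
    have "y \<otimes> e \<otimes> u = y \<otimes> u" using e(2) yc ec u by (metis m_assoc)
    then show ?thesis using yc ec u by (simp add: minus_eq l_distr l_minus r_neg)
  qed
  moreover have "y \<ominus> y \<otimes> e \<in> I" if y: "y \<in> I" for y
    using I(4)[OF y I(5)[of y e]] y e(1) I(1) by auto
  ultimately have z: "y \<ominus> y \<otimes> e = \<zero>" if "y \<in> I" for y using ann that by blast
  have "y \<otimes> e = y" if "y \<in> I" for y
    using z[OF that] that I(1) ec by (metis add.inv_solve_right' l_zero m_closed minus_eq subsetD zero_closed)
  moreover have "e \<noteq> \<zero>" using e u xc by auto
  ultimately show ?thesis using e by auto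
qed

text \<open>\<open>\<mu>\<close> stands for a dimension: its strict growth supplies both minimal
  left ideals and the induction. A right unit e of a minimal left ideal I inside L splits L into I
  and the kernel of right multiplication by e, to which the induction hypothesis applies.\<close>

lemma semiprime_imp_semisimple:
  fixes R (structure) and \<mu> :: "'a set \<Rightarrow> nat"
  assumes R: "ring R"
    and semiprime: "\<And>x. x \<in> carrier R \<Longrightarrow> x \<noteq> \<zero>\<^bsub>R\<^esub> \<Longrightarrow> \<exists>b\<in>carrier R. x \<otimes>\<^bsub>R\<^esub> b \<otimes>\<^bsub>R\<^esub> x \<noteq> \<zero>\<^bsub>R\<^esub>"
    and mono: "\<And>I J. left_ideal R I \<Longrightarrow> left_ideal R J \<Longrightarrow> I \<subset> J \<Longrightarrow> \<mu> I < \<mu> J"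
  shows "semisimple_ring R"
proof -
  interpret ring R by fact
  have minimal: "\<exists>I\<subseteq>L. simple_left_ideal R I" if L: "left_ideal R L" "L \<noteq> {\<zero>}" for L
  proof -
    define Q where "Q I \<longleftrightarrow> left_ideal R I \<and> I \<noteq> {\<zero>} \<and> I \<subseteq> L" for I
    have "Q L" using L by (simp add: Q_def)
    then obtain I where I: "Q I" "\<And>K. Q K \<Longrightarrow> \<mu> I \<le> \<mu> K"
      using ex_has_least_nat[of Q L \<mu>] by blast
    have "simple_left_ideal R I"
      unfolding simple_left_ideal_def
    proof (intro conjI allI impI)
      fix K assume K: "left_ideal R K" "K \<subseteq> I"
      show "K = {\<zero>} \<or> K = I"
      proof (rule ccontr)
        assume "\<not> ?thesis"
        then have K': "Q K" "K \<subset> I" using K I(1) by (auto simp: Q_def)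
        have "left_ideal R I" using I(1) by (simp add: Q_def)
        then show False using mono[OF K(1) _ K'(2)] I(2)[OF K'(1)] by simp
      qed
    qed (use I in \<open>auto simp: Q_def\<close>)
    then show ?thesis using I by (auto simp: Q_def)
  qed
  have "\<exists>F. finite F \<and> (\<forall>I\<in>F. simple_left_ideal R I \<and> I \<subseteq> L) \<and>
          (\<forall>x\<in>L. \<exists>!f. f \<in> (\<Pi>\<^sub>E I\<in>F. I) \<and> x = (\<Oplus>I\<in>F. f I))" if "left_ideal R L" for L
    using that
  proof (induction "\<mu> L" arbitrary: L rule: less_induct)
    case less
    note L = left_idealD[OF R less.prems]
    show ?case
    proof (cases "L = {\<zero>}")
      case True
      then show ?thesis by (intro exI[of _ "{}"]) auto
    next
      case False
      obtain I where I: "I \<subseteq> L" "simple_left_ideal R I" using minimal[OF less.prems False] by auto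
      have lI: "left_ideal R I" using I by (simp add: simple_left_ideal_def)
      note I' = left_idealD[OF R lI]
      obtain e where e: "e \<in> I" "e \<noteq> \<zero>" "\<And>y. y \<in> I \<Longrightarrow> y \<otimes> e = y"
        using semiprime_imp_idempotent[OF R I(2) semiprime] by auto
      have ec: "e \<in> carrier R" using e I' by auto
      \<comment> \<open>Since e is idempotent, x = x e + (x - x e) is the decomposition of x in L
        along I and L'.\<close>
      define L' where "L' = {y \<in> L. y \<otimes> e = \<zero>}"
      have lL': "left_ideal R L'" unfolding L'_def by (rule left_ideal_annihilator[OF R less.prems ec])
      note L' = left_idealD[OF R lL']
      have "e \<in> L - L'" using e(1,2) e(3)[OF e(1)] I(1) by (auto simp: L'_def)
      then have "L' \<subset> L" by (auto simp: L'_def)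
      from less.hyps[OF mono[OF lL' less.prems this] lL']
      obtain F where F1: "finite F" "\<forall>K\<in>F. simple_left_ideal R K \<and> K \<subseteq> L'"
        and dec1: "\<forall>x\<in>L'. \<exists>!f. f \<in> (\<Pi>\<^sub>E I\<in>F. I) \<and> x = (\<Oplus>I\<in>F. f I)"
        by (elim exE conjE)
      have F: "finite F" "\<And>K. K \<in> F \<Longrightarrow> simple_left_ideal R K" "\<And>K. K \<in> F \<Longrightarrow> K \<subseteq> L'"
        using F1 by simp_all
      note dec = bspec[OF dec1]
      have notin: "I \<notin> F"
      proof
        assume "I \<in> F"
        then have "e \<in> L'" using F(3) e(1) by blast
        with \<open>e \<in> L - L'\<close> show False by simp
      qed
      have sumL': "(\<Oplus>K\<in>F. f K) \<in> L'" if "\<And>K. K \<in> F \<Longrightarrow> f K \<in> K" for f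
        by (rule left_ideal_finsum[OF R lL' F(1)]) (use F(3) that in blast)
      have fcF: "f K \<in> carrier R" if "\<And>K. K \<in> F \<Longrightarrow> f K \<in> K" "K \<in> F" for f K
        using that F(3) L'(1) by blast
      have ex1: "\<exists>!f. f \<in> (\<Pi>\<^sub>E K\<in>insert I F. K) \<and> x = (\<Oplus>K\<in>insert I F. f K)" if x: "x \<in> L" for x
      proof -
        have xc: "x \<in> carrier R" using x L by auto
        have xe: "x \<otimes> e \<in> I" "x \<otimes> e \<in> carrier R" using I' e xc by auto
        define d where "d = x \<ominus> x \<otimes> e"
        have "d \<in> L" using x L xe I(1) by (auto simp: d_def)
        moreover have "d \<otimes> e = \<zero>"
          using xc ec e(1) e(3)[OF e(1)] by (simp add: d_def minus_eq l_distr l_minus m_assoc r_neg)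
        ultimately have dL': "d \<in> L'" by (simp add: L'_def)
        have dc: "d \<in> carrier R" using dL' L'(1) by auto
        have xd: "x = x \<otimes> e \<oplus> d" using xc xe ec unfolding d_def minus_eq
          by (metis a_comm a_inv_closed add.inv_solve_right' minus_eq add.m_closed)
        have "\<exists>f. (f \<in> (\<Pi>\<^sub>E I\<in>F. I) \<and> d = (\<Oplus>I\<in>F. f I)) \<and>
            (\<forall>g. g \<in> (\<Pi>\<^sub>E I\<in>F. I) \<and> d = (\<Oplus>I\<in>F. g I) \<longrightarrow> g = f)"
          using dec[OF dL'] unfolding Ex1_def .
        then obtain f where f: "f \<in> (\<Pi>\<^sub>E I\<in>F. I)" "d = (\<Oplus>I\<in>F. f I)"
          and fu: "\<forall>g. g \<in> (\<Pi>\<^sub>E I\<in>F. I) \<and> d = (\<Oplus>I\<in>F. g I) \<longrightarrow> g = f"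
          by (elim exE conjE)
        show ?thesis
        proof (rule ex1I[of _ "f(I := x \<otimes> e)"], intro conjI)
          show "f(I := x \<otimes> e) \<in> (\<Pi>\<^sub>E K\<in>insert I F. K)" using f(1) xe
            by (auto simp: PiE_iff extensional_def)
          have "(\<Oplus>K\<in>F. (f(I := x \<otimes> e)) K) = (\<Oplus>K\<in>F. f K)"
            by (rule finsum_cong') (use notin f fcF in auto)
          moreover have "(f(I := x \<otimes> e)) I = x \<otimes> e" by simp
          moreover have "(f(I := x \<otimes> e)) \<in> F \<rightarrow> carrier R" using notin f fcF by auto
          ultimately show "x = (\<Oplus>K\<in>insert I F. (f(I := x \<otimes> e)) K)"
            using finsum_insert[OF F(1) notin, of "f(I := x \<otimes> e)"] xe f(2) xd
            by (simp del: fun_upd_apply)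
        next
          fix g assume g: "g \<in> (\<Pi>\<^sub>E K\<in>insert I F. K) \<and> x = (\<Oplus>K\<in>insert I F. g K)"
          define h where "h = restrict g F"
          have gI: "g I \<in> I" "g I \<in> carrier R" and gF: "\<And>K. K \<in> F \<Longrightarrow> g K \<in> K"
            using g I' by auto
          have S: "(\<Oplus>K\<in>F. g K) \<in> L'" by (rule sumL'[OF gF])
          then have Sc: "(\<Oplus>K\<in>F. g K) \<in> carrier R" and Se: "(\<Oplus>K\<in>F. g K) \<otimes> e = \<zero>"
            using L'(1) by (auto simp: L'_def)
          have xg: "x = g I \<oplus> (\<Oplus>K\<in>F. g K)"
            using g finsum_insert[OF F(1) notin, of g] gI fcF[OF gF] by auto
          \<comment> \<open>Right multiplication by e kills the part in L' and fixes the part in I,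
            which recovers the component at I.\<close>
          then have "x \<otimes> e = g I" using Se Sc gI ec e(3)[OF gI(1)] by (simp add: l_distr)
          have "d = (\<Oplus>K\<in>F. g K)"
            using xg \<open>x \<otimes> e = g I\<close> xd gI Sc dc by (metis a_comm add.right_cancel)
          moreover have "(\<Oplus>K\<in>F. h K) = (\<Oplus>K\<in>F. g K)"
            by (rule finsum_cong') (use fcF[OF gF] in \<open>auto simp: h_def\<close>)
          ultimately have "d = (\<Oplus>K\<in>F. h K)" by simp
          moreover have "h \<in> (\<Pi>\<^sub>E K\<in>F. K)" using gF by (auto simp: h_def)
          ultimately have "h = f" using fu by simp
          moreover have "g \<in> extensional (insert I F)" using g by (auto simp: PiE_iff)
          moreover note \<open>x \<otimes> e = g I\<close>
          ultimately show "g = f(I := x \<otimes> e)"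
            by (intro ext) (metis extensional_arb fun_upd_apply h_def insert_iff restrict_apply)
        qed
      qed
      have "\<forall>K\<in>insert I F. simple_left_ideal R K \<and> K \<subseteq> L"
        using F I \<open>L' \<subset> L\<close> by blast
      moreover have "finite (insert I F)" using F(1) by simp
      ultimately show ?thesis
        by (intro exI[of _ "insert I F"] conjI) (assumption | rule ballI, rule ex1, assumption)+
    qed
  qed
  from this[OF left_ideal_carrier[OF R]]
  obtain F where F: "finite F" "\<forall>I\<in>F. simple_left_ideal R I \<and> I \<subseteq> carrier R"
    and dec: "\<forall>x\<in>carrier R. \<exists>!f. f \<in> (\<Pi>\<^sub>E I\<in>F. I) \<and> x = (\<Oplus>I\<in>F. f I)"
    by (elim exE conjE)
  have "\<forall>I\<in>F. simple_left_ideal R I" using F(2) by simp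
  with F(1) dec show ?thesis unfolding semisimple_ring_def by (intro exI[of _ F] conjI)
qed

section \<open>Eigenvalues of Jucys-Murphy elements\<close>

lemma commute_prod_list:
  fixes a :: "'a::monoid_mult"
  assumes "\<And>x. x \<in> set xs \<Longrightarrow> a * f x = f x * a"
  shows "a * prod_list (map f xs) = prod_list (map f xs) * a"
  using assms
proof (induction xs)
  case (Cons x xs)
  then have "a * f x = f x * a" "a * prod_list (map f xs) = prod_list (map f xs) * a" by auto
  then show ?case by simp (metis mult.assoc)
qed simp

text \<open>D is the divided difference (p(Z) - p(X)) / (Z - X) of the polynomial p with roots
  \<open>cs\<close>. The relation s X = Z s - 1 of the degenerate affine Hecke algebra, which links
  the Jucys-Murphy elements X and Z of consecutive points, carries over from X to p(X) with D as
  correction term.\<close>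

lemma divided_difference:
  fixes s X Z :: "'a::ring_1"
  assumes "s * X = Z * s - 1" "X * Z = Z * X"
  shows "\<exists>D. D * Z = Z * D \<and> D * X = X * D \<and>
    D * (Z - X) = prod_list (map (\<lambda>c::int. Z - of_int c) cs) - prod_list (map (\<lambda>c. X - of_int c) cs) \<and>
    s * prod_list (map (\<lambda>c. X - of_int c) cs) = prod_list (map (\<lambda>c. Z - of_int c) cs) * s - D"
proof (induction cs)
  case Nil
  show ?case by (intro exI[of _ 0]) auto
next
  case (Cons c cs)
  define pX where "pX = prod_list (map (\<lambda>c. X - of_int c) cs)"
  define pZ where "pZ = prod_list (map (\<lambda>c. Z - of_int c) cs)"
  obtain D where D: "D * Z = Z * D" "D * X = X * D" "D * (Z - X) = pZ - pX" "s * pX = pZ * s - D"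
    using Cons.IH unfolding pX_def pZ_def by blast
  have cX: "X * of_int m = of_int m * X" "Z * of_int m = of_int m * Z" "D * of_int m = of_int m * D" "s * of_int m = of_int m * s" for m
    by (simp_all add: mult_of_int_commute)
  have pXX: "pX * X = X * pX"
    unfolding pX_def
    by (rule commute_prod_list[symmetric]) (simp add: left_diff_distrib right_diff_distrib cX)
  have pXZ: "pX * Z = Z * pX"
    unfolding pX_def
    by (rule commute_prod_list[symmetric]) (simp add: left_diff_distrib right_diff_distrib cX assms(2))
  \<comment> \<open>Leibniz rule for the divided difference of (x - c) p(x).\<close>
  define D' where "D' = (Z - of_int c) * D + pX"
  have "(Z - of_int c) * D * Z = (Z - of_int c) * Z * D" "(Z - of_int c) * D * X = (Z - of_int c) * X * D"
    by (simp_all add: mult.assoc D)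
  moreover have "(Z - of_int c) * Z = Z * (Z - of_int c)" "(Z - of_int c) * X = X * (Z - of_int c)"
    by (simp_all add: left_diff_distrib right_diff_distrib cX assms(2))
  ultimately have "D' * Z = Z * D'" "D' * X = X * D'"
    by (simp_all add: D'_def distrib_left distrib_right pXX pXZ mult.assoc)
  moreover have "D' * (Z - X) = (Z - of_int c) * pZ - (X - of_int c) * pX"
  proof -
    have "D' * (Z - X) = (Z - of_int c) * (D * (Z - X)) + pX * (Z - X)"
      by (simp add: D'_def distrib_right mult.assoc)
    also have "\<dots> = (Z - of_int c) * pZ - (X - of_int c) * pX"
      unfolding D(3) using pXX pXZ by (simp add: algebra_simps)
    finally show ?thesis .
  qed
  moreover have "s * ((X - of_int c) * pX) = (Z - of_int c) * pZ * s - D'"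
  proof -
    have "s * ((X - of_int c) * pX) = (s * X) * pX - of_int c * (s * pX)"
      using cX(4)[of c] by (simp add: algebra_simps) (metis mult.assoc)
    also have "\<dots> = (Z - of_int c) * (s * pX) - pX"
      unfolding assms(1) by (simp add: algebra_simps)
    also have "\<dots> = (Z - of_int c) * pZ * s - D'"
      unfolding D(4) by (simp add: D'_def algebra_simps)
    finally show ?thesis .
  qed
  ultimately show ?case
    by (intro exI[of _ D']) (simp add: pX_def pZ_def mult.assoc)
qed

text \<open>In terms of spectra: an eigenvalue of Z is one of X or differs from one by 1.
  Algebraically, p(X) = 0 implies that p(Z) annihilates (Z - X)^2 - 1, and modulo this element (Z -
  c)^2 - 1 is divisible by X - c.\<close>

lemma spectrum_step:
  fixes s X Z :: "'a::ring_1" and cs :: "int list"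
  assumes s2: "s * s = 1" and sX: "s * X = Z * s - 1" and XZ: "X * Z = Z * X"
    and pX: "prod_list (map (\<lambda>c. X - of_int c) cs) = 0"
  shows "prod_list (map (\<lambda>c. Z - of_int c) (cs @ concat (map (\<lambda>c. [c + 1, c - 1]) cs))) = 0"
proof -
  define pZ where "pZ = prod_list (map (\<lambda>c. Z - of_int c) cs)"
  obtain D where D: "D * Z = Z * D" "D * X = X * D" "D * (Z - X) = pZ" "0 = pZ * s - D"
    using divided_difference[OF sX XZ, of cs] pX by (auto simp: pZ_def)
  define g where "g = (Z - X) * (Z - X) - 1"
  have Ds: "D * s = D * (Z - X)" using D(3,4) s2 by (metis eq_iff_diff_eq_0 mult.assoc mult.right_neutral)
  have "s * Z = X * s + 1"
  proof -
    have "s * X * s = Z - s" using sX s2 by (simp add: left_diff_distrib mult.assoc)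
    then have "s * (s * X * s) = s * Z - 1" by (simp add: right_diff_distrib s2)
    moreover have "s * (s * X * s) = X * s" using s2 by (metis mult.assoc mult_1)
    ultimately show ?thesis by (simp add: algebra_simps)
  qed
  then have sZX: "s * (Z - X) = 2 - (Z - X) * s"
    by (simp add: right_diff_distrib left_diff_distrib sX flip: one_add_one)
  \<comment> \<open>Because p(X) = 0, D s equals D (Z - X). As s anticommutes with Z - X up to the
    constant 2, this gives D (Z - X)^2 = D.\<close>
  have "D * ((Z - X) * (Z - X)) = D * s * (Z - X)" by (simp add: Ds mult.assoc)
  also have "\<dots> = D * (2 - (Z - X) * s)" by (simp add: mult.assoc sZX)
  also have "\<dots> = 2 * D - D * (Z - X) * s" by (simp only: right_diff_distrib mult.assoc[symmetric] mult_2 mult_2_right)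
  also have "D * (Z - X) * s = D" by (metis Ds mult.assoc mult.right_neutral s2)
  also have "2 * D - D = D" by (simp add: mult_2)
  finally have Dg: "D * g = 0" by (simp add: g_def right_diff_distrib)
  have gZX: "(Z - X) * g = g * (Z - X)" by (simp add: g_def algebra_simps)
  have pg: "pZ * g = 0" unfolding D(3)[symmetric] by (metis Dg gZX mult.assoc mult_zero_left)
  have cX: "X * of_int m = of_int m * X" "Z * of_int m = of_int m * Z" for m
    by (simp_all add: mult_of_int_commute)
  have pZZ: "Z * pZ = pZ * Z" "X * pZ = pZ * X" unfolding pZ_def
    by (rule commute_prod_list, simp add: left_diff_distrib right_diff_distrib cX XZ)+
  have ex: "\<exists>Q. pZ * prod_list (map (\<lambda>c. Z - of_int c) (concat (map (\<lambda>c. [c + 1, c - 1]) ds)))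
      = pZ * prod_list (map (\<lambda>c. X - of_int c) ds) * Q" for ds
  proof (induction ds)
    case Nil show ?case by (intro exI[of _ 1]) simp
  next
    case (Cons c ds)
    define w where "w = (Z - of_int (c + 1)) * (Z - of_int (c - 1))"
    define U where "U = prod_list (map (\<lambda>c. Z - of_int c) (concat (map (\<lambda>c. [c + 1, c - 1]) ds)))"
    define V where "V = prod_list (map (\<lambda>c. X - of_int c) ds)"
    define q where "q = 2 * Z - X - of_int c"
    obtain Q where Q: "pZ * U = pZ * V * Q" using Cons.IH unfolding U_def V_def by blast
    \<comment> \<open>w is (Z - c)^2 - 1, and (Z - c)^2 - (Z - X)^2 factors as (X - c) (2 Z - X -
      c).\<close>
    have w: "w = g + (X - of_int c) * q"
      by (simp add: w_def g_def q_def algebra_simps cX XZ mult_2 mult_2_right)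
    have Zq: "Z * q = q * Z" "X * q = q * X"
      by (simp_all add: q_def algebra_simps cX XZ mult_2 mult_2_right)
    have qp: "q * pZ = pZ * q"
      using pZZ mult_of_int_commute[of c pZ] by (simp add: q_def left_diff_distrib right_diff_distrib mult_2 distrib_left distrib_right)
    have qV: "q * V = V * q" unfolding V_def
      by (rule commute_prod_list) (simp add: left_diff_distrib right_diff_distrib Zq mult_of_int_commute[of _ q])
    have Xp: "(X - of_int c) * pZ = pZ * (X - of_int c)" using pZZ mult_of_int_commute[of c pZ]
      by (simp add: left_diff_distrib right_diff_distrib)
    have "pZ * (w * U) = pZ * g * U + pZ * (X - of_int c) * q * U"
      by (simp add: w algebra_simps)
    also have "\<dots> = (X - of_int c) * q * (pZ * U)"
      using pg Xp qp by (simp add: mult.assoc) (metis mult.assoc)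
    also have "\<dots> = pZ * ((X - of_int c) * V) * (q * Q)"
      unfolding Q using Xp qp qV by (metis mult.assoc)
    finally show ?case by (intro exI[of _ "q * Q"]) (simp add: w_def U_def V_def mult.assoc)
  qed
  show ?thesis using ex[of cs] pX by (auto simp: pZ_def)
qed

text \<open>The contents of removable boxes in partitions of n. For n = 2 and n = 3 the content 0 is
  absent; otherwise every integer of absolute value below n occurs.\<close>

definition jm_values :: "nat \<Rightarrow> int set" where
  "jm_values n = (if n = 2 then {-1, 1} else if n = 3 then {-2, -1, 1, 2} else {c. \<bar>c\<bar> < int n})"

lemma jm_values_subset: "c \<in> jm_values n \<Longrightarrow> \<bar>c\<bar> < int n"
  by (auto simp: jm_values_def split: if_splits)

text \<open>Interpreting \<open>t u v\<close> as the transposition of \<open>u\<close> and \<open>v\<close>, the sum below is a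
  Jucys-Murphy element of the symmetric group on \<open>insert z S\<close>, whose eigenvalues are contents of boxes.\<close>

lemma jucys_murphy_annihilated:
  fixes t :: "nat \<Rightarrow> nat \<Rightarrow> 'a::ring_1"
  assumes sym: "\<And>u v. t u v = t v u" and inv: "\<And>u v. u \<noteq> v \<Longrightarrow> t u v * t u v = 1"
    and tri: "\<And>u v w. u \<noteq> v \<Longrightarrow> v \<noteq> w \<Longrightarrow> u \<noteq> w \<Longrightarrow> t u v * t v w = t v w * t u w"
    and com: "\<And>u v w x. u \<noteq> w \<Longrightarrow> u \<noteq> x \<Longrightarrow> v \<noteq> w \<Longrightarrow> v \<noteq> x \<Longrightarrow> u \<noteq> v \<Longrightarrow> w \<noteq> x \<Longrightarrow> t u v * t w x = t w x * t u v"
    and S: "finite S" "z \<notin> S"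
  shows "\<exists>cs. set cs \<subseteq> jm_values (Suc (card S)) \<and>
    prod_list (map (\<lambda>c. (\<Sum>v\<in>S. t v z) - of_int c) cs) = 0"
proof -
  have conj: "t w z * (\<Sum>v\<in>S. t v w) = (\<Sum>v\<in>S. t v z) * t w z"
    if "finite S" "z \<notin> S" "w \<notin> S" "w \<noteq> z" for S z w
    unfolding sum_distrib_left sum_distrib_right
  proof (rule sum.cong)
    fix v assume "v \<in> S"
    then have "v \<noteq> w" "v \<noteq> z" using that by auto
    then show "t w z * t v w = t v z * t w z" using tri[of z w v] tri[of w v z] that
      by (metis sym tri)
  qed simp
  have gen: "\<exists>cs. set cs \<subseteq> {c. \<bar>c\<bar> < int (Suc (card S))} \<and>
    prod_list (map (\<lambda>c. (\<Sum>v\<in>S. t v z) - of_int c) cs) = 0" if "finite S" "z \<notin> S" for S z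
    using that
  proof (induction S arbitrary: z rule: finite_induct)
    case empty
    show ?case by (intro exI[of _ "[0]"]) auto
  next
    case (insert w S)
    \<comment> \<open>The induction adjoins w to S. Conjugation by \<open>t w z\<close> turns the
      sum X centred at w into Z - \<open>t w z\<close>, which is the relation required by
      \<open>spectrum_step\<close>.\<close>
    define X where "X = (\<Sum>v\<in>S. t v w)"
    define Z where "Z = (\<Sum>v\<in>insert w S. t v z)"
    have wz: "w \<noteq> z" "z \<notin> S" using insert by auto
    have Z: "Z = (\<Sum>v\<in>S. t v z) + t w z" using insert by (simp add: Z_def add.commute)
    obtain cs where cs: "set cs \<subseteq> {c. \<bar>c\<bar> < int (Suc (card S))}" "prod_list (map (\<lambda>c. X - of_int c) cs) = 0"
      using insert.IH[of w] insert.hyps unfolding X_def by blast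
    have "t w z * X = Z * t w z - 1"
      using conj[of S z w] insert wz inv[of w z] by (simp add: X_def Z distrib_right)
    moreover have "X * Z = Z * X"
    proof -
      \<comment> \<open>\<open>t v w\<close> exchanges the summands \<open>t v z\<close> and
        \<open>t w z\<close> of Z and commutes with the others.\<close>
      have "t v w * Z = Z * t v w" if v: "v \<in> S" for v
      proof -
        have vw: "v \<noteq> w" "v \<noteq> z" using v insert by auto
        have "Z = t w z + t v z + (\<Sum>u\<in>S - {v}. t u z)"
          using v insert by (simp add: Z_def sum.remove[of S v] add.assoc)
        moreover have "t v w * (\<Sum>u\<in>S - {v}. t u z) = (\<Sum>u\<in>S - {v}. t u z) * t v w"
          unfolding sum_distrib_left sum_distrib_right
        proof (rule sum.cong[OF refl])
          fix u assume "u \<in> S - {v}"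
          then have "u \<noteq> v" "u \<noteq> w" "u \<noteq> z" using insert.hyps wz by auto
          then show "t v w * t u z = t u z * t v w" using com[of v u z w] vw wz by metis
        qed
        moreover have "t v w * t w z = t v z * t v w" "t v w * t v z = t w z * t v w"
          using tri[of v w z] tri[of w v z] tri[of z v w] tri[of v z w] vw wz by (metis sym tri)+
        ultimately show ?thesis by (simp add: algebra_simps)
      qed
      then show ?thesis unfolding X_def sum_distrib_left sum_distrib_right by (rule sum.cong[OF refl])
    qed
    ultimately have "prod_list (map (\<lambda>c. Z - of_int c) (cs @ concat (map (\<lambda>c. [c + 1, c - 1]) cs))) = 0"
      using spectrum_step[of "t w z" X Z cs] inv[OF wz(1)] cs by blast
    moreover have "set (cs @ concat (map (\<lambda>c. [c + 1, c - 1]) cs)) \<subseteq> {c. \<bar>c\<bar> < int (Suc (card (insert w S)))}"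
      using cs(1) insert by (fastforce simp: card_insert_if)
    ultimately show ?case unfolding Z_def by blast
  qed
  \<comment> \<open>The general bound admits the value 0, so the groups on two and three points are
    treated by explicit polynomials.\<close>
  consider "card S = 1" | "card S = 2" | "card S \<noteq> 1" "card S \<noteq> 2" by blast
  then show ?thesis
  proof cases
    case 1
    then obtain a where a: "S = {a}" by (rule card_1_singletonE)
    then have "(t a z - 1) * (t a z + 1) = 0" using inv[of a z] S by (simp add: algebra_simps)
    then show ?thesis using a by (intro exI[of _ "[1, -1]"]) (auto simp: jm_values_def)
  next
    case 2
    then obtain a b where ab: "S = {a, b}" "a \<noteq> b" by (auto simp: card_2_iff)
    define x y where "x = t a z" and "y = t b z"
    have x2: "x * x = 1" "y * y = 1" using ab S inv by (auto simp: x_def y_def)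
    have "x * y = t a b * x" "y * x = x * t a b" "x * y = y * t a b"
      using tri[of a z b] tri[of b z a] tri[of a b z] tri[of z a b] ab S unfolding x_def y_def
      by (metis insert_iff sym tri)+
    then have xyxy: "x * y * x = y * x * y" using x2 by (metis mult.assoc mult.left_neutral mult.right_neutral)
    \<comment> \<open>The sum of the two 3-cycles: it satisfies w^2 = w + 2, with roots 2 and -1,
      and the Jucys-Murphy element x + y has square w + 2.\<close>
    define w where "w = x * y + y * x"
    have xyx: "x * y * x * y = y * x" "y * x * y * x = x * y"
      using xyxy x2 by (metis mult.assoc mult.left_neutral mult.right_neutral)+
    have X2: "(x + y) * (x + y) = w + 2" by (simp add: algebra_simps x2 w_def)
    have "x * y * y * x = 1" "y * x * x * y = 1" using x2 by (metis mult.assoc mult.right_neutral)+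
    then have "w * w = w + 2" using xyx by (simp add: w_def algebra_simps)
    then have w0: "(w - 2) * (w + 1) = 0" by (simp add: algebra_simps mult_2 mult_2_right)
    have "4 * a = a + a + (a + a)" for a :: 'a
    proof -
      have "(4 :: 'a) = 2 + 2" by simp
      then show ?thesis by (simp only: distrib_right mult_2)
    qed
    then have "(x + y - 2) * ((x + y + 2) * ((x + y - 1) * (x + y + 1))) =
        ((x + y) * (x + y) - 4) * ((x + y) * (x + y) - 1)"
      by (simp add: algebra_simps mult_2 mult_2_right)
    also have "\<dots> = (w - 2) * (w + 1)" unfolding X2 by (simp flip: add_diff_eq)
    also have "\<dots> = 0" by (fact w0)
    finally have "(x + y - 2) * ((x + y + 2) * ((x + y - 1) * (x + y + 1))) = 0" .
    then show ?thesis using ab by (intro exI[of _ "[2, -2, 1, -1]"]) (auto simp: jm_values_def x_def y_def)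
  next
    case 3
    then have "jm_values (Suc (card S)) = {c. \<bar>c\<bar> < int (Suc (card S))}" by (simp add: jm_values_def)
    with gen[OF S] show ?thesis by simp
  qed
qed

section \<open>Saturated sets and connected components\<close>

definition saturated :: "'v set set \<Rightarrow> 'v set \<Rightarrow> bool" where
  "saturated E X \<longleftrightarrow> (\<forall>e\<in>E. e \<subseteq> X \<or> e \<inter> X = {})"

text \<open>Blocks are saturated, and no smaller nonempty set inside a block is, so the saturated
  sets determine the blocks.\<close>

lemma partition_eqI:
  assumes "partition_on A C" "partition_on A D" "\<And>X. X \<subseteq> A \<Longrightarrow> saturated C X \<longleftrightarrow> saturated D X"
  shows "C = D"
proof -
  have sub: "C \<subseteq> D" if C: "partition_on A C" and D: "partition_on A D"
    and eq: "\<And>X. X \<subseteq> A \<Longrightarrow> saturated C X \<longleftrightarrow> saturated D X" for C D :: "'a set set"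
  proof
    fix c assume c: "c \<in> C"
    have sC: "saturated C c'" if "c' \<in> C" for c'
      using C that by (auto simp: saturated_def partition_on_def disjoint_def)
    have sD: "saturated D d" if "d \<in> D" for d
      using D that by (auto simp: saturated_def partition_on_def disjoint_def)
    have cA: "c \<subseteq> A" "c \<noteq> {}" using C c by (auto simp: partition_on_def)
    then obtain x where x: "x \<in> c" by auto
    then obtain d where d: "d \<in> D" "x \<in> d" using cA D by (auto simp: partition_on_def)
    have dA: "d \<subseteq> A" using D d by (auto simp: partition_on_def)
    have "saturated D c" using sC[OF c] eq[OF cA(1)] by simp
    then have "d \<subseteq> c" using d x by (auto simp: saturated_def)
    moreover have "saturated C d" using sD[OF d(1)] eq[OF dA] by simp
    then have "c \<subseteq> d" using c x d by (auto simp: saturated_def)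
    ultimately show "c \<in> D" using d by auto
  qed
  show ?thesis using sub[OF assms(1,2)] sub[OF assms(2,1)] assms(3) by blast
qed

lemma partition_on_components: "partition_on (\<Union>E) (components E)"
proof -
  define r where "r = {(u, v). {u, v} \<in> E}\<^sup>*"
  have "sym {(u, v). {u, v} \<in> E}" by (auto simp: sym_def insert_commute)
  then have sym: "sym r" unfolding r_def by (rule sym_rtrancl)
  have trans: "trans r" unfolding r_def by (rule trans_rtrancl)
  have refl: "(x, x) \<in> r" for x by (simp add: r_def)
  have closed: "y \<in> \<Union>E" if "(x, y) \<in> r" "x \<in> \<Union>E" for x y
    using that unfolding r_def by (induction rule: rtrancl_induct) auto
  have cl: "r `` {x} = r `` {y}" if "(x, y) \<in> r" for x y
    using that sym trans by (auto dest: symD transD)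
  show ?thesis
    unfolding components_def r_def[symmetric]
  proof (rule partition_onI)
    show "\<Union> (\<Union> E // r) = \<Union> E"
    proof
      show "\<Union> (\<Union> E // r) \<subseteq> \<Union> E" using closed by (auto simp: quotient_def simp del: Union_iff)
      show "\<Union> E \<subseteq> \<Union> (\<Union> E // r)" using refl by (auto simp: quotient_def)
    qed
    show "{} \<notin> \<Union> E // r" using refl by (auto simp: quotient_def)
    fix p q assume "p \<in> \<Union> E // r" "q \<in> \<Union> E // r" "p \<noteq> q"
    then obtain x y where xy: "p = r `` {x}" "q = r `` {y}" by (auto simp: quotient_def)
    have "z \<notin> q" if "z \<in> p" for z
    proof
      assume "z \<in> q"
      then have "(x, z) \<in> r" "(y, z) \<in> r" using that xy by auto
      then show False using cl[of x z] cl[of y z] xy \<open>p \<noteq> q\<close> by simp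
    qed
    then show "disjnt p q" by (auto simp: disjnt_def)
  qed
qed

lemma saturated_component:
  assumes "saturated E X" "K \<in> components E"
  shows "K \<subseteq> X \<or> K \<inter> X = {}"
proof -
  define r where "r = {(u, v). {u, v} \<in> E}\<^sup>*"
  have *: "x \<in> X \<longleftrightarrow> y \<in> X" if "(x, y) \<in> r" for x y
    using that unfolding r_def
    by (induction rule: rtrancl_induct) (use assms(1) in \<open>auto simp: saturated_def\<close>)
  obtain x where "K = r `` {x}" using assms(2) by (auto simp: components_def quotient_def r_def)
  then show ?thesis using * by auto
qed

lemma edge_subset_component:
  assumes "e \<in> E" "card e = 2" "K \<in> components E" "x \<in> e" "x \<in> K"
  shows "e \<subseteq> K"
proof
  fix y assume y: "y \<in> e"
  define r where "r = {(u, v). {u, v} \<in> E}\<^sup>*"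
  obtain z where z: "K = r `` {z}" using assms(3) by (auto simp: components_def quotient_def r_def)
  show "y \<in> K"
  proof (cases "y = x")
    case False
    then have "e = {x, y}" using assms y by (auto simp: card_2_iff)
    then have "(x, y) \<in> r" using assms by (auto simp: r_def)
    then show ?thesis using z assms(5) by (auto simp: r_def)
  qed (use assms in auto)
qed

text \<open>Saturation propagates along paths, so it can be tested edge by edge and the components
  need never be described.\<close>

lemma saturated_components_iff:
  assumes "\<And>e. e \<in> E \<Longrightarrow> card e = 2"
  shows "saturated (components E) X \<longleftrightarrow> saturated E X"
proof
  assume *: "saturated (components E) X"
  show "saturated E X" unfolding saturated_def
  proof
    fix e assume e: "e \<in> E"
    then obtain x where x: "x \<in> e" using assms[OF e] by (metis card.empty ex_in_conv zero_neq_numeral)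
    then obtain K where K: "K \<in> components E" "x \<in> K"
      using partition_on_components[of E] e by (auto simp: partition_on_def)
    have "e \<subseteq> K" by (rule edge_subset_component[OF e assms[OF e] K(1) x K(2)])
    then show "e \<subseteq> X \<or> e \<inter> X = {}" using * K by (auto simp: saturated_def)
  qed
next
  assume "saturated E X"
  then show "saturated (components E) X"
    unfolding saturated_def[of "components E"] using saturated_component by blast
qed

section \<open>Composing diagrams via saturated sets\<close>

text \<open>Node sets are coded by their labels row by row, so that the middle row of a stacked pair
  becomes a variable to count over.\<close>

definition boundary :: "nat set \<Rightarrow> nat set \<Rightarrow> node set" where
  "boundary f g = North ` f \<union> South ` g"

definition level :: "nat set \<Rightarrow> nat set \<Rightarrow> nat set \<Rightarrow> vertex set" where
  "level f h g = Top ` f \<union> Middle ` h \<union> Bottom ` g"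

lemma subset_nodes_boundary:
  assumes "X \<subseteq> nodes r s"
  obtains f g where "f \<subseteq> {1..r + s}" "g \<subseteq> {1..r + s}" "X = boundary f g"
proof
  show "X = boundary (North -` X) (South -` X)"
    using assms by (auto simp: boundary_def nodes_def)
qed (use assms in \<open>auto simp: nodes_def\<close>)

text \<open>A colouring of the stacked graph is a pair of colourings of A and B that agree on the
  middle row.\<close>

lemma saturated_stacked:
  "saturated (stacked A B) (level f h g) \<longleftrightarrow> saturated A (boundary f h) \<and> saturated B (boundary h g)"
proof -
  have up: "upper x \<in> level f h g \<longleftrightarrow> x \<in> boundary f h" for x
    by (cases x) (auto simp: level_def boundary_def)
  have lo: "lower x \<in> level f h g \<longleftrightarrow> x \<in> boundary h g" for x
    by (cases x) (auto simp: level_def boundary_def)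
  have "upper ` e \<subseteq> level f h g \<longleftrightarrow> e \<subseteq> boundary f h" "upper ` e \<inter> level f h g = {} \<longleftrightarrow> e \<inter> boundary f h = {}"
    "lower ` e \<subseteq> level f h g \<longleftrightarrow> e \<subseteq> boundary h g" "lower ` e \<inter> level f h g = {} \<longleftrightarrow> e \<inter> boundary h g = {}" for e
    using up lo by blast+
  then show ?thesis by (auto simp: saturated_def stacked_def ball_Un)
qed

lemma Union_stacked:
  assumes "partition_on (nodes r s) A" "partition_on (nodes r s) B"
  shows "\<Union>(stacked A B) = level {1..r + s} {1..r + s} {1..r + s}"
proof -
  have "\<Union>(stacked A B) = upper ` \<Union>A \<union> lower ` \<Union>B" by (auto simp: stacked_def)
  also have "\<dots> = upper ` nodes r s \<union> lower ` nodes r s" using assms by (simp add: partition_on_def)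
  also have "\<dots> = level {1..r + s} {1..r + s} {1..r + s}"
    by (simp add: nodes_def level_def image_Un image_image) auto
  finally show ?thesis .
qed

lemma card_stacked:
  assumes "\<And>e. e \<in> A \<Longrightarrow> card e = 2" "\<And>e. e \<in> B \<Longrightarrow> card e = 2" "e \<in> stacked A B"
  shows "card e = 2"
proof -
  have "inj upper" "inj lower" unfolding inj_def by (auto elim!: upper.elims lower.elims)
  then show ?thesis using assms by (auto simp: stacked_def card_image inj_on_subset)
qed

lemma partition_on_concat:
  assumes "partition_on (nodes r s) A" "partition_on (nodes r s) B"
  shows "partition_on (nodes r s) (concat_diagram A B)"
proof -
  have P: "partition_on (level {1..r + s} {1..r + s} {1..r + s}) (components (stacked A B))"
    using partition_on_components[of "stacked A B"] Union_stacked[OF assms] by simp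
  have out: "outer x \<in> level {1..r + s} {1..r + s} {1..r + s} \<longleftrightarrow> x \<in> nodes r s" for x
    by (cases x) (auto simp: level_def nodes_def)
  have notM: "outer x \<notin> range Middle" for x by (cases x) auto
  show ?thesis
  proof (rule partition_onI)
    show "\<Union>(concat_diagram A B) = nodes r s"
    proof (intro Set.set_eqI iffI)
      fix x assume "x \<in> \<Union>(concat_diagram A B)"
      then show "x \<in> nodes r s" using P out by (auto simp: concat_diagram_def partition_on_def)
    next
      fix x assume "x \<in> nodes r s"
      then obtain K where "K \<in> components (stacked A B)" "outer x \<in> K"
        using P out[of x] unfolding partition_on_def by blast
      then show "x \<in> \<Union>(concat_diagram A B)" using notM[of x] unfolding concat_diagram_def by blast
    qed
    have "outer -` K \<noteq> {}" if "\<not> K \<subseteq> range Middle" for K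
    proof -
      obtain v where "v \<in> K" "v \<notin> range Middle" using \<open>\<not> K \<subseteq> range Middle\<close> by auto
      then obtain i where "v = Top i \<or> v = Bottom i" by (cases v) auto
      then have "outer (North i) \<in> K \<or> outer (South i) \<in> K" using \<open>v \<in> K\<close> by auto
      then show ?thesis by blast
    qed
    then show "{} \<notin> concat_diagram A B" unfolding concat_diagram_def by blast
    fix p q assume "p \<in> concat_diagram A B" "q \<in> concat_diagram A B" "p \<noteq> q"
    then obtain K L where "p = outer -` K" "q = outer -` L" "K \<in> components (stacked A B)" "L \<in> components (stacked A B)" "K \<noteq> L"
      by (auto simp: concat_diagram_def)
    then show "disjnt p q" using P unfolding partition_on_def disjoint_def disjnt_def by blast
  qed
qed

text \<open>Colours propagate along components. A component that reaches the outer rows is forced,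
  or contradictory if its outer nodes disagree, whereas each closed loop in the middle can be
  coloured freely. The exponent of \<delta> is thereby read off from a count of colourings.\<close>

lemma card_saturated_middle:
  assumes A: "partition_on (nodes r s) A" "\<And>e. e \<in> A \<Longrightarrow> card e = 2"
    and B: "partition_on (nodes r s) B" "\<And>e. e \<in> B \<Longrightarrow> card e = 2"
    and fg: "f \<subseteq> {1..r + s}" "g \<subseteq> {1..r + s}"
  shows "card {h. h \<subseteq> {1..r + s} \<and> saturated A (boundary f h) \<and> saturated B (boundary h g)} =
    (if saturated (concat_diagram A B) (boundary f g) then 2 ^ loops A B else 0)"
proof -
  define E where "E = stacked A B"
  define V where "V = level {1..r + s} {1..r + s} {1..r + s}"
  define L where "L = {K \<in> components E. K \<subseteq> range Middle}"
  \<comment> \<open>The components forced into the coloured set by their outer nodes.\<close>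
  define N where "N = {K \<in> components E. \<not> K \<subseteq> range Middle \<and> outer -` K \<subseteq> boundary f g}"
  define H where "H = {h. h \<subseteq> {1..r + s} \<and> saturated A (boundary f h) \<and> saturated B (boundary h g)}"
  have P: "partition_on V (components E)"
    using partition_on_components[of E] Union_stacked[OF A(1) B(1)] by (simp add: E_def V_def)
  have E2: "card e = 2" if "e \<in> E" for e
    using card_stacked[of A B] A(2) B(2) that by (auto simp: E_def)
  have UV: "K \<subseteq> V" if "K \<in> components E" for K using P that by (auto simp: partition_on_def)
  have finV: "finite V" by (simp add: V_def level_def)
  have finL: "finite L" using finite_elements[OF finV P] by (simp add: L_def)
  have Hsat: "h \<in> H \<longleftrightarrow> h \<subseteq> {1..r + s} \<and> saturated (components E) (level f h g)" for h
    by (simp add: H_def saturated_components_iff[OF E2] E_def saturated_stacked)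
  have lev: "outer x \<in> level f h g \<longleftrightarrow> x \<in> boundary f g" for x h
    by (cases x) (auto simp: level_def boundary_def)
  have outV: "\<exists>x. v = outer x" if "v \<notin> range Middle" for v
    using that by (cases v) (metis outer.simps, auto, metis outer.simps)
  have conc: "saturated (concat_diagram A B) (boundary f g)" if h: "h \<in> H" for h
    unfolding saturated_def concat_diagram_def
  proof
    fix e assume "e \<in> (\<lambda>K. outer -` K) ` {K \<in> components (stacked A B). \<not> K \<subseteq> range Middle}"
    then obtain K where K: "e = outer -` K" "K \<in> components E" by (auto simp: E_def)
    then have "K \<subseteq> level f h g \<or> K \<inter> level f h g = {}" using h Hsat by (auto simp: saturated_def)
    then show "e \<subseteq> boundary f g \<or> e \<inter> boundary f g = {}" using K lev by blast
  qed
  \<comment> \<open>The middle row obtained by colouring the forced components and a free choice S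
    of loops.\<close>
  define G where "G S = Middle -` (\<Union>N \<union> \<Union>S)" for S
  \<comment> \<open>Coherence of the outer colours ensures that the forced components contain
    exactly the coloured outer nodes.\<close>
  have levG: "level f (G S) g = \<Union>N \<union> \<Union>S"
    if S: "S \<subseteq> L" and c: "saturated (concat_diagram A B) (boundary f g)" for S
  proof -
    have "v \<in> level f (G S) g \<longleftrightarrow> v \<in> \<Union>N \<union> \<Union>S" for v
    proof (cases "v \<in> range Middle")
      case True
      then show ?thesis by (auto simp: level_def G_def)
    next
      case False
      then obtain x where x: "v = outer x" using outV by blast
      have nS: "v \<notin> \<Union>S" using S False by (auto simp: L_def)
      have "x \<in> boundary f g \<longleftrightarrow> outer x \<in> \<Union>N"
      proof
        assume xb: "x \<in> boundary f g"
        then have "outer x \<in> V" using fg by (cases x) (auto simp: boundary_def V_def level_def)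
        then obtain K where K: "K \<in> components E" "outer x \<in> K" using P by (auto simp: partition_on_def)
        have nM: "\<not> K \<subseteq> range Middle" using K(2) False x by auto
        then have "outer -` K \<in> concat_diagram A B" using K by (auto simp: concat_diagram_def E_def)
        then have "outer -` K \<subseteq> boundary f g \<or> outer -` K \<inter> boundary f g = {}"
          using c unfolding saturated_def by (rule bspec[rotated])
        moreover have "x \<in> outer -` K \<inter> boundary f g" using xb K(2) by simp
        ultimately have "outer -` K \<subseteq> boundary f g" by (metis empty_iff)
        then show "outer x \<in> \<Union>N" using K nM by (auto simp: N_def)
      next
        assume "outer x \<in> \<Union>N"
        then show "x \<in> boundary f g" by (auto simp: N_def)
      qed
      then show ?thesis using x nS lev by auto
    qed
    then show ?thesis by blast
  qed
  show ?thesis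
  proof (cases "saturated (concat_diagram A B) (boundary f g)")
    case False
    then have "H = {}" using conc by auto
    then show ?thesis using False by (simp add: H_def)
  next
    case True
    have disj: "K = K'" if "K \<in> components E" "K' \<in> components E" "v \<in> K" "v \<in> K'" for K K' v
      using P that by (auto simp: partition_on_def disjoint_def)
    have NL: "N \<subseteq> components E" "L \<subseteq> components E" "N \<inter> L = {}" by (auto simp: N_def L_def)
    have ne: "K \<noteq> {}" if "K \<in> components E" for K using P that by (auto simp: partition_on_def)
    have "bij_betw G (Pow L) H"
      unfolding bij_betw_def
    proof
      show "inj_on G (Pow L)"
      proof (rule inj_onI)
        fix S S' assume S: "S \<in> Pow L" "S' \<in> Pow L" "G S = G S'"
        have "K \<in> S'" if K: "K \<in> S" and S: "S \<subseteq> L" "S' \<subseteq> L" and eq: "\<Union>N \<union> \<Union>S = \<Union>N \<union> \<Union>S'" for K S S'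
        proof -
          have "K \<in> components E" using K S NL by blast
          then obtain v where v: "v \<in> K" using ne by blast
          then have "v \<in> \<Union>N \<union> \<Union>S'" unfolding eq[symmetric] using K by blast
          then obtain K' where K': "K' \<in> N \<union> S'" "v \<in> K'" by blast
          then have "K' = K" using disj[of K K' v] \<open>K \<in> components E\<close> v S NL by blast
          moreover have "K \<notin> N" using K S NL by blast
          ultimately show ?thesis using K' by blast
        qed
        moreover have "\<Union>N \<union> \<Union>S = \<Union>N \<union> \<Union>S'" using levG[OF _ True, of S] levG[OF _ True, of S'] S by auto
        ultimately show "S = S'" using S by (metis Pow_iff subsetI subset_antisym)
      qed
      show "G ` Pow L = H"
      proof (intro Set.set_eqI iffI)
        fix h assume "h \<in> G ` Pow L"
        then obtain S where S: "S \<subseteq> L" "h = G S" by auto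
        have "saturated (components E) (\<Union>N \<union> \<Union>S)"
          unfolding saturated_def
        proof
          fix K assume K: "K \<in> components E"
          show "K \<subseteq> \<Union>N \<union> \<Union>S \<or> K \<inter> (\<Union>N \<union> \<Union>S) = {}"
          proof (cases "K \<in> N \<union> S")
            case False
            then have "K \<inter> K' = {}" if "K' \<in> N \<union> S" for K'
              using disj[OF K, of K'] that NL S by blast
            then show ?thesis by blast
          qed auto
        qed
        moreover have "h \<subseteq> {1..r + s}"
        proof
          fix i assume "i \<in> h"
          then have "Middle i \<in> \<Union>N \<union> \<Union>S" by (simp add: S G_def)
          then have "Middle i \<in> V" using NL S UV by blast
          then show "i \<in> {1..r + s}" by (auto simp: V_def level_def)
        qed
        ultimately show "h \<in> H" using Hsat levG[OF S(1) True] S by simp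
      next
        fix h assume h: "h \<in> H"
        define S where "S = {K \<in> L. K \<subseteq> level f h g}"
        have sat: "K \<subseteq> level f h g \<or> K \<inter> level f h g = {}" if "K \<in> components E" for K
          using h Hsat that by (auto simp: saturated_def)
        have "h = G S"
        proof (rule Set.set_eqI)
          fix i
          have *: "i \<in> h \<longleftrightarrow> Middle i \<in> level f h g" by (auto simp: level_def)
          show "i \<in> h \<longleftrightarrow> i \<in> G S"
          proof
            assume i: "i \<in> h"
            then have "Middle i \<in> V" using h by (auto simp: H_def V_def level_def)
            then obtain K where K: "K \<in> components E" "Middle i \<in> K" using P by (auto simp: partition_on_def)
            then have Kl: "K \<subseteq> level f h g" using sat[of K] * i by auto
            have "K \<in> N \<union> S"
            proof (cases "K \<subseteq> range Middle")
              case False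
              then show ?thesis using K Kl lev by (auto simp: N_def)
            qed (use K Kl in \<open>auto simp: S_def L_def\<close>)
            then show "i \<in> G S" using K by (auto simp: G_def)
          next
            assume "i \<in> G S"
            then obtain K where K: "K \<in> N \<union> S" "Middle i \<in> K" by (auto simp: G_def)
            have "K \<subseteq> level f h g"
            proof (cases "K \<in> S")
              case False
              then have KN: "K \<in> N" using K by auto
              then obtain v where v: "v \<in> K" "v \<notin> range Middle" by (auto simp: N_def)
              then obtain x where "v = outer x" using outV by blast
              then have "v \<in> level f h g" using KN v lev by (auto simp: N_def)
              then show ?thesis using sat[of K] v KN by (auto simp: N_def)
            qed (auto simp: S_def)
            then show "i \<in> h" using K * by auto
          qed
        qed
        then show "h \<in> G ` Pow L" by (auto simp: S_def)
      qed
    qed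
    then have "card H = card (Pow L)" by (simp add: bij_betw_same_card)
    then show ?thesis using True finL by (simp add: H_def card_Pow loops_def L_def E_def)
  qed
qed

section \<open>Diagrams as permutations\<close>

text \<open>Orient every edge from \<open>src i\<close> to \<open>snk j\<close>, i.e. downwards on the left of the wall and
  upwards on the right. The wall conditions say exactly that every edge joins a source to a sink.\<close>

fun source_node :: "nat \<Rightarrow> node \<Rightarrow> bool" where
  "source_node r (North i) \<longleftrightarrow> i \<le> r"
| "source_node r (South i) \<longleftrightarrow> \<not> i \<le> r"

lemma walled_diagrams_alt:
  "walled_diagrams r s = {d. partition_on (nodes r s) d \<and>
     (\<forall>e\<in>d. \<exists>x y. e = {x, y} \<and> source_node r x \<and> \<not> source_node r y)}"
proof (intro Set.set_eqI iffI)
  fix d assume d: "d \<in> walled_diagrams r s"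
  have "\<exists>x y. e = {x, y} \<and> source_node r x \<and> \<not> source_node r y" if e: "e \<in> d" for e
  proof -
    have "card e = 2" using d e by (auto simp: walled_diagrams_def)
    then obtain x y where xy: "e = {x, y}" by (auto simp: card_2_iff)
    have "source_node r x \<longleftrightarrow> \<not> source_node r y"
      using d e xy by (cases x; cases y) (auto simp: walled_diagrams_def insert_commute)
    then show ?thesis using xy by (metis insert_commute)
  qed
  then show "d \<in> {d. partition_on (nodes r s) d \<and>
     (\<forall>e\<in>d. \<exists>x y. e = {x, y} \<and> source_node r x \<and> \<not> source_node r y)}"
    using d by (auto simp: walled_diagrams_def)
next
  fix d assume d: "d \<in> {d. partition_on (nodes r s) d \<and>
     (\<forall>e\<in>d. \<exists>x y. e = {x, y} \<and> source_node r x \<and> \<not> source_node r y)}"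
  have *: "source_node r x \<longleftrightarrow> \<not> source_node r y" if "{x, y} \<in> d" for x y
    using d that by (auto simp: doubleton_eq_iff dest!: bspec)
  have "card e = 2" if "e \<in> d" for e using d that by (auto simp: card_2_iff dest!: bspec)
  then show "d \<in> walled_diagrams r s"
    using d * by (fastforce simp: walled_diagrams_def)
qed

text \<open>The forward orbit Q of u is saturated, because predecessors are unique and u has none.
  So v lies in Q, and since it has no predecessor either, it is u.\<close>

lemma component_source_unique:
  assumes inj: "single_valued (R\<inverse>)" and E: "E = (\<lambda>(a, b). {a, b}) ` R"
    and K: "K \<in> components E" "u \<in> K" "v \<in> K" and uv: "u \<notin> Range R" "v \<notin> Range R"
  shows "v = u"
proof -
  define Q where "Q = R\<^sup>* `` {u}"
  have "saturated E Q"
    unfolding saturated_def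
  proof
    fix e assume "e \<in> E"
    then obtain a b where ab: "e = {a, b}" "(a, b) \<in> R" using E by auto
    have "a \<in> Q" if b: "b \<in> Q"
    proof -
      have "(u, b) \<in> R\<^sup>*" using b by (simp add: Q_def)
      then show ?thesis
      proof (cases rule: rtranclE)
        case base then show ?thesis using ab uv by auto
      next
        case (step a')
        then have "a' = a" using ab inj by (auto simp: single_valued_def)
        then show ?thesis using step by (simp add: Q_def)
      qed
    qed
    moreover have "b \<in> Q" if "a \<in> Q" using that ab by (auto simp: Q_def)
    ultimately show "e \<subseteq> Q \<or> e \<inter> Q = {}" using ab by auto
  qed
  then have "K \<subseteq> Q \<or> K \<inter> Q = {}" using saturated_component K(1) by blast
  moreover have "u \<in> Q" by (simp add: Q_def)
  ultimately have "(u, v) \<in> R\<^sup>*" using K by (auto simp: Q_def)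
  then show ?thesis using uv by (cases rule: rtranclE) auto
qed

abbreviation pinv :: "('a \<Rightarrow> 'b) \<Rightarrow> 'b \<Rightarrow> 'a" where
  "pinv \<equiv> inv_into UNIV"

locale walled_shape =
  fixes r s :: nat
begin

definition labels :: "nat set" where
  "labels = {1..r + s}"

lemma finite_labels [simp]: "finite labels"
  by (simp add: labels_def)

definition perms :: "(nat \<Rightarrow> nat) set" where
  "perms = {\<sigma>. \<sigma> permutes labels}"

definition src :: "nat \<Rightarrow> node" where
  "src i = (if i \<le> r then North i else South i)"

definition snk :: "nat \<Rightarrow> node" where
  "snk j = (if j \<le> r then South j else North j)"

definition diag :: "(nat \<Rightarrow> nat) \<Rightarrow> node set set" where
  "diag \<sigma> = (\<lambda>i. {src i, snk (\<sigma> i)}) ` labels"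

text \<open>Saturation of \<open>boundary f g\<close> with respect to \<open>diag \<sigma>\<close>.\<close>

definition compatible :: "(nat \<Rightarrow> nat) \<Rightarrow> nat set \<Rightarrow> nat set \<Rightarrow> bool" where
  "compatible \<sigma> f g \<longleftrightarrow> (\<forall>i\<in>labels. i \<in> (if i \<le> r then f else g) \<longleftrightarrow> \<sigma> i \<in> (if \<sigma> i \<le> r then g else f))"

lemma src_snk_simps [simp]:
  "source_node r (src i)" "\<not> source_node r (snk i)" "src i = src j \<longleftrightarrow> i = j" "snk i = snk j \<longleftrightarrow> i = j"
  "src i \<noteq> snk j" "snk j \<noteq> src i"
  by (auto simp: src_def snk_def)

lemma nodes_eq: "nodes r s = src ` labels \<union> snk ` labels"
proof -
  have "x \<in> nodes r s \<longleftrightarrow> x \<in> src ` labels \<union> snk ` labels" for x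
    by (cases x) (auto simp: nodes_def src_def snk_def image_iff labels_def)
  then show ?thesis by blast
qed

lemma src_in_nodes [simp]: "src i \<in> nodes r s \<longleftrightarrow> i \<in> labels" "snk i \<in> nodes r s \<longleftrightarrow> i \<in> labels"
  by (auto simp: nodes_eq)

lemma subset_nodes_labels:
  assumes "X \<subseteq> nodes r s"
  obtains f g where "f \<subseteq> labels" "g \<subseteq> labels" "X = boundary f g"
  using subset_nodes_boundary[OF assms] unfolding labels_def by blast

lemma finite_perms: "finite perms"
  by (simp add: perms_def finite_permutations)

lemma permsD: "\<sigma> \<in> perms \<Longrightarrow> i \<in> labels \<Longrightarrow> \<sigma> i \<in> labels" "\<sigma> \<in> perms \<Longrightarrow> i \<notin> labels \<Longrightarrow> \<sigma> i = i"
  "\<sigma> \<in> perms \<Longrightarrow> \<sigma> i = \<sigma> j \<longleftrightarrow> i = j"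
  unfolding perms_def mem_Collect_eq using permutes_in_image permutes_not_in permutes_inj by (metis inj_eq)+

lemma diag_walled:
  assumes "\<sigma> \<in> perms"
  shows "diag \<sigma> \<in> walled_diagrams r s"
proof -
  have im: "\<sigma> ` labels = labels" using assms by (simp add: perms_def permutes_image)
  have "partition_on (nodes r s) (diag \<sigma>)"
  proof (rule partition_onI)
    have "\<Union>(diag \<sigma>) = src ` labels \<union> snk ` \<sigma> ` labels" by (auto simp: diag_def)
    then show "\<Union>(diag \<sigma>) = nodes r s" by (simp add: im nodes_eq)
    show "{} \<notin> diag \<sigma>" by (auto simp: diag_def)
    fix p q assume "p \<in> diag \<sigma>" "q \<in> diag \<sigma>" "p \<noteq> q"
    then show "disjnt p q" using permsD(3)[OF assms] by (auto simp: diag_def disjnt_def)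
  qed
  then show ?thesis by (fastforce simp: walled_diagrams_alt diag_def)
qed

lemma inj_diag: "inj_on diag perms"
proof (rule inj_onI)
  fix \<sigma> \<tau> assume st: "\<sigma> \<in> perms" "\<tau> \<in> perms" "diag \<sigma> = diag \<tau>"
  show "\<sigma> = \<tau>"
  proof
    fix i
    show "\<sigma> i = \<tau> i"
    proof (cases "i \<in> labels")
      case True
      then have "{src i, snk (\<sigma> i)} \<in> diag \<sigma>" unfolding diag_def by (rule imageI)
      then obtain j where "{src i, snk (\<sigma> i)} = {src j, snk (\<tau> j)}" unfolding st(3) by (auto simp: diag_def)
      then show ?thesis by (auto simp: doubleton_eq_iff)
    qed (simp add: permsD(2)[OF st(1)] permsD(2)[OF st(2)])
  qed
qed

lemma diag_surj:
  assumes "d \<in> walled_diagrams r s"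
  shows "d \<in> diag ` perms"
proof -
  have part: "partition_on (nodes r s) d"
    and edge: "\<And>e. e \<in> d \<Longrightarrow> \<exists>x y. e = {x, y} \<and> source_node r x \<and> \<not> source_node r y"
    using assms by (auto simp: walled_diagrams_alt)
  have edge': "\<exists>i\<in>labels. \<exists>j\<in>labels. e = {src i, snk j}" if e: "e \<in> d" for e
  proof -
    obtain x y where xy: "e = {x, y}" "source_node r x" "\<not> source_node r y" using edge[OF e] by blast
    have "x \<in> nodes r s" "y \<in> nodes r s" using part e xy by (auto simp: partition_on_def)
    then show ?thesis using xy by (auto simp: nodes_eq)
  qed
  have unique: "e = e'" if "e \<in> d" "e' \<in> d" "x \<in> e" "x \<in> e'" for e e' x
    using part that by (auto simp: partition_on_def disjoint_def)
  define \<sigma> where "\<sigma> i = (if i \<in> labels then SOME j. {src i, snk j} \<in> d else i)" for i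
  have \<sigma>: "{src i, snk (\<sigma> i)} \<in> d" if i: "i \<in> labels" for i
  proof -
    obtain e where e: "e \<in> d" "src i \<in> e" using part i src_in_nodes(1)[of i] unfolding partition_on_def by blast
    then obtain i' j where "e = {src i', snk j}" using edge' by blast
    then have "\<exists>j. {src i, snk j} \<in> d" using e by auto
    then show ?thesis using i by (auto simp: \<sigma>_def intro: someI)
  qed
  have lab: "\<sigma> i \<in> labels" if "i \<in> labels" for i
    using edge'[OF \<sigma>[OF that]] by (auto simp: doubleton_eq_iff)
  have inj: "inj_on \<sigma> labels"
  proof (rule inj_onI)
    fix i j assume ij: "i \<in> labels" "j \<in> labels" "\<sigma> i = \<sigma> j"
    then have "{src i, snk (\<sigma> i)} = {src j, snk (\<sigma> j)}" using unique[OF \<sigma>[OF ij(1)] \<sigma>[OF ij(2)], of "snk (\<sigma> i)"] by simp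
    then show "i = j" by (auto simp: doubleton_eq_iff)
  qed
  have "\<sigma> ` labels = labels" by (rule endo_inj_surj) (use inj lab in auto)
  then have "\<sigma> permutes labels" using inj by (intro bij_imp_permutes) (auto simp: bij_betw_def \<sigma>_def)
  moreover have "d = diag \<sigma>"
  proof
    show "diag \<sigma> \<subseteq> d" using \<sigma> by (auto simp: diag_def)
    show "d \<subseteq> diag \<sigma>"
    proof
      fix e assume e: "e \<in> d"
      then obtain i j where ij: "e = {src i, snk j}" "i \<in> labels" using edge' by blast
      then have "e = {src i, snk (\<sigma> i)}" using unique[OF e \<sigma>[of i], of "src i"] by auto
      then show "e \<in> diag \<sigma>" using ij by (auto simp: diag_def)
    qed
  qed
  ultimately show ?thesis by (auto simp: perms_def)
qed

lemma bij_diag: "bij_betw diag perms (walled_diagrams r s)"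
  using inj_diag diag_walled diag_surj by (auto simp: bij_betw_def)

lemma diag_partition: "\<sigma> \<in> perms \<Longrightarrow> partition_on (nodes r s) (diag \<sigma>)"
  using diag_walled by (auto simp: walled_diagrams_def)

lemma diag_card: "\<sigma> \<in> perms \<Longrightarrow> e \<in> diag \<sigma> \<Longrightarrow> card e = 2"
  using diag_walled by (auto simp: walled_diagrams_def)

lemma diag_id: "diag id = identity_diagram r s"
  unfolding diag_def identity_diagram_def labels_def
  by (rule image_cong) (auto simp: src_def snk_def)

lemma saturated_diag: "saturated (diag \<sigma>) (boundary f g) \<longleftrightarrow> compatible \<sigma> f g"
proof -
  have "src i \<in> boundary f g \<longleftrightarrow> i \<in> (if i \<le> r then f else g)"
    "snk i \<in> boundary f g \<longleftrightarrow> i \<in> (if i \<le> r then g else f)" for i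
    by (auto simp: src_def snk_def boundary_def)
  moreover have "{a, b} \<subseteq> X \<or> {a, b} \<inter> X = {} \<longleftrightarrow> (a \<in> X \<longleftrightarrow> b \<in> X)" for a b :: node and X by auto
  ultimately show ?thesis by (simp only: saturated_def compatible_def diag_def ball_simps)
qed

text \<open>\<open>\<sigma>\<close> maps the coloured sources bijectively to the coloured sinks.
  Hence the number of coloured labels left of the wall minus that on the right is the same in both
  rows, an invariant that passes through any stack of diagrams.\<close>

lemma compatible_balanced:
  assumes "\<sigma> \<in> perms" "compatible \<sigma> f g" "f \<subseteq> labels" "g \<subseteq> labels"
  shows "card (f \<inter> {..r}) + card (g \<inter> {r<..}) = card (g \<inter> {..r}) + card (f \<inter> {r<..})"
proof -
  have fin: "finite f" "finite g" using assms(3,4) by (auto intro: finite_subset[OF _ finite_labels])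
  define F where "F = (f \<inter> {..r}) \<union> (g \<inter> {r<..})"
  define T where "T = (g \<inter> {..r}) \<union> (f \<inter> {r<..})"
  have F: "i \<in> F \<longleftrightarrow> i \<in> (if i \<le> r then f else g)" and T: "i \<in> T \<longleftrightarrow> i \<in> (if i \<le> r then g else f)" for i
    by (auto simp: F_def T_def)
  have FT: "F \<subseteq> labels" "T \<subseteq> labels" using assms(3,4) by (auto simp: F_def T_def)
  have "\<sigma> ` F = T"
  proof (intro Set.set_eqI iffI)
    fix j assume "j \<in> \<sigma> ` F"
    then obtain i where i: "i \<in> F" "j = \<sigma> i" by auto
    then have "i \<in> labels" using FT by auto
    then show "j \<in> T" using assms(2) F[of i] T[of j] i unfolding compatible_def by simp
  next
    fix j assume j: "j \<in> T"
    then have "j \<in> \<sigma> ` labels" using FT assms(1) by (auto simp: perms_def permutes_image)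
    then obtain i where i: "i \<in> labels" "j = \<sigma> i" by auto
    then have "i \<in> F" using assms(2) F[of i] T[of j] j unfolding compatible_def by simp
    then show "j \<in> \<sigma> ` F" using i by auto
  qed
  moreover have "inj_on \<sigma> F" using permsD(3)[OF assms(1)] by (auto simp: inj_on_def)
  ultimately have "card F = card T" using card_image by fastforce
  moreover have "card F = card (f \<inter> {..r}) + card (g \<inter> {r<..})" unfolding F_def
    by (rule card_Un_disjoint) (use fin in auto)
  moreover have "card T = card (g \<inter> {..r}) + card (f \<inter> {r<..})" unfolding T_def
    by (rule card_Un_disjoint) (use fin in auto)
  ultimately show ?thesis by simp
qed

lemma card_compatible:
  assumes "\<sigma> \<in> perms" "\<tau> \<in> perms" "f \<subseteq> labels" "g \<subseteq> labels"
  shows "card {h. h \<subseteq> labels \<and> compatible \<sigma> f h \<and> compatible \<tau> h g} =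
    (if saturated (concat_diagram (diag \<sigma>) (diag \<tau>)) (boundary f g) then 2 ^ loops (diag \<sigma>) (diag \<tau>) else 0)"
  using card_saturated_middle[OF diag_partition[OF assms(1)] diag_card[OF assms(1)]
      diag_partition[OF assms(2)] diag_card[OF assms(2)] assms(3,4)[unfolded labels_def]]
  by (simp add: saturated_diag labels_def)

text \<open>A component of the oriented stack has at most one outer source and, with all arrows
  reversed, at most one outer sink. The invariant of \<open>compatible_balanced\<close>, transported
  through the middle row, excludes blocks that have only one of the two.\<close>

lemma concat_walled:
  assumes "\<sigma> \<in> perms" "\<tau> \<in> perms"
  shows "concat_diagram (diag \<sigma>) (diag \<tau>) \<in> walled_diagrams r s"
proof -
  let ?C = "concat_diagram (diag \<sigma>) (diag \<tau>)"
  define R where "R = (\<lambda>i. (upper (src i), upper (snk (\<sigma> i)))) ` labels \<union>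
      (\<lambda>i. (lower (src i), lower (snk (\<tau> i)))) ` labels"
  have E: "stacked (diag \<sigma>) (diag \<tau>) = (\<lambda>(a, b). {a, b}) ` R"
    by (simp add: R_def stacked_def diag_def image_Un image_image)
  have E': "stacked (diag \<sigma>) (diag \<tau>) = (\<lambda>(a, b). {a, b}) ` (R\<inverse>)"
    unfolding E by (auto simp: insert_commute)
  have up: "upper (src i) = (if i \<le> r then Top i else Middle i)" "upper (snk i) = (if i \<le> r then Middle i else Top i)"
    "lower (src i) = (if i \<le> r then Middle i else Bottom i)" "lower (snk i) = (if i \<le> r then Bottom i else Middle i)" for i
    by (auto simp: src_def snk_def)
  \<comment> \<open>A middle node is a sink of one diagram and a source of the other, so the
    orientations fit together and each vertex has at most one predecessor and one successor.\<close>
  have inj: "single_valued (R\<inverse>)" "single_valued ((R\<inverse>)\<inverse>)"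
    using permsD(3)[OF assms(1)] permsD(3)[OF assms(2)]
    by (auto simp: single_valued_def R_def up split: if_splits)
  have part: "partition_on (nodes r s) ?C"
    by (rule partition_on_concat) (use diag_partition assms in auto)
  have nR: "outer x \<notin> Range R" if "source_node r x" for x
    using that by (cases x) (auto simp: R_def up split: if_splits)
  have nR': "outer x \<notin> Range (R\<inverse>)" if "\<not> source_node r x" for x
    using that by (cases x) (auto simp: R_def up split: if_splits)
  have outer_inj: "outer x = outer y \<Longrightarrow> x = y" for x y by (cases x; cases y) auto
  have "\<exists>x y. e = {x, y} \<and> source_node r x \<and> \<not> source_node r y" if e: "e \<in> ?C" for e
  proof -
    obtain K where K: "K \<in> components (stacked (diag \<sigma>) (diag \<tau>))" "e = outer -` K"
      using e by (auto simp: concat_diagram_def)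
    have u1: "x = y" if "x \<in> e" "y \<in> e" "source_node r x" "source_node r y" for x y
      using component_source_unique[OF inj(1) E K(1), of "outer x" "outer y"] that nR K(2) outer_inj by auto
    have u2: "x = y" if "x \<in> e" "y \<in> e" "\<not> source_node r x" "\<not> source_node r y" for x y
      using component_source_unique[OF inj(2) E' K(1), of "outer x" "outer y"] that nR' K(2) outer_inj by auto
    have "e \<subseteq> nodes r s" "e \<noteq> {}" using part e by (auto simp: partition_on_def)
    obtain f g where fg: "f \<subseteq> labels" "g \<subseteq> labels" "e = boundary f g"
      using \<open>e \<subseteq> nodes r s\<close> by (rule subset_nodes_labels)
    have "saturated ?C e" using part e by (auto simp: saturated_def partition_on_def disjoint_def)
    \<comment> \<open>A block, being saturated for the composite, extends to a colouring of the
      middle row.\<close>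
    then have "card {h. h \<subseteq> labels \<and> compatible \<sigma> f h \<and> compatible \<tau> h g} \<noteq> 0"
      using card_compatible[OF assms fg(1,2)] fg(3) by simp
    then obtain h where h: "h \<subseteq> labels" "compatible \<sigma> f h" "compatible \<tau> h g"
      by (metis (mono_tags, lifting) card.empty empty_Collect_eq)
    have bal: "card (f \<inter> {..r}) + card (g \<inter> {r<..}) = card (g \<inter> {..r}) + card (f \<inter> {r<..})"
      using compatible_balanced[OF assms(1) h(2) fg(1) h(1)] compatible_balanced[OF assms(2) h(3) h(1) fg(2)] by simp
    have fin: "finite f" "finite g" using fg(1,2) by (auto intro: finite_subset[OF _ finite_labels])
    have S: "(\<exists>x\<in>e. source_node r x) \<longleftrightarrow> f \<inter> {..r} \<noteq> {} \<or> g \<inter> {r<..} \<noteq> {}"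
      unfolding fg(3) boundary_def by force
    have T: "(\<exists>x\<in>e. \<not> source_node r x) \<longleftrightarrow> g \<inter> {..r} \<noteq> {} \<or> f \<inter> {r<..} \<noteq> {}"
      unfolding fg(3) boundary_def by force
    have "(f \<inter> {..r} = {} \<and> g \<inter> {r<..} = {}) \<longleftrightarrow> (g \<inter> {..r} = {} \<and> f \<inter> {r<..} = {})"
      using bal fin by (metis add_is_0 card_0_eq finite_Int)
    then have "(\<exists>x\<in>e. source_node r x) \<longleftrightarrow> (\<exists>x\<in>e. \<not> source_node r x)" using S T by blast
    then obtain x y where "x \<in> e" "source_node r x" "y \<in> e" "\<not> source_node r y" using \<open>e \<noteq> {}\<close> by blast
    moreover from this have "e = {x, y}" using u1 u2 by blast
    ultimately show ?thesis by blast
  qed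
  then show ?thesis using part by (simp add: walled_diagrams_alt)
qed

section \<open>The product transported to permutations\<close>

definition star :: "(nat \<Rightarrow> nat) \<Rightarrow> (nat \<Rightarrow> nat) \<Rightarrow> nat \<Rightarrow> nat" where
  "star \<sigma> \<tau> = the_inv_into perms diag (concat_diagram (diag \<sigma>) (diag \<tau>))"

definition lp :: "(nat \<Rightarrow> nat) \<Rightarrow> (nat \<Rightarrow> nat) \<Rightarrow> nat" where
  "lp \<sigma> \<tau> = loops (diag \<sigma>) (diag \<tau>)"

lemma star_in_perms: "\<sigma> \<in> perms \<Longrightarrow> \<tau> \<in> perms \<Longrightarrow> star \<sigma> \<tau> \<in> perms"
  unfolding star_def by (rule the_inv_into_into[OF inj_diag]) (use concat_walled diag_surj in auto)

lemma diag_star: "\<sigma> \<in> perms \<Longrightarrow> \<tau> \<in> perms \<Longrightarrow> diag (star \<sigma> \<tau>) = concat_diagram (diag \<sigma>) (diag \<tau>)"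
  unfolding star_def by (rule f_the_inv_into_f[OF inj_diag]) (use concat_walled diag_surj in auto)

lemma card_star:
  assumes "\<sigma> \<in> perms" "\<tau> \<in> perms" "f \<subseteq> labels" "g \<subseteq> labels"
  shows "card {h. h \<subseteq> labels \<and> compatible \<sigma> f h \<and> compatible \<tau> h g} = (if compatible (star \<sigma> \<tau>) f g then 2 ^ lp \<sigma> \<tau> else 0)"
  using card_compatible[OF assms] by (simp add: lp_def diag_star[OF assms(1,2), symmetric] saturated_diag)

lemma compatible_star:
  assumes "\<sigma> \<in> perms" "\<tau> \<in> perms" "f \<subseteq> labels" "g \<subseteq> labels"
  shows "compatible (star \<sigma> \<tau>) f g \<longleftrightarrow> (\<exists>h\<subseteq>labels. compatible \<sigma> f h \<and> compatible \<tau> h g)"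
proof -
  have "finite {h. h \<subseteq> labels \<and> compatible \<sigma> f h \<and> compatible \<tau> h g}" by simp
  then have "card {h. h \<subseteq> labels \<and> compatible \<sigma> f h \<and> compatible \<tau> h g} \<noteq> 0 \<longleftrightarrow>
      (\<exists>h\<subseteq>labels. compatible \<sigma> f h \<and> compatible \<tau> h g)" by auto
  then show ?thesis unfolding card_star[OF assms] by (simp split: if_splits)
qed

lemma perms_eqI:
  assumes "\<sigma> \<in> perms" "\<tau> \<in> perms" "\<And>f g. f \<subseteq> labels \<Longrightarrow> g \<subseteq> labels \<Longrightarrow> compatible \<sigma> f g \<longleftrightarrow> compatible \<tau> f g"
  shows "\<sigma> = \<tau>"
proof -
  have "diag \<sigma> = diag \<tau>"
  proof (rule partition_eqI[OF diag_partition diag_partition])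
    fix X assume "X \<subseteq> nodes r s"
    then obtain f g where "f \<subseteq> labels" "g \<subseteq> labels" "X = boundary f g" by (rule subset_nodes_labels)
    then show "saturated (diag \<sigma>) X \<longleftrightarrow> saturated (diag \<tau>) X" using assms(3) by (simp add: saturated_diag)
  qed (use assms in auto)
  then show ?thesis using inj_diag assms by (auto simp: inj_on_def)
qed

lemma star_eqI:
  assumes "\<sigma> \<in> perms" "\<tau> \<in> perms" "\<rho> \<in> perms"
    "\<And>f g. f \<subseteq> labels \<Longrightarrow> g \<subseteq> labels \<Longrightarrow> compatible \<rho> f g \<longleftrightarrow> (\<exists>h\<subseteq>labels. compatible \<sigma> f h \<and> compatible \<tau> h g)"
  shows "star \<sigma> \<tau> = \<rho>"
  by (rule perms_eqI) (use assms compatible_star star_in_perms in auto)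

lemma compatible_empty: "compatible \<sigma> {} {}"
  by (auto simp: compatible_def)

text \<open>Empty outer rows are always compatible with the composite, so the count is then a pure
  power of 2 and recovers the number of loops.\<close>

lemma lp_card:
  assumes "\<sigma> \<in> perms" "\<tau> \<in> perms"
  shows "2 ^ lp \<sigma> \<tau> = card {h. h \<subseteq> labels \<and> compatible \<sigma> {} h \<and> compatible \<tau> h {}}"
  using card_star[OF assms, of "{}" "{}"] by (simp add: compatible_empty)

text \<open>Colourings turn \<open>star\<close> into composition of relations between subsets of
  \<open>labels\<close>, which is associative, and a permutation is determined by its
  relation.\<close>

lemma star_assoc:
  assumes "\<sigma> \<in> perms" "\<tau> \<in> perms" "\<upsilon> \<in> perms"
  shows "star (star \<sigma> \<tau>) \<upsilon> = star \<sigma> (star \<tau> \<upsilon>)"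
proof (rule star_eqI)
  fix f g assume fg: "f \<subseteq> labels" "g \<subseteq> labels"
  have "compatible (star \<sigma> (star \<tau> \<upsilon>)) f g \<longleftrightarrow> (\<exists>h\<subseteq>labels. compatible \<sigma> f h \<and> (\<exists>h'\<subseteq>labels. compatible \<tau> h h' \<and> compatible \<upsilon> h' g))"
    using fg star_in_perms assms by (simp add: compatible_star cong: conj_cong)
  also have "\<dots> \<longleftrightarrow> (\<exists>h'\<subseteq>labels. (\<exists>h\<subseteq>labels. compatible \<sigma> f h \<and> compatible \<tau> h h') \<and> compatible \<upsilon> h' g)" by blast
  also have "\<dots> \<longleftrightarrow> (\<exists>h'\<subseteq>labels. compatible (star \<sigma> \<tau>) f h' \<and> compatible \<upsilon> h' g)"
    using fg assms by (simp add: compatible_star cong: conj_cong)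
  finally show "compatible (star \<sigma> (star \<tau> \<upsilon>)) f g \<longleftrightarrow> (\<exists>h\<subseteq>labels. compatible (star \<sigma> \<tau>) f h \<and> compatible \<upsilon> h g)" .
qed (use assms star_in_perms in auto)

text \<open>Both sides are the exponent of 2 in the number of pairs of colourings of the two inner
  rows of a triple stack with empty outer rows, summed in either order.\<close>

lemma lp_assoc:
  assumes "\<sigma> \<in> perms" "\<tau> \<in> perms" "\<upsilon> \<in> perms"
  shows "lp \<sigma> \<tau> + lp (star \<sigma> \<tau>) \<upsilon> = lp \<tau> \<upsilon> + lp \<sigma> (star \<tau> \<upsilon>)"
proof -
  let ?P = "Pow labels"
  have eq: "{h. h \<subseteq> labels \<and> Q h} = {h \<in> ?P. Q h}" for Q by auto
  have card_sum: "card {h \<in> ?P. Q h} = (\<Sum>h\<in>?P. if Q h then 1 else 0 :: nat)" for Q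
    by (simp add: sum.If_cases Int_def)
  have "(2::nat) ^ (lp \<sigma> \<tau> + lp (star \<sigma> \<tau>) \<upsilon>) = (\<Sum>h'\<in>?P. if compatible \<upsilon> h' {} then 2 ^ lp \<sigma> \<tau> * (if compatible (star \<sigma> \<tau>) {} h' then 1 else 0) else 0)"
    unfolding power_add lp_card[OF star_in_perms[OF assms(1,2)] assms(3)] eq card_sum sum_distrib_left
    by (rule sum.cong) auto
  also have "\<dots> = (\<Sum>h'\<in>?P. \<Sum>h\<in>?P. if compatible \<sigma> {} h \<and> compatible \<tau> h h' \<and> compatible \<upsilon> h' {} then 1 else 0)"
  proof (rule sum.cong[OF refl])
    fix h' assume "h' \<in> ?P"
    then have "(2::nat) ^ lp \<sigma> \<tau> * (if compatible (star \<sigma> \<tau>) {} h' then 1 else 0) = card {h \<in> ?P. compatible \<sigma> {} h \<and> compatible \<tau> h h'}"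
      using card_star[OF assms(1,2), of "{}" h'] by simp
    then show "(if compatible \<upsilon> h' {} then (2::nat) ^ lp \<sigma> \<tau> * (if compatible (star \<sigma> \<tau>) {} h' then 1 else 0) else 0) =
        (\<Sum>h\<in>?P. if compatible \<sigma> {} h \<and> compatible \<tau> h h' \<and> compatible \<upsilon> h' {} then 1 else 0)"
      by (simp only: card_sum) auto
  qed
  also have "\<dots> = (\<Sum>h\<in>?P. \<Sum>h'\<in>?P. if compatible \<sigma> {} h \<and> compatible \<tau> h h' \<and> compatible \<upsilon> h' {} then 1 else 0)"
    by (rule sum.swap)
  also have "\<dots> = (\<Sum>h\<in>?P. if compatible \<sigma> {} h then 2 ^ lp \<tau> \<upsilon> * (if compatible (star \<tau> \<upsilon>) h {} then 1 else 0) else 0)"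
  proof (rule sum.cong[OF refl])
    fix h assume "h \<in> ?P"
    then have "(2::nat) ^ lp \<tau> \<upsilon> * (if compatible (star \<tau> \<upsilon>) h {} then 1 else 0) = card {h' \<in> ?P. compatible \<tau> h h' \<and> compatible \<upsilon> h' {}}"
      using card_star[OF assms(2,3), of h "{}"] by simp
    then show "(\<Sum>h'\<in>?P. if compatible \<sigma> {} h \<and> compatible \<tau> h h' \<and> compatible \<upsilon> h' {} then 1 else 0) =
        (if compatible \<sigma> {} h then (2::nat) ^ lp \<tau> \<upsilon> * (if compatible (star \<tau> \<upsilon>) h {} then 1 else 0) else 0)"
      by (simp only: card_sum) auto
  qed
  also have "\<dots> = (2::nat) ^ (lp \<tau> \<upsilon> + lp \<sigma> (star \<tau> \<upsilon>))"
    unfolding power_add lp_card[OF assms(1) star_in_perms[OF assms(2,3)]] eq card_sum sum_distrib_left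
    by (rule sum.cong) auto
  finally show ?thesis by simp
qed

lemma inv_in_perms: "\<sigma> \<in> perms \<Longrightarrow> pinv \<sigma> \<in> perms"
  by (simp add: perms_def permutes_inv)

text \<open>Turning a diagram upside down exchanges \<open>src i\<close> and \<open>snk i\<close>,
  hence inverts its permutation; this makes inversion an anti-automorphism for
  \<open>star\<close>.\<close>

lemma compatible_inv:
  assumes "\<sigma> \<in> perms"
  shows "compatible (pinv \<sigma>) f g \<longleftrightarrow> compatible \<sigma> g f"
proof -
  have p: "\<sigma> permutes labels" using assms by (simp add: perms_def)
  have "compatible (pinv \<sigma>) f g \<longleftrightarrow> (\<forall>i\<in>\<sigma> ` labels. i \<in> (if i \<le> r then f else g) \<longleftrightarrow> pinv \<sigma> i \<in> (if pinv \<sigma> i \<le> r then g else f))"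
    unfolding compatible_def permutes_image[OF p] ..
  also have "\<dots> \<longleftrightarrow> compatible \<sigma> g f"
    unfolding compatible_def ball_simps permutes_inverses[OF p] by blast
  finally show ?thesis .
qed

lemma star_inv:
  assumes "\<sigma> \<in> perms" "\<tau> \<in> perms"
  shows "star (pinv \<tau>) (pinv \<sigma>) = pinv (star \<sigma> \<tau>)"
  by (rule star_eqI)
     (use assms in \<open>auto simp: inv_in_perms star_in_perms compatible_inv compatible_star\<close>)

lemma lp_inv:
  assumes "\<sigma> \<in> perms" "\<tau> \<in> perms"
  shows "lp (pinv \<tau>) (pinv \<sigma>) = lp \<sigma> \<tau>"
proof -
  have "(2::nat) ^ lp (pinv \<tau>) (pinv \<sigma>) = 2 ^ lp \<sigma> \<tau>"
    unfolding lp_card[OF assms] lp_card[OF inv_in_perms[OF assms(2)] inv_in_perms[OF assms(1)]]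
    by (rule arg_cong[where f = card]) (auto simp: compatible_inv assms)
  then show ?thesis by simp
qed

section \<open>Composition with permutation diagrams and hooks\<close>

lemma id_in_perms: "id \<in> perms"
  by (simp add: perms_def permutes_id)

lemma comp_in_perms: "\<sigma> \<in> perms \<Longrightarrow> \<tau> \<in> perms \<Longrightarrow> \<sigma> \<circ> \<tau> \<in> perms"
  by (simp add: perms_def permutes_compose)

lemma transpose_in_perms: "i \<in> labels \<Longrightarrow> j \<in> labels \<Longrightarrow> transpose i j \<in> perms"
  by (simp add: perms_def permutes_swap_id)

lemma pinv_perms: "\<sigma> \<in> perms \<Longrightarrow> \<sigma> (pinv \<sigma> i) = i" "\<sigma> \<in> perms \<Longrightarrow> pinv \<sigma> (\<sigma> i) = i"
  by (auto simp: perms_def permutes_inverses)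

lemma pinv_perms_comp: "\<sigma> \<in> perms \<Longrightarrow> \<sigma> \<circ> pinv \<sigma> = id" "\<sigma> \<in> perms \<Longrightarrow> pinv \<sigma> \<circ> \<sigma> = id"
  by (auto simp: pinv_perms)

lemma pinv_unique: "\<sigma> \<circ> \<tau> = id \<Longrightarrow> \<tau> \<circ> \<sigma> = id \<Longrightarrow> pinv \<sigma> = \<tau>"
  by (rule inv_unique_comp)

lemma pinv_pinv: "\<sigma> \<in> perms \<Longrightarrow> pinv (pinv \<sigma>) = \<sigma>"
  by (rule pinv_unique) (simp_all add: pinv_perms_comp)

text \<open>The colours that \<open>boundary f g\<close> gives to \<open>src i\<close> and, in the
  next definition, to \<open>snk i\<close>.\<close>

definition vsrc :: "nat set \<Rightarrow> nat set \<Rightarrow> nat \<Rightarrow> bool" where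
  "vsrc f g i \<longleftrightarrow> i \<in> (if i \<le> r then f else g)"

definition vsnk :: "nat set \<Rightarrow> nat set \<Rightarrow> nat \<Rightarrow> bool" where
  "vsnk f g i \<longleftrightarrow> i \<in> (if i \<le> r then g else f)"

lemma compatible_alt: "compatible \<sigma> f g \<longleftrightarrow> (\<forall>i\<in>labels. vsrc f g i = vsnk f g (\<sigma> i))"
  by (simp add: compatible_def vsrc_def vsnk_def)

section \<open>Permutation diagrams and their factors on the two sides of the wall\<close>

definition wall_perms :: "(nat \<Rightarrow> nat) set" where
  "wall_perms = {\<pi> \<in> perms. \<forall>i\<in>labels. \<pi> i \<le> r \<longleftrightarrow> i \<le> r}"

definition lft :: "(nat \<Rightarrow> nat) \<Rightarrow> nat \<Rightarrow> nat" where
  "lft \<pi> i = (if i \<le> r then \<pi> i else i)"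

definition rgt :: "(nat \<Rightarrow> nat) \<Rightarrow> nat \<Rightarrow> nat" where
  "rgt \<pi> i = (if i \<le> r then i else \<pi> i)"

lemma wall_permsD:
  assumes "\<pi> \<in> wall_perms"
  shows "\<pi> \<in> perms" "\<pi> i \<le> r \<longleftrightarrow> i \<le> r"
  using assms permsD(2)[of \<pi> i] by (auto simp: wall_perms_def)

lemma id_wall_perms: "id \<in> wall_perms"
  by (simp add: wall_perms_def id_in_perms)

lemma comp_wall_perms: "\<pi> \<in> wall_perms \<Longrightarrow> \<rho> \<in> wall_perms \<Longrightarrow> \<pi> \<circ> \<rho> \<in> wall_perms"
  using comp_in_perms by (auto simp: wall_perms_def permsD(1))

lemma pinv_wall_perms:
  assumes "\<pi> \<in> wall_perms"
  shows "pinv \<pi> \<in> wall_perms"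
proof -
  note \<pi> = wall_permsD[OF assms]
  have "pinv \<pi> i \<le> r \<longleftrightarrow> i \<le> r" for i using \<pi>(2)[of "pinv \<pi> i"] pinv_perms(1)[OF \<pi>(1)] by simp
  then show ?thesis using inv_in_perms[OF \<pi>(1)] by (simp add: wall_perms_def)
qed

lemma lft_rgt_comp:
  assumes "\<pi> \<in> wall_perms" "\<rho> \<in> wall_perms"
  shows "lft \<pi> \<circ> lft \<rho> = lft (\<pi> \<circ> \<rho>)" "rgt \<pi> \<circ> rgt \<rho> = rgt (\<pi> \<circ> \<rho>)" "lft \<pi> \<circ> rgt \<rho> = rgt \<rho> \<circ> lft \<pi>"
    "lft \<pi> \<circ> rgt \<pi> = \<pi>"
  using wall_permsD(2)[OF assms(1)] wall_permsD(2)[OF assms(2)] by (auto simp: lft_def rgt_def fun_eq_iff)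

lemma lft_rgt_id [simp]: "lft id = id" "rgt id = id"
  by (auto simp: lft_def rgt_def)

lemma pinv_lft_rgt:
  assumes "\<pi> \<in> wall_perms"
  shows "pinv (lft \<pi>) = lft (pinv \<pi>)" "pinv (rgt \<pi>) = rgt (pinv \<pi>)"
  using pinv_perms_comp[OF wall_permsD(1)[OF assms]]
  by (auto intro!: pinv_unique simp: lft_rgt_comp assms pinv_wall_perms)

lemma lft_rgt_wall:
  assumes "\<pi> \<in> wall_perms"
  shows "lft \<pi> \<in> wall_perms" "rgt \<pi> \<in> wall_perms"
proof -
  note \<pi> = wall_permsD[OF assms]
  have o: "lft \<pi> i = i" "rgt \<pi> i = i" if "i \<notin> labels" for i
    using permsD(2)[OF \<pi>(1)] that by (auto simp: lft_def rgt_def)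
  have "bij (lft \<pi>)" "bij (rgt \<pi>)"
    by (rule o_bij[of "lft (pinv \<pi>)"] o_bij[of "rgt (pinv \<pi>)"];
        simp add: lft_rgt_comp assms pinv_wall_perms pinv_perms_comp[OF \<pi>(1)])+
  then have "lft \<pi> permutes labels" "rgt \<pi> permutes labels"
    using o unfolding permutes_def bij_iff by auto
  then show "lft \<pi> \<in> wall_perms" "rgt \<pi> \<in> wall_perms"
    using \<pi> by (auto simp: wall_perms_def perms_def lft_def rgt_def)
qed

text \<open>Without arcs the colours of one row determine those of the other. Edges on the right of
  the wall run upwards, so there the colours are moved by the inverse of
  \<open>\<pi>\<close>.\<close>

lemma compatible_wall:
  assumes \<pi>: "\<pi> \<in> wall_perms" and fh: "f \<subseteq> labels" "h \<subseteq> labels"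
  shows "compatible \<pi> f h \<longleftrightarrow> h = {k \<in> labels. (if k \<le> r then pinv \<pi> k \<in> f else \<pi> k \<in> f)}"
proof -
  note p = wall_permsD[OF \<pi>]
  have "compatible \<pi> f h \<longleftrightarrow> (\<forall>i\<in>labels. (if i \<le> r then i \<in> f \<longleftrightarrow> \<pi> i \<in> h else i \<in> h \<longleftrightarrow> \<pi> i \<in> f))"
    by (auto simp: compatible_def p)
  also have "\<dots> \<longleftrightarrow> (\<forall>k\<in>labels. k \<in> h \<longleftrightarrow> (if k \<le> r then pinv \<pi> k \<in> f else \<pi> k \<in> f))"
    by (smt (verit, best) inv_in_perms p permsD(1) pinv_perms)
  also have "\<dots> \<longleftrightarrow> h = {k \<in> labels. (if k \<le> r then pinv \<pi> k \<in> f else \<pi> k \<in> f)}"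
    using fh by blast
  finally show ?thesis .
qed

text \<open>Each f has the single continuation \<open>H f\<close> to the middle row, so no loop can
  arise. The left factor is applied before \<open>\<sigma>\<close> and the right factor after it,
  because left edges leave the top row and right edges arrive there.\<close>

lemma star_wall_left:
  assumes \<pi>: "\<pi> \<in> wall_perms" and \<sigma>: "\<sigma> \<in> perms"
  shows "star \<pi> \<sigma> = rgt \<pi> \<circ> \<sigma> \<circ> lft \<pi>" "lp \<pi> \<sigma> = 0"
proof -
  note p = wall_permsD[OF \<pi>]
  define H where "H f = {k \<in> labels. (if k \<le> r then pinv \<pi> k \<in> f else \<pi> k \<in> f)}" for f
  have cw: "h \<subseteq> labels \<and> compatible \<pi> f h \<longleftrightarrow> h = H f" if "f \<subseteq> labels" for f h
  proof -
    have "H f \<subseteq> labels" by (auto simp: H_def)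
    then show ?thesis
      using compatible_wall[OF \<pi> that, of h, folded H_def] compatible_wall[OF \<pi> that, of "H f", folded H_def] by blast
  qed
  show "star \<pi> \<sigma> = rgt \<pi> \<circ> \<sigma> \<circ> lft \<pi>"
  proof (rule star_eqI[OF p(1) \<sigma>])
    show "rgt \<pi> \<circ> \<sigma> \<circ> lft \<pi> \<in> perms" using lft_rgt_wall[OF \<pi>] wall_permsD(1) comp_in_perms \<sigma> by blast
    fix f g assume fg: "f \<subseteq> labels" "g \<subseteq> labels"
    have v: "vsrc (H f) g (lft \<pi> i) = vsrc f g i" "vsnk (H f) g i = vsnk f g (rgt \<pi> i)" if "i \<in> labels" for i
      using that p permsD(1)[OF p(1)] pinv_perms[OF p(1)] by (auto simp: vsrc_def vsnk_def H_def lft_def rgt_def)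
    have "lft \<pi> ` labels = labels" using lft_rgt_wall(1)[OF \<pi>] wall_permsD(1) by (auto simp: perms_def permutes_image)
    then have "compatible \<sigma> (H f) g \<longleftrightarrow> (\<forall>i\<in>lft \<pi> ` labels. vsrc (H f) g i = vsnk (H f) g (\<sigma> i))"
      by (simp only: compatible_alt)
    also have "\<dots> \<longleftrightarrow> (\<forall>i\<in>labels. vsrc f g i = vsnk f g (rgt \<pi> (\<sigma> (lft \<pi> i))))"
      using v permsD(1)[OF \<sigma>] permsD(1)[OF wall_permsD(1)[OF lft_rgt_wall(1)[OF \<pi>]]] by simp
    also have "\<dots> \<longleftrightarrow> compatible (rgt \<pi> \<circ> \<sigma> \<circ> lft \<pi>) f g" by (simp add: compatible_alt)
    finally have c: "compatible \<sigma> (H f) g \<longleftrightarrow> compatible (rgt \<pi> \<circ> \<sigma> \<circ> lft \<pi>) f g" .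
    have "(\<exists>h\<subseteq>labels. compatible \<pi> f h \<and> compatible \<sigma> h g) \<longleftrightarrow>
        (\<exists>h. (h \<subseteq> labels \<and> compatible \<pi> f h) \<and> compatible \<sigma> h g)" by simp
    then show "compatible (rgt \<pi> \<circ> \<sigma> \<circ> lft \<pi>) f g \<longleftrightarrow> (\<exists>h\<subseteq>labels. compatible \<pi> f h \<and> compatible \<sigma> h g)"
      unfolding cw[OF fg(1)] c[symmetric] by simp
  qed
  have "H {} = {}" by (auto simp: H_def)
  moreover have "{h. h \<subseteq> labels \<and> compatible \<pi> {} h \<and> compatible \<sigma> h {}} =
      {h. (h \<subseteq> labels \<and> compatible \<pi> {} h) \<and> compatible \<sigma> h {}}" by simp
  ultimately have "{h. h \<subseteq> labels \<and> compatible \<pi> {} h \<and> compatible \<sigma> h {}} = {{}}"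
    unfolding cw[OF empty_subsetI] using compatible_empty by auto
  then have "(2::nat) ^ lp \<pi> \<sigma> = 1" using lp_card[OF p(1) \<sigma>] by simp
  then show "lp \<pi> \<sigma> = 0" by simp
qed

lemma pinv_comp:
  assumes "\<sigma> \<in> perms" "\<tau> \<in> perms"
  shows "pinv (\<sigma> \<circ> \<tau>) = pinv \<tau> \<circ> pinv \<sigma>"
  by (rule pinv_unique) (auto simp: fun_eq_iff pinv_perms assms)

lemma star_wall_right:
  assumes \<pi>: "\<pi> \<in> wall_perms" and \<sigma>: "\<sigma> \<in> perms"
  shows "star \<sigma> \<pi> = lft \<pi> \<circ> \<sigma> \<circ> rgt \<pi>" "lp \<sigma> \<pi> = 0"
proof -
  note p = wall_permsD[OF \<pi>] and p' = wall_permsD[OF pinv_wall_perms[OF \<pi>]]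
  have "pinv (star \<sigma> \<pi>) = rgt (pinv \<pi>) \<circ> pinv \<sigma> \<circ> lft (pinv \<pi>)"
    unfolding star_inv[OF \<sigma> p(1), symmetric]
    by (rule star_wall_left(1)[OF pinv_wall_perms[OF \<pi>] inv_in_perms[OF \<sigma>]])
  also have "\<dots> = pinv (lft \<pi> \<circ> \<sigma> \<circ> rgt \<pi>)"
    using lft_rgt_wall[OF \<pi>, THEN wall_permsD(1)] \<sigma>
    by (simp add: pinv_comp comp_in_perms pinv_lft_rgt[OF \<pi>] comp_assoc)
  finally have "pinv (pinv (star \<sigma> \<pi>)) = pinv (pinv (lft \<pi> \<circ> \<sigma> \<circ> rgt \<pi>))" by simp
  then show "star \<sigma> \<pi> = lft \<pi> \<circ> \<sigma> \<circ> rgt \<pi>"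
    using lft_rgt_wall[OF \<pi>, THEN wall_permsD(1)] \<sigma> by (simp add: pinv_pinv star_in_perms p comp_in_perms)
  show "lp \<sigma> \<pi> = 0"
    using lp_inv[OF \<sigma> p(1)] star_wall_left(2)[OF pinv_wall_perms[OF \<pi>] inv_in_perms[OF \<sigma>]] by simp
qed

lemma star_id:
  assumes "\<sigma> \<in> perms"
  shows "star id \<sigma> = \<sigma>" "star \<sigma> id = \<sigma>" "lp id \<sigma> = 0" "lp \<sigma> id = 0"
  using star_wall_left[OF id_wall_perms assms] star_wall_right[OF id_wall_perms assms] by auto

section \<open>Hooks across the wall\<close>

definition hooks :: "(nat \<times> nat) set" where
  "hooks = {(i, j). i \<in> labels \<and> j \<in> labels \<and> i \<le> r \<and> r < j}"

lemma hooksD: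
  assumes "(i, j) \<in> hooks"
  shows "i \<in> labels" "j \<in> labels" "i \<le> r" "r < j" "i \<noteq> j" "transpose i j \<in> perms"
  using assms transpose_in_perms by (auto simp: hooks_def)

lemma compatible_hook:
  assumes "(i, j) \<in> hooks"
  shows "compatible (transpose i j) f h \<longleftrightarrow>
    (i \<in> f \<longleftrightarrow> j \<in> f) \<and> (i \<in> h \<longleftrightarrow> j \<in> h) \<and> (\<forall>k\<in>labels. k \<noteq> i \<longrightarrow> k \<noteq> j \<longrightarrow> (k \<in> f \<longleftrightarrow> k \<in> h))"
proof -
  note ij = hooksD[OF assms]
  have "compatible (transpose i j) f h \<longleftrightarrow> vsrc f h i = vsnk f h j \<and> vsrc f h j = vsnk f h i \<and>
      (\<forall>k\<in>labels. k \<noteq> i \<longrightarrow> k \<noteq> j \<longrightarrow> vsrc f h k = vsnk f h k)"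
  proof -
    have "(\<forall>k\<in>labels. Q k) \<longleftrightarrow> Q i \<and> Q j \<and> (\<forall>k\<in>labels. k \<noteq> i \<longrightarrow> k \<noteq> j \<longrightarrow> Q k)" for Q
      using ij by auto
    from this[of "\<lambda>k. vsrc f h k = vsnk f h (transpose i j k)"] show ?thesis
      unfolding compatible_alt by simp
  qed
  moreover have "vsrc f h i = vsnk f h j \<longleftrightarrow> (i \<in> f \<longleftrightarrow> j \<in> f)" "vsrc f h j = vsnk f h i \<longleftrightarrow> (i \<in> h \<longleftrightarrow> j \<in> h)"
    "vsrc f h k = vsnk f h k \<longleftrightarrow> (k \<in> f \<longleftrightarrow> k \<in> h)" for k
    using ij by (auto simp: vsrc_def vsnk_def)
  ultimately show ?thesis by simp
qed

text \<open>The transposition of i and j across the wall is the hook with the arcs {North i, North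
  j} and {South i, South j} and vertical lines elsewhere. The edge of \<open>\<sigma>\<close> that
  ends at j is continued by the lower arc to i and from there to \<open>\<sigma> i\<close>, while i
  is now sent to j by the upper arc. If \<open>\<sigma> i = j\<close>, the lower arc closes a
  loop.\<close>

lemma star_hook_left:
  assumes ij: "(i, j) \<in> hooks" and \<sigma>: "\<sigma> \<in> perms"
  shows "star (transpose i j) \<sigma> = transpose (\<sigma> i) j \<circ> \<sigma>" "lp (transpose i j) \<sigma> = (if \<sigma> i = j then 1 else 0)"
proof -
  note h = hooksD[OF ij]
  \<comment> \<open>The source whose edge is rerouted; b = i is the case of a loop.\<close>
  define b where "b = pinv \<sigma> j"
  have b: "\<sigma> k = j \<longleftrightarrow> k = b" for k using pinv_perms[OF \<sigma>] by (auto simp: b_def)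
  have bl: "b \<in> labels" using inv_in_perms[OF \<sigma>] permsD(1) h by (simp add: b_def)
  have ai: "\<sigma> k = \<sigma> i \<longleftrightarrow> k = i" for k by (rule permsD(3)[OF \<sigma>])
  have \<rho>: "transpose (\<sigma> i) j \<circ> \<sigma> \<in> perms" using comp_in_perms transpose_in_perms \<sigma> h permsD(1) by simp
  have split: "(\<forall>k\<in>labels. Q k) \<longleftrightarrow> (\<forall>k\<in>labels. k \<noteq> i \<longrightarrow> k \<noteq> b \<longrightarrow> Q k) \<and> Q i \<and> Q b" for Q
    using h(1) bl by auto
  \<comment> \<open>Only the edges of \<open>\<sigma>\<close> at i and b see the lower arc of the
    hook; for all others the middle row has the colours of f.\<close>
  have comp\<sigma>: "compatible \<sigma> x g \<longleftrightarrow> (\<forall>k\<in>labels. k \<noteq> i \<longrightarrow> k \<noteq> b \<longrightarrow> vsrc f g k = vsnk f g (\<sigma> k)) \<and>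
        (b \<noteq> i \<longrightarrow> vsrc f g b = (i \<in> x) \<and> (i \<in> x) = vsnk f g (\<sigma> i))"
    if x: "x \<subseteq> labels" "compatible (transpose i j) f x" for f g x
  proof -
    have c: "(i \<in> f \<longleftrightarrow> j \<in> f)" "(i \<in> x \<longleftrightarrow> j \<in> x)" "\<And>k. k \<in> labels \<Longrightarrow> k \<noteq> i \<Longrightarrow> k \<noteq> j \<Longrightarrow> (k \<in> f \<longleftrightarrow> k \<in> x)"
      using x(2) compatible_hook[OF ij] by auto
    have s: "vsrc x g k = vsrc f g k" if "k \<in> labels" "k \<noteq> i" for k
      using c(3)[OF that] h by (auto simp: vsrc_def)
    have t: "vsnk x g k = vsnk f g k" if "k \<in> labels" "k \<noteq> j" for k
      using c(3)[OF that(1) _ that(2)] h by (auto simp: vsnk_def)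
    have si: "vsrc x g i = (i \<in> x)" "vsnk x g j = (i \<in> x)" using h c(2) by (auto simp: vsrc_def vsnk_def)
    have gen: "k \<noteq> i \<Longrightarrow> k \<noteq> b \<Longrightarrow> k \<in> labels \<Longrightarrow> (vsrc x g k = vsnk x g (\<sigma> k)) = (vsrc f g k = vsnk f g (\<sigma> k))" for k
      using s[of k] t[of "\<sigma> k"] b[of k] permsD(1)[OF \<sigma>] by simp
    show ?thesis
    proof (cases "b = i")
      case True
      then have "\<sigma> i = j" using b by simp
      then have "vsrc x g i = vsnk x g (\<sigma> i)" using si by simp
      then show ?thesis
        unfolding compatible_alt split[of "\<lambda>k. vsrc x g k = vsnk x g (\<sigma> k)"] using gen True by simp
    next
      case False
      then have "\<sigma> i \<noteq> j" using b by auto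
      then have "(vsrc x g i = vsnk x g (\<sigma> i)) = ((i \<in> x) = vsnk f g (\<sigma> i))"
        using si t permsD(1)[OF \<sigma> h(1)] by simp
      moreover have "(vsrc x g b = vsnk x g (\<sigma> b)) = (vsrc f g b = (i \<in> x))"
        using si s[OF bl False] b[of b] by simp
      ultimately show ?thesis
        unfolding compatible_alt split[of "\<lambda>k. vsrc x g k = vsnk x g (\<sigma> k)"] using gen False by auto
    qed
  qed
  show "star (transpose i j) \<sigma> = transpose (\<sigma> i) j \<circ> \<sigma>"
  proof (rule star_eqI[OF h(6) \<sigma> \<rho>])
    fix f g assume fg: "f \<subseteq> labels" "g \<subseteq> labels"
    have \<rho>k: "k \<noteq> i \<Longrightarrow> k \<noteq> b \<Longrightarrow> (transpose (\<sigma> i) j \<circ> \<sigma>) k = \<sigma> k" for k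
      using b[of k] ai[of k] by (simp add: transpose_def)
    have \<rho>i: "(transpose (\<sigma> i) j \<circ> \<sigma>) i = j" "(transpose (\<sigma> i) j \<circ> \<sigma>) b = \<sigma> i"
      using b[of b] by (simp_all add: transpose_def)
    have c\<rho>: "compatible (transpose (\<sigma> i) j \<circ> \<sigma>) f g \<longleftrightarrow>
        (\<forall>k\<in>labels. k \<noteq> i \<longrightarrow> k \<noteq> b \<longrightarrow> vsrc f g k = vsnk f g (\<sigma> k)) \<and> (i \<in> f \<longleftrightarrow> j \<in> f) \<and>
        (b \<noteq> i \<longrightarrow> vsrc f g b = vsnk f g (\<sigma> i))"
    proof -
      have e: "vsrc f g i \<longleftrightarrow> i \<in> f" "vsnk f g j \<longleftrightarrow> j \<in> f" using h by (auto simp: vsrc_def vsnk_def)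
      have "i \<noteq> b \<or> \<sigma> i = j" using b by auto
      then show ?thesis
        unfolding compatible_alt split[of "\<lambda>k. vsrc f g k = vsnk f g ((transpose (\<sigma> i) j \<circ> \<sigma>) k)"] \<rho>i
        using e \<rho>k by auto
    qed
    show "compatible (transpose (\<sigma> i) j \<circ> \<sigma>) f g \<longleftrightarrow> (\<exists>x\<subseteq>labels. compatible (transpose i j) f x \<and> compatible \<sigma> x g)"
    proof
      assume A: "compatible (transpose (\<sigma> i) j \<circ> \<sigma>) f g"
      \<comment> \<open>The lower arc gives i and j the same colour in the middle row; the edge of
        \<open>\<sigma>\<close> that starts at i prescribes which one, unless it closes a
        loop.\<close>
      define x where "x = (f - {i, j}) \<union> (if vsnk f g (\<sigma> i) then {i, j} else {})"
      have x: "x \<subseteq> labels" "i \<in> x \<longleftrightarrow> vsnk f g (\<sigma> i)" using fg h by (auto simp: x_def)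
      have cx: "compatible (transpose i j) f x"
        unfolding compatible_hook[OF ij] using A c\<rho> by (auto simp: x_def)
      have "compatible \<sigma> x g" using comp\<sigma>[OF x(1) cx] A c\<rho> x(2) by simp
      then show "\<exists>x\<subseteq>labels. compatible (transpose i j) f x \<and> compatible \<sigma> x g" using x cx by auto
    next
      assume "\<exists>x\<subseteq>labels. compatible (transpose i j) f x \<and> compatible \<sigma> x g"
      then obtain x where x: "x \<subseteq> labels" "compatible (transpose i j) f x" "compatible \<sigma> x g" by auto
      then show "compatible (transpose (\<sigma> i) j \<circ> \<sigma>) f g"
        using comp\<sigma>[OF x(1,2), of g] c\<rho> compatible_hook[OF ij, of f x] by blast
    qed
  qed
  have c0: "x \<subseteq> labels \<and> compatible (transpose i j) {} x \<longleftrightarrow> x = {} \<or> x = {i, j}" for x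
  proof
    assume A: "x \<subseteq> labels \<and> compatible (transpose i j) {} x"
    then have "x \<subseteq> {i, j}" "i \<in> x \<longleftrightarrow> j \<in> x" unfolding compatible_hook[OF ij] by auto
    then show "x = {} \<or> x = {i, j}" by auto
  next
    assume "x = {} \<or> x = {i, j}"
    then show "x \<subseteq> labels \<and> compatible (transpose i j) {} x"
      unfolding compatible_hook[OF ij] using h by auto
  qed
  have c1: "compatible \<sigma> {i, j} {} \<longleftrightarrow> b = i"
    using comp\<sigma>[of "{i, j}" "{}" "{}"] c0[of "{i, j}"] by (auto simp: vsnk_def vsrc_def)
  have "{x. x \<subseteq> labels \<and> compatible (transpose i j) {} x \<and> compatible \<sigma> x {}} =
      {x. (x \<subseteq> labels \<and> compatible (transpose i j) {} x) \<and> compatible \<sigma> x {}}" by simp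
  also have "\<dots> = (if \<sigma> i = j then {{}, {i, j}} else {{}})"
    unfolding c0 using c1 compatible_empty[of \<sigma>] b[of i] by (cases "\<sigma> i = j") auto
  finally have "(2::nat) ^ lp (transpose i j) \<sigma> = (if \<sigma> i = j then 2 else 1)"
    using lp_card[OF h(6) \<sigma>] by simp
  moreover have "(2::nat) ^ n = 2 \<Longrightarrow> n = 1" "(2::nat) ^ n = 1 \<Longrightarrow> n = 0" for n
    using power_inject_exp[of "2::nat" n 1] power_inject_exp[of "2::nat" n 0] by simp_all
  ultimately show "lp (transpose i j) \<sigma> = (if \<sigma> i = j then 1 else 0)"
    by (simp split: if_splits)
qed

lemma star_hook_right:
  assumes ij: "(i, j) \<in> hooks" and \<sigma>: "\<sigma> \<in> perms"
  shows "star \<sigma> (transpose i j) = transpose i (\<sigma> j) \<circ> \<sigma>" "lp \<sigma> (transpose i j) = (if \<sigma> j = i then 1 else 0)"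
proof -
  note h = hooksD[OF ij] and \<sigma>' = inv_in_perms[OF \<sigma>]
  have t: "pinv (transpose a b) = transpose a b" for a b :: nat
    by (rule pinv_unique) (auto simp: fun_eq_iff)
  have "pinv (star \<sigma> (transpose i j)) = transpose (pinv \<sigma> i) j \<circ> pinv \<sigma>"
    unfolding star_inv[OF \<sigma> h(6), symmetric] t by (rule star_hook_left(1)[OF ij \<sigma>'])
  moreover have "transpose (pinv \<sigma> i) j \<in> perms" using transpose_in_perms h permsD(1)[OF \<sigma>'] by simp
  ultimately have "pinv (pinv (star \<sigma> (transpose i j))) = \<sigma> \<circ> transpose (pinv \<sigma> i) j"
    using pinv_comp[of "transpose (pinv \<sigma> i) j" "pinv \<sigma>"] \<sigma> \<sigma>' by (simp add: pinv_pinv t)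
  moreover have "\<sigma> \<circ> transpose (pinv \<sigma> i) j = transpose i (\<sigma> j) \<circ> \<sigma>"
    using pinv_perms[OF \<sigma>] permsD(3)[OF \<sigma>] by (auto simp: fun_eq_iff transpose_def)
  ultimately show "star \<sigma> (transpose i j) = transpose i (\<sigma> j) \<circ> \<sigma>"
    using \<sigma> h by (simp add: pinv_pinv star_in_perms)
  have "pinv \<sigma> i = j \<longleftrightarrow> \<sigma> j = i" using pinv_perms[OF \<sigma>] by auto
  then show "lp \<sigma> (transpose i j) = (if \<sigma> j = i then 1 else 0)"
    using lp_inv[OF \<sigma> h(6)] star_hook_left(2)[OF ij \<sigma>'] by (simp add: t)
qed

text \<open>Colour only the edge of the product at i. In the upper diagram both ends of the northern
  arc from i are then coloured, so the edge of the product ends at \<open>\<sigma> i\<close>: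
  northern arcs of the upper factor survive.\<close>

lemma star_top:
  assumes "\<sigma> \<in> perms" "\<tau> \<in> perms" "i \<in> labels" "i \<le> r" "\<sigma> i > r"
  shows "star \<sigma> \<tau> i = \<sigma> i"
proof -
  define \<rho> where "\<rho> = star \<sigma> \<tau>"
  have \<rho>: "\<rho> \<in> perms" using star_in_perms assms by (simp add: \<rho>_def)
  define f where "f = (if \<rho> i \<le> r then {i} else {i, \<rho> i})"
  define g where "g = (if \<rho> i \<le> r then {\<rho> i} else {})"
  have fg: "f \<subseteq> labels" "g \<subseteq> labels" using permsD(1)[OF \<rho>] assms by (auto simp: f_def g_def)
  have "vsrc f g k = (k = i)" "vsnk f g k = (k = \<rho> i)" for k
    using assms by (auto simp: f_def g_def vsrc_def vsnk_def)
  then have "compatible \<rho> f g" using permsD(3)[OF \<rho>] by (auto simp: compatible_alt)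
  then obtain h where "compatible \<sigma> f h" using compatible_star[OF assms(1,2) fg] by (auto simp: \<rho>_def)
  then have "vsnk f h (\<sigma> i)" using assms by (auto simp: compatible_alt vsrc_def f_def)
  then show ?thesis using assms by (auto simp: vsnk_def f_def \<rho>_def split: if_splits)
qed

section \<open>The number of arcs\<close>

definition arcs :: "(nat \<Rightarrow> nat) \<Rightarrow> nat" where
  "arcs \<sigma> = card {i \<in> labels. i \<le> r \<and> \<sigma> i > r}"

text \<open>Labels left of the wall are equally many as arguments and as values, so as many labels
  are sent from left to right (northern arcs) as from right to left (southern arcs).\<close>

lemma arcs_right:
  assumes \<sigma>: "\<sigma> \<in> perms"
  shows "card {j \<in> labels. j > r \<and> \<sigma> j \<le> r} = arcs \<sigma>"
proof -
  have fin: "finite {i \<in> labels. Q i}" for Q by simp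
  have "{k \<in> labels. k \<le> r} = \<sigma> ` {k \<in> labels. \<sigma> k \<le> r}"
    using permsD(1)[OF \<sigma>] pinv_perms[OF \<sigma>] permsD(1)[OF inv_in_perms[OF \<sigma>]] by (auto simp: image_iff) metis
  then have "card {k \<in> labels. k \<le> r} = card {k \<in> labels. \<sigma> k \<le> r}"
    using permsD(3)[OF \<sigma>] by (metis (mono_tags, lifting) card_image inj_onI)
  moreover have "card {k \<in> labels. k \<le> r} = card {k \<in> labels. k \<le> r \<and> \<sigma> k \<le> r} + arcs \<sigma>"
    unfolding arcs_def by (subst card_Un_disjoint[symmetric]) (auto intro: arg_cong[where f = card])
  moreover have "card {k \<in> labels. \<sigma> k \<le> r} =
      card {k \<in> labels. k \<le> r \<and> \<sigma> k \<le> r} + card {j \<in> labels. j > r \<and> \<sigma> j \<le> r}"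
    by (subst card_Un_disjoint[symmetric]) (auto intro: arg_cong[where f = card])
  ultimately show ?thesis by simp
qed

lemma arcs_pinv:
  assumes \<sigma>: "\<sigma> \<in> perms"
  shows "arcs (pinv \<sigma>) = arcs \<sigma>"
proof -
  have "{i \<in> labels. i \<le> r \<and> pinv \<sigma> i > r} = \<sigma> ` {j \<in> labels. j > r \<and> \<sigma> j \<le> r}"
    using permsD(1)[OF \<sigma>] pinv_perms[OF \<sigma>] permsD(1)[OF inv_in_perms[OF \<sigma>]] by (auto simp: image_iff) metis
  then have "arcs (pinv \<sigma>) = card {j \<in> labels. j > r \<and> \<sigma> j \<le> r}"
    using permsD(3)[OF \<sigma>] unfolding arcs_def by (metis (mono_tags, lifting) card_image inj_onI)
  then show ?thesis using arcs_right[OF \<sigma>] by simp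
qed

text \<open>The northern arcs of the upper factor persist and, by inversion, so do the southern arcs
  of the lower one.\<close>

lemma arcs_star:
  assumes "\<sigma> \<in> perms" "\<tau> \<in> perms"
  shows "arcs \<sigma> \<le> arcs (star \<sigma> \<tau>)" "arcs \<tau> \<le> arcs (star \<sigma> \<tau>)"
proof -
  have *: "arcs \<sigma> \<le> arcs (star \<sigma> \<tau>)" if "\<sigma> \<in> perms" "\<tau> \<in> perms" for \<sigma> \<tau>
    unfolding arcs_def by (rule card_mono) (use star_top[OF that] in auto)
  show "arcs \<sigma> \<le> arcs (star \<sigma> \<tau>)" by (rule *[OF assms])
  show "arcs \<tau> \<le> arcs (star \<sigma> \<tau>)"
    using *[OF inv_in_perms[OF assms(2)] inv_in_perms[OF assms(1)]] assms
    by (simp add: star_inv arcs_pinv star_in_perms)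
qed

lemma arcs_wall:
  assumes "\<pi> \<in> wall_perms" "\<rho> \<in> wall_perms" "\<sigma> \<in> perms"
  shows "arcs (\<pi> \<circ> \<sigma> \<circ> \<rho>) = arcs \<sigma>"
proof -
  note \<pi> = wall_permsD[OF assms(1)] and \<rho> = wall_permsD[OF assms(2)]
  have "{i \<in> labels. i \<le> r \<and> \<sigma> i > r} = \<rho> ` {i \<in> labels. i \<le> r \<and> (\<pi> \<circ> \<sigma> \<circ> \<rho>) i > r}"
  proof (intro Set.set_eqI iffI)
    fix i assume i: "i \<in> {i \<in> labels. i \<le> r \<and> \<sigma> i > r}"
    have "i = \<rho> (pinv \<rho> i)" by (simp add: pinv_perms \<rho>)
    moreover have "pinv \<rho> i \<in> {i \<in> labels. i \<le> r \<and> (\<pi> \<circ> \<sigma> \<circ> \<rho>) i > r}"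
      using i permsD(1)[OF inv_in_perms[OF \<rho>(1)]] wall_permsD(2)[OF pinv_wall_perms[OF assms(2)], of i] \<pi>(2)[of "\<sigma> i"]
      by (simp add: pinv_perms \<rho>(1))
    ultimately show "i \<in> \<rho> ` {i \<in> labels. i \<le> r \<and> (\<pi> \<circ> \<sigma> \<circ> \<rho>) i > r}" by blast
  next
    fix i assume "i \<in> \<rho> ` {i \<in> labels. i \<le> r \<and> (\<pi> \<circ> \<sigma> \<circ> \<rho>) i > r}"
    then obtain k where k: "i = \<rho> k" "k \<in> labels" "k \<le> r" "\<not> \<pi> (\<sigma> (\<rho> k)) \<le> r" by auto
    then show "i \<in> {i \<in> labels. i \<le> r \<and> \<sigma> i > r}"
      using permsD(1)[OF \<rho>(1) k(2)] \<rho>(2)[of k] \<pi>(2)[of "\<sigma> (\<rho> k)"] by auto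
  qed
  then show ?thesis unfolding arcs_def using permsD(3)[OF \<rho>(1)] by (metis (mono_tags, lifting) card_image inj_onI)
qed

end

section \<open>The walled Brauer algebra on permutations\<close>

text \<open>The additive self-maps of a function space form a ring with unit, in which
  \<open>jucys_murphy_annihilated\<close> can be applied to transpositions acting by
  translation.\<close>

typedef (overloaded) ('a, 'k::field) endo = "{f :: ('a \<Rightarrow> 'k) \<Rightarrow> 'a \<Rightarrow> 'k. \<forall>x y. f (x + y) = f x + f y}"
  morphisms app Endo
  by (intro exI[of _ id]) simp

setup_lifting type_definition_endo

instantiation endo :: (type, field) ring_1
begin

lift_definition zero_endo :: "('a, 'b) endo" is "\<lambda>_. 0" by simp
lift_definition one_endo :: "('a, 'b) endo" is "\<lambda>y. y" by simp
lift_definition plus_endo :: "('a, 'b) endo \<Rightarrow> ('a, 'b) endo \<Rightarrow> ('a, 'b) endo" is "\<lambda>f g y. f y + g y"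
  by (simp add: algebra_simps)
lift_definition minus_endo :: "('a, 'b) endo \<Rightarrow> ('a, 'b) endo \<Rightarrow> ('a, 'b) endo" is "\<lambda>f g y. f y - g y"
  by (simp add: algebra_simps)
lift_definition uminus_endo :: "('a, 'b) endo \<Rightarrow> ('a, 'b) endo" is "\<lambda>f y. - f y" by simp
lift_definition times_endo :: "('a, 'b) endo \<Rightarrow> ('a, 'b) endo \<Rightarrow> ('a, 'b) endo" is "\<lambda>f g y. f (g y)" by simp

instance
proof
  show "(0 :: ('a, 'b) endo) \<noteq> 1"
  proof (transfer, rule notI)
    assume "(\<lambda>_. 0) = (\<lambda>y :: 'a \<Rightarrow> 'b. y)"
    from fun_cong[OF fun_cong[OF this, of "\<lambda>_. 1"], of undefined] show False by simp
  qed
qed (transfer, simp add: algebra_simps fun_eq_iff)+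

end

lemma app_of_int: "app (of_int c) y = (\<lambda>\<sigma>. of_int c * y \<sigma>)"
proof -
  have n: "app (of_nat n) y = (\<lambda>\<sigma>. of_nat n * y \<sigma>)" for n
    by (induction n) (simp_all add: zero_endo.rep_eq plus_endo.rep_eq one_endo.rep_eq fun_eq_iff algebra_simps)
  obtain m n' where c: "c = int m - int n'" by (rule int_diff_cases)
  show ?thesis
    unfolding c of_int_diff of_int_of_nat_eq minus_endo.rep_eq n by (simp add: fun_eq_iff algebra_simps)
qed

definition jm_op :: "nat set \<Rightarrow> nat \<Rightarrow> ((nat \<Rightarrow> nat) \<Rightarrow> 'k::field) \<Rightarrow> (nat \<Rightarrow> nat) \<Rightarrow> 'k" where
  "jm_op S z y \<sigma> = (\<Sum>v\<in>S. y (transpose v z \<circ> \<sigma>))"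

definition jm_shift :: "nat set \<Rightarrow> nat \<Rightarrow> int \<Rightarrow> ((nat \<Rightarrow> nat) \<Rightarrow> 'k::field) \<Rightarrow> (nat \<Rightarrow> nat) \<Rightarrow> 'k" where
  "jm_shift S z c y \<sigma> = jm_op S z y \<sigma> - of_int c * y \<sigma>"

lemma jm_op_annihilated:
  assumes "finite S" "z \<notin> S"
  obtains cs where "set cs \<subseteq> jm_values (Suc (card S))"
    "\<And>y. foldr (jm_shift S z) cs y = (\<lambda>_. 0 :: 'k::field)"
proof -
  define t :: "nat \<Rightarrow> nat \<Rightarrow> (nat \<Rightarrow> nat, 'k) endo" where
    "t u v = Endo (\<lambda>y \<sigma>. y (transpose u v \<circ> \<sigma>))" for u v
  have t: "app (t u v) y = (\<lambda>\<sigma>. y (transpose u v \<circ> \<sigma>))" for u v y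
    unfolding t_def by (subst Endo_inverse) (auto simp: fun_eq_iff)
  have eqI: "f = g" if "\<And>y \<sigma>. app f y \<sigma> = app g y \<sigma>" for f g :: "(nat \<Rightarrow> nat, 'k) endo"
    using that by (metis app_inject ext)
  \<comment> \<open>Translation operators multiply in the opposite order of their
    permutations.\<close>
  have comm: "t u v * t w x = t u' v' * t w' x'"
    if "\<And>k. transpose w x (transpose u v k) = transpose w' x' (transpose u' v' k)" for u v w x u' v' w' x'
  proof (rule eqI)
    fix y :: "(nat \<Rightarrow> nat) \<Rightarrow> 'k" and \<sigma> :: "nat \<Rightarrow> nat"
    have "transpose w x \<circ> (transpose u v \<circ> \<sigma>) = transpose w' x' \<circ> (transpose u' v' \<circ> \<sigma>)"
      using that by (auto simp: fun_eq_iff)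
    then show "app (t u v * t w x) y \<sigma> = app (t u' v' * t w' x') y \<sigma>" by (simp add: times_endo.rep_eq t)
  qed
  have sumapp: "app (\<Sum>v\<in>S. t v z) y = jm_op S z y" for y
    using assms(1)
    by (induction S rule: finite_induct) (auto simp: zero_endo.rep_eq plus_endo.rep_eq t jm_op_def fun_eq_iff)
  obtain cs where cs: "set cs \<subseteq> jm_values (Suc (card S))"
    "prod_list (map (\<lambda>c. (\<Sum>v\<in>S. t v z) - of_int c) cs) = 0"
  proof -
    have "\<exists>cs. set cs \<subseteq> jm_values (Suc (card S)) \<and>
        prod_list (map (\<lambda>c. (\<Sum>v\<in>S. t v z) - of_int c) cs) = 0"
    proof (rule jucys_murphy_annihilated)
      show "t u v = t v u" for u v by (simp add: t_def transpose_commute)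
      show "t u v * t u v = 1" for u v
        by (rule eqI) (simp add: times_endo.rep_eq one_endo.rep_eq t comp_assoc[symmetric])
      show "t u v * t v w = t v w * t u w" if "u \<noteq> v" "v \<noteq> w" "u \<noteq> w" for u v w
        by (rule comm) (use that in \<open>simp add: transpose_def\<close>)
      show "t u v * t w x = t w x * t u v"
        if "u \<noteq> w" "u \<noteq> x" "v \<noteq> w" "v \<noteq> x" "u \<noteq> v" "w \<noteq> x" for u v w x
        by (rule comm) (use that in \<open>simp add: transpose_def\<close>)
    qed (use assms in auto)
    then show ?thesis using that by blast
  qed
  have "foldr (jm_shift S z) ds y = app (prod_list (map (\<lambda>c. (\<Sum>v\<in>S. t v z) - of_int c) ds)) y" for ds y
  proof (induction ds)
    case (Cons c ds)
    have "app ((\<Sum>v\<in>S. t v z) - of_int c) w = jm_shift S z c w" for w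
      by (simp add: minus_endo.rep_eq sumapp app_of_int jm_shift_def fun_eq_iff)
    then show ?case by (simp add: times_endo.rep_eq Cons)
  qed (simp add: one_endo.rep_eq)
  then show ?thesis using that[OF cs(1)] cs(2) by (simp add: zero_endo.rep_eq zero_fun_def)
qed

text \<open>Each \<open>jm_shift\<close> multiplies an eigenvector by e - c, so e is a root of the
  annihilating polynomial.\<close>

lemma jm_op_eigenvalue:
  assumes "finite S" "z \<notin> S" and u: "u \<noteq> (\<lambda>_. 0)" and eig: "\<And>\<sigma>. jm_op S z u \<sigma> = (e :: 'k::field) * u \<sigma>"
  shows "\<exists>c\<in>jm_values (Suc (card S)). e = of_int c"
proof -
  obtain cs where cs: "set cs \<subseteq> jm_values (Suc (card S))"
    "\<And>y. foldr (jm_shift S z) cs y = (\<lambda>_. 0 :: 'k)" using jm_op_annihilated[OF assms(1,2)] by blast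
  have "foldr (jm_shift S z) ds u = (\<lambda>\<sigma>. prod_list (map (\<lambda>c. e - of_int c) ds) * u \<sigma>)" for ds
  proof (induction ds)
    case (Cons c ds)
    have "jm_op S z (\<lambda>\<sigma>. k * u \<sigma>) \<sigma> = k * (e * u \<sigma>)" for k \<sigma>
      using eig[of \<sigma>] by (simp add: jm_op_def sum_distrib_left[symmetric])
    then have "jm_shift S z c (\<lambda>\<sigma>. k * u \<sigma>) = (\<lambda>\<sigma>. (e - of_int c) * k * u \<sigma>)" for k
      by (simp add: jm_shift_def fun_eq_iff algebra_simps)
    then show ?case by (simp add: Cons)
  qed simp
  then have "prod_list (map (\<lambda>c. e - of_int c) cs) * u \<sigma> = 0" for \<sigma>
    using cs(2)[of u] by (metis)
  then have "prod_list (map (\<lambda>c. e - of_int c) cs) = 0" using u by (metis mult_eq_0_iff ext)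
  then obtain c where "c \<in> set cs" "e - of_int c = 0" by (auto simp: prod_list_zero_iff)
  then show ?thesis using cs(1) by auto
qed

locale walled_algebra = walled_shape r s for r s :: nat +
  fixes \<delta> :: "'k::field"
begin

definition mul :: "((nat \<Rightarrow> nat) \<Rightarrow> 'k) \<Rightarrow> ((nat \<Rightarrow> nat) \<Rightarrow> 'k) \<Rightarrow> (nat \<Rightarrow> nat) \<Rightarrow> 'k" where
  "mul a b \<rho> = (\<Sum>\<sigma>\<in>perms. \<Sum>\<tau>\<in>perms. if star \<sigma> \<tau> = \<rho> then a \<sigma> * b \<tau> * \<delta> ^ lp \<sigma> \<tau> else 0)"

definition bas :: "(nat \<Rightarrow> nat) \<Rightarrow> (nat \<Rightarrow> nat) \<Rightarrow> 'k" where
  "bas \<sigma> = (\<lambda>\<rho>. if \<rho> = \<sigma> then 1 else 0)"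

definition scal :: "'k \<Rightarrow> ((nat \<Rightarrow> nat) \<Rightarrow> 'k) \<Rightarrow> (nat \<Rightarrow> nat) \<Rightarrow> 'k" where
  "scal c a = (\<lambda>\<rho>. c * a \<rho>)"

definition supported :: "((nat \<Rightarrow> nat) \<Rightarrow> 'k) set" where
  "supported = {a. \<forall>\<sigma>. \<sigma> \<notin> perms \<longrightarrow> a \<sigma> = 0}"

text \<open>Used with two different weights G, to expand both bracketings of a triple
  product.\<close>

lemma mul_sum_star:
  "(\<Sum>\<alpha>\<in>perms. mul a b \<alpha> * G \<alpha>) = (\<Sum>\<sigma>\<in>perms. \<Sum>\<tau>\<in>perms. a \<sigma> * b \<tau> * \<delta> ^ lp \<sigma> \<tau> * G (star \<sigma> \<tau>))"
proof -
  have "(\<Sum>\<alpha>\<in>perms. mul a b \<alpha> * G \<alpha>) =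
      (\<Sum>\<alpha>\<in>perms. \<Sum>\<sigma>\<in>perms. \<Sum>\<tau>\<in>perms. if star \<sigma> \<tau> = \<alpha> then a \<sigma> * b \<tau> * \<delta> ^ lp \<sigma> \<tau> * G \<alpha> else 0)"
    unfolding mul_def sum_distrib_right by (intro sum.cong refl) simp
  also have "\<dots> = (\<Sum>\<sigma>\<in>perms. \<Sum>\<alpha>\<in>perms. \<Sum>\<tau>\<in>perms. if star \<sigma> \<tau> = \<alpha> then a \<sigma> * b \<tau> * \<delta> ^ lp \<sigma> \<tau> * G \<alpha> else 0)"
    by (rule sum.swap)
  also have "\<dots> = (\<Sum>\<sigma>\<in>perms. \<Sum>\<tau>\<in>perms. \<Sum>\<alpha>\<in>perms. if star \<sigma> \<tau> = \<alpha> then a \<sigma> * b \<tau> * \<delta> ^ lp \<sigma> \<tau> * G \<alpha> else 0)"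
    by (intro sum.cong refl sum.swap)
  also have "\<dots> = (\<Sum>\<sigma>\<in>perms. \<Sum>\<tau>\<in>perms. a \<sigma> * b \<tau> * \<delta> ^ lp \<sigma> \<tau> * G (star \<sigma> \<tau>))"
    by (intro sum.cong refl) (simp add: sum.delta' finite_perms star_in_perms)
  finally show ?thesis .
qed

lemma mul_assoc: "mul (mul a b) c = mul a (mul b c)"
proof
  fix \<rho>
  have "mul (mul a b) c \<rho> = (\<Sum>\<upsilon>\<in>perms. \<Sum>\<alpha>\<in>perms. mul a b \<alpha> * (if star \<alpha> \<upsilon> = \<rho> then c \<upsilon> * \<delta> ^ lp \<alpha> \<upsilon> else 0))"
    unfolding mul_def[of "mul a b"] by (subst sum.swap) (intro sum.cong refl, simp)
  also have "\<dots> = (\<Sum>\<upsilon>\<in>perms. \<Sum>\<sigma>\<in>perms. \<Sum>\<tau>\<in>perms. a \<sigma> * b \<tau> * \<delta> ^ lp \<sigma> \<tau> *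
      (if star (star \<sigma> \<tau>) \<upsilon> = \<rho> then c \<upsilon> * \<delta> ^ lp (star \<sigma> \<tau>) \<upsilon> else 0))"
    by (simp only: mul_sum_star)
  also have "\<dots> = (\<Sum>\<upsilon>\<in>perms. \<Sum>\<sigma>\<in>perms. \<Sum>\<tau>\<in>perms. b \<tau> * c \<upsilon> * \<delta> ^ lp \<tau> \<upsilon> *
      (if star \<sigma> (star \<tau> \<upsilon>) = \<rho> then a \<sigma> * \<delta> ^ lp \<sigma> (star \<tau> \<upsilon>) else 0))"
  proof (intro sum.cong refl)
    fix \<upsilon> \<sigma> \<tau> assume p: "\<upsilon> \<in> perms" "\<sigma> \<in> perms" "\<tau> \<in> perms"
    have "\<delta> ^ lp \<sigma> \<tau> * \<delta> ^ lp (star \<sigma> \<tau>) \<upsilon> = \<delta> ^ lp \<tau> \<upsilon> * \<delta> ^ lp \<sigma> (star \<tau> \<upsilon>)"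
      unfolding power_add[symmetric] lp_assoc[OF p(2,3,1)] ..
    then show "a \<sigma> * b \<tau> * \<delta> ^ lp \<sigma> \<tau> * (if star (star \<sigma> \<tau>) \<upsilon> = \<rho> then c \<upsilon> * \<delta> ^ lp (star \<sigma> \<tau>) \<upsilon> else 0) =
        b \<tau> * c \<upsilon> * \<delta> ^ lp \<tau> \<upsilon> * (if star \<sigma> (star \<tau> \<upsilon>) = \<rho> then a \<sigma> * \<delta> ^ lp \<sigma> (star \<tau> \<upsilon>) else 0)"
      unfolding star_assoc[OF p(2,3,1)] by (simp add: mult_ac)
  qed
  also have "\<dots> = (\<Sum>\<sigma>\<in>perms. \<Sum>\<tau>\<in>perms. \<Sum>\<upsilon>\<in>perms. b \<tau> * c \<upsilon> * \<delta> ^ lp \<tau> \<upsilon> *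
      (if star \<sigma> (star \<tau> \<upsilon>) = \<rho> then a \<sigma> * \<delta> ^ lp \<sigma> (star \<tau> \<upsilon>) else 0))"
    by (subst sum.swap) (intro sum.cong refl sum.swap)
  also have "\<dots> = (\<Sum>\<sigma>\<in>perms. \<Sum>\<alpha>\<in>perms. mul b c \<alpha> * (if star \<sigma> \<alpha> = \<rho> then a \<sigma> * \<delta> ^ lp \<sigma> \<alpha> else 0))"
    by (simp only: mul_sum_star)
  also have "\<dots> = mul a (mul b c) \<rho>"
    unfolding mul_def[of a "mul b c"] by (intro sum.cong refl) simp
  finally show "mul (mul a b) c \<rho> = mul a (mul b c) \<rho>" .
qed

lemma mul_add_left: "mul (a + b) c = mul a c + mul b c"
  unfolding fun_eq_iff mul_def plus_fun_apply sum.distrib[symmetric]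
  by (intro allI sum.cong refl) (simp add: distrib_right)

lemma mul_add_right: "mul c (a + b) = mul c a + mul c b"
  unfolding fun_eq_iff mul_def plus_fun_apply sum.distrib[symmetric]
  by (intro allI sum.cong refl) (simp add: distrib_left distrib_right)

lemma mul_scal: "mul (scal k a) b = scal k (mul a b)" "mul a (scal k b) = scal k (mul a b)"
  unfolding fun_eq_iff mul_def scal_def sum_distrib_left
  by (intro allI sum.cong refl, simp)+

lemma mul_zero [simp]: "mul 0 a = 0" "mul a 0 = 0"
  unfolding fun_eq_iff mul_def by (simp_all cong: if_cong)

lemma mul_diff_left: "mul (a - b) c = mul a c - mul b c"
  using mul_add_left[of "a - b" b c] by (simp add: eq_diff_eq)

lemma mul_diff_right: "mul c (a - b) = mul c a - mul c b"
  using mul_add_right[of c "a - b" b] by (simp add: eq_diff_eq)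

lemma mul_sum_left: "mul (\<Sum>i\<in>I. f i) b = (\<Sum>i\<in>I. mul (f i) b)"
proof (induction I rule: infinite_finite_induct)
  case (insert x F)
  then show ?case by (simp only: sum.insert mul_add_left not_False_eq_True)
qed (simp_all only: sum.infinite sum.empty mul_zero not_False_eq_True)

lemma mul_sum_right: "mul b (\<Sum>i\<in>I. f i) = (\<Sum>i\<in>I. mul b (f i))"
proof (induction I rule: infinite_finite_induct)
  case (insert x F)
  then show ?case by (simp only: sum.insert mul_add_right not_False_eq_True)
qed (simp_all only: sum.infinite sum.empty mul_zero not_False_eq_True)

lemma mul_supported [simp]: "mul a b \<in> supported"
  by (auto simp: supported_def mul_def star_in_perms intro!: sum.neutral)

lemma bas_supported: "\<sigma> \<in> perms \<Longrightarrow> bas \<sigma> \<in> supported"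
  by (auto simp: bas_def supported_def)

lemma mul_bas_left_apply:
  assumes "\<pi> \<in> perms"
  shows "mul (bas \<pi>) y \<rho> = (\<Sum>\<tau>\<in>perms. if star \<pi> \<tau> = \<rho> then y \<tau> * \<delta> ^ lp \<pi> \<tau> else 0)"
proof -
  have "mul (bas \<pi>) y \<rho> = (\<Sum>\<sigma>\<in>perms. if \<sigma> = \<pi> then (\<Sum>\<tau>\<in>perms. if star \<pi> \<tau> = \<rho> then y \<tau> * \<delta> ^ lp \<pi> \<tau> else 0) else 0)"
    unfolding mul_def bas_def by (intro sum.cong refl) (auto intro!: sum.neutral sum.cong)
  then show ?thesis using assms by (simp add: finite_perms)
qed

lemma mul_bas:
  assumes "\<sigma> \<in> perms" "\<tau> \<in> perms"
  shows "mul (bas \<sigma>) (bas \<tau>) = scal (\<delta> ^ lp \<sigma> \<tau>) (bas (star \<sigma> \<tau>))"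
proof
  fix \<rho>
  have "mul (bas \<sigma>) (bas \<tau>) \<rho> = (\<Sum>\<tau>'\<in>perms. if \<tau>' = \<tau> then (if star \<sigma> \<tau> = \<rho> then \<delta> ^ lp \<sigma> \<tau> else 0) else 0)"
    unfolding mul_bas_left_apply[OF assms(1)] by (intro sum.cong refl) (auto simp: bas_def)
  then show "mul (bas \<sigma>) (bas \<tau>) \<rho> = scal (\<delta> ^ lp \<sigma> \<tau>) (bas (star \<sigma> \<tau>)) \<rho>"
    using assms by (auto simp: finite_perms scal_def bas_def)
qed

lemma mul_one:
  assumes "a \<in> supported"
  shows "mul (bas id) a = a" "mul a (bas id) = a"
proof -
  show "mul (bas id) a = a"
  proof
    fix \<rho>
    have "mul (bas id) a \<rho> = (\<Sum>\<tau>\<in>perms. if \<tau> = \<rho> then a \<tau> else 0)"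
      unfolding mul_bas_left_apply[OF id_in_perms]
    proof (intro sum.cong refl)
      fix \<tau> assume "\<tau> \<in> perms"
      then show "(if star id \<tau> = \<rho> then a \<tau> * \<delta> ^ lp id \<tau> else 0) = (if \<tau> = \<rho> then a \<tau> else 0)"
        by (simp only: star_id power_0 mult_1_right)
    qed
    then show "mul (bas id) a \<rho> = a \<rho>" using assms by (auto simp: finite_perms supported_def)
  qed
  show "mul a (bas id) = a"
  proof
    fix \<rho>
    have "mul a (bas id) \<rho> = (\<Sum>\<sigma>\<in>perms. if \<sigma> = \<rho> then a \<sigma> else 0)"
      unfolding mul_def
    proof (intro sum.cong refl)
      fix \<sigma> assume s: "\<sigma> \<in> perms"
      have *: "star \<sigma> \<tau> = \<sigma>" "lp \<sigma> \<tau> = 0" if "\<tau> = id" for \<tau> using star_id[OF s] that by simp_all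
      have "(\<Sum>\<tau>\<in>perms. if star \<sigma> \<tau> = \<rho> then a \<sigma> * bas id \<tau> * \<delta> ^ lp \<sigma> \<tau> else 0) =
          (\<Sum>\<tau>\<in>perms. if \<tau> = id then (if \<sigma> = \<rho> then a \<sigma> else 0) else 0)"
      proof (intro sum.cong refl)
        fix \<tau> assume "\<tau> \<in> perms"
        show "(if star \<sigma> \<tau> = \<rho> then a \<sigma> * bas id \<tau> * \<delta> ^ lp \<sigma> \<tau> else 0) =
            (if \<tau> = id then (if \<sigma> = \<rho> then a \<sigma> else 0) else 0)"
        proof (cases "\<tau> = id")
          case True
          then show ?thesis by (simp only: * bas_def if_True power_0 mult_1_right refl)
        qed (simp add: bas_def)
      qed
      then show "(\<Sum>\<tau>\<in>perms. if star \<sigma> \<tau> = \<rho> then a \<sigma> * bas id \<tau> * \<delta> ^ lp \<sigma> \<tau> else 0) = (if \<sigma> = \<rho> then a \<sigma> else 0)"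
        by (simp add: finite_perms id_in_perms)
    qed
    then show "mul a (bas id) \<rho> = a \<rho>" using assms by (auto simp: finite_perms supported_def)
  qed
qed

lemma sum_apply: "(\<Sum>i\<in>I. f i) \<sigma> = (\<Sum>i\<in>I. f i \<sigma>)" for f :: "'i \<Rightarrow> 'b \<Rightarrow> 'k"
  by (induction I rule: infinite_finite_induct) auto

lemma supported_expand:
  assumes "a \<in> supported"
  shows "a = (\<Sum>\<sigma>\<in>perms. scal (a \<sigma>) (bas \<sigma>))"
proof
  fix \<rho>
  have "(\<Sum>\<sigma>\<in>perms. scal (a \<sigma>) (bas \<sigma>)) \<rho> = (\<Sum>\<sigma>\<in>perms. if \<rho> = \<sigma> then a \<sigma> else 0)"
    unfolding sum_apply by (intro sum.cong refl) (simp add: scal_def bas_def)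
  also have "\<dots> = a \<rho>" using assms by (auto simp: finite_perms supported_def)
  finally show "a \<rho> = (\<Sum>\<sigma>\<in>perms. scal (a \<sigma>) (bas \<sigma>)) \<rho>" by simp
qed

text \<open>Only diagrams with the northern arc from i to j arise. Their preimages under the hook
  are \<open>transpose v j \<circ> \<rho>\<close>, indexed by the value v of the preimage at i. The
  term v = j closes a loop and yields \<delta>; the others form two Jucys-Murphy sums, according to
  the side of v.\<close>

lemma mul_hook_apply:
  assumes ij: "(i, j) \<in> hooks" and \<rho>: "\<rho> \<in> perms"
  shows "mul (bas (transpose i j)) y \<rho> =
    (if \<rho> i = j then \<delta> * y \<rho> + (\<Sum>v\<in>labels - {j}. y (transpose v j \<circ> \<rho>)) else 0)"
proof -
  note h = hooksD[OF ij]
  have "mul (bas (transpose i j)) y \<rho> =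
      (\<Sum>\<tau>\<in>perms. if transpose (\<tau> i) j \<circ> \<tau> = \<rho> then y \<tau> * \<delta> ^ (if \<tau> i = j then 1 else 0) else 0)"
    unfolding mul_bas_left_apply[OF h(6)] by (intro sum.cong refl) (simp add: star_hook_left[OF ij])
  also have "\<dots> = (\<Sum>\<tau>\<in>{\<tau> \<in> perms. transpose (\<tau> i) j \<circ> \<tau> = \<rho>}. y \<tau> * \<delta> ^ (if \<tau> i = j then 1 else 0))"
    by (simp add: sum.If_cases finite_perms Int_def)
  also have "\<dots> = (if \<rho> i = j then \<delta> * y \<rho> + (\<Sum>v\<in>labels - {j}. y (transpose v j \<circ> \<rho>)) else 0)"
  proof (cases "\<rho> i = j")
    case False
    then have e: "{\<tau> \<in> perms. transpose (\<tau> i) j \<circ> \<tau> = \<rho>} = {}" by auto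
    show ?thesis unfolding e using False by simp
  next
    case True
    have "(\<Sum>\<tau>\<in>{\<tau> \<in> perms. transpose (\<tau> i) j \<circ> \<tau> = \<rho>}. y \<tau> * \<delta> ^ (if \<tau> i = j then 1 else 0)) =
        (\<Sum>v\<in>labels. y (transpose v j \<circ> \<rho>) * \<delta> ^ (if v = j then 1 else 0))"
    proof (rule sum.reindex_bij_witness[where i = "\<lambda>v. transpose v j \<circ> \<rho>" and j = "\<lambda>\<tau>. \<tau> i"])
      fix \<tau> assume "\<tau> \<in> {\<tau> \<in> perms. transpose (\<tau> i) j \<circ> \<tau> = \<rho>}"
      then have \<tau>: "\<tau> \<in> perms" "\<rho> = transpose (\<tau> i) j \<circ> \<tau>" by auto
      then show e: "transpose (\<tau> i) j \<circ> \<rho> = \<tau>" by (simp add: comp_assoc[symmetric])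
      show "\<tau> i \<in> labels" using permsD(1)[OF \<tau>(1)] h by simp
      show "y (transpose (\<tau> i) j \<circ> \<rho>) * \<delta> ^ (if \<tau> i = j then 1 else 0) = y \<tau> * \<delta> ^ (if \<tau> i = j then 1 else 0)"
        by (simp add: e)
    next
      fix v assume v: "v \<in> labels"
      show "(transpose v j \<circ> \<rho>) i = v" using True by simp
      then show "transpose v j \<circ> \<rho> \<in> {\<tau> \<in> perms. transpose (\<tau> i) j \<circ> \<tau> = \<rho>}"
        using comp_in_perms[OF transpose_in_perms[OF v h(2)] \<rho>] True by (simp add: comp_assoc[symmetric])
    qed
    also have "\<dots> = y (transpose j j \<circ> \<rho>) * \<delta> + (\<Sum>v\<in>labels - {j}. y (transpose v j \<circ> \<rho>) * \<delta> ^ (if v = j then 1 else 0))"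
      using h by (subst sum.remove[of _ j]) auto
    also have "(\<Sum>v\<in>labels - {j}. y (transpose v j \<circ> \<rho>) * \<delta> ^ (if v = j then 1 else 0)) = (\<Sum>v\<in>labels - {j}. y (transpose v j \<circ> \<rho>))"
      by (intro sum.cong refl) simp
    also have "y (transpose j j \<circ> \<rho>) * \<delta> = \<delta> * y \<rho>" by (simp add: mult.commute)
    finally show ?thesis unfolding if_P[OF True] .
  qed
  finally show ?thesis .
qed

lemma mul_wall_apply:
  assumes \<pi>: "\<pi> \<in> wall_perms" and \<rho>: "\<rho> \<in> perms"
  shows "mul (bas \<pi>) y (rgt \<pi> \<circ> \<rho> \<circ> lft \<pi>) = y \<rho>"
proof -
  note w = lft_rgt_wall[OF \<pi>, THEN wall_permsD(1)]
  have "star \<pi> \<tau> = rgt \<pi> \<circ> \<rho> \<circ> lft \<pi> \<longleftrightarrow> \<tau> = \<rho>" if \<tau>: "\<tau> \<in> perms" for \<tau>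
  proof -
    have "\<tau> k = \<rho> k" if eq: "rgt \<pi> \<circ> \<tau> \<circ> lft \<pi> = rgt \<pi> \<circ> \<rho> \<circ> lft \<pi>" for k
      using fun_cong[OF eq, of "pinv (lft \<pi>) k"] permsD(3)[OF w(2)] by (simp add: pinv_perms[OF w(1)])
    then show ?thesis unfolding star_wall_left(1)[OF \<pi> \<tau>] by blast
  qed
  then have "mul (bas \<pi>) y (rgt \<pi> \<circ> \<rho> \<circ> lft \<pi>) = (\<Sum>\<tau>\<in>perms. if \<tau> = \<rho> then y \<tau> else 0)"
    unfolding mul_bas_left_apply[OF wall_permsD(1)[OF \<pi>]]
    by (intro sum.cong refl) (simp only: star_wall_left(2)[OF \<pi>] power_0 mult_1_right)
  then show ?thesis using \<rho> by (simp add: finite_perms)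
qed

section \<open>The filtration by arcs and the flip\<close>

definition layer_ideal :: "nat \<Rightarrow> ((nat \<Rightarrow> nat) \<Rightarrow> 'k) set" where
  "layer_ideal m = {a \<in> supported. \<forall>\<sigma>. arcs \<sigma> < m \<longrightarrow> a \<sigma> = 0}"

text \<open>Arcs persist in products, so the diagrams with at least m arcs span a two-sided
  ideal.\<close>

lemma layer_ideal_mul:
  assumes "a \<in> layer_ideal m"
  shows "mul a b \<in> layer_ideal m" "mul b a \<in> layer_ideal m"
proof -
  have "mul a b \<rho> = 0" "mul b a \<rho> = 0" if "arcs \<rho> < m" for \<rho>
  proof -
    have "a \<sigma> = 0" if "\<sigma> \<in> perms" "\<tau> \<in> perms" "star \<sigma> \<tau> = \<rho> \<or> star \<tau> \<sigma> = \<rho>" for \<sigma> \<tau>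
      using that arcs_star[of \<sigma> \<tau>] arcs_star[of \<tau> \<sigma>] \<open>arcs \<rho> < m\<close> assms by (auto simp: layer_ideal_def)
    then show "mul a b \<rho> = 0" "mul b a \<rho> = 0" unfolding mul_def by (auto intro!: sum.neutral)
  qed
  then show "mul a b \<in> layer_ideal m" "mul b a \<in> layer_ideal m" by (auto simp: layer_ideal_def)
qed

lemma layer_ideal_closed:
  "a \<in> layer_ideal m \<Longrightarrow> b \<in> layer_ideal m \<Longrightarrow> a + b \<in> layer_ideal m"
  "a \<in> layer_ideal m \<Longrightarrow> b \<in> layer_ideal m \<Longrightarrow> a - b \<in> layer_ideal m"
  "a \<in> layer_ideal m \<Longrightarrow> scal c a \<in> layer_ideal m" "0 \<in> layer_ideal m"
  by (simp_all add: layer_ideal_def supported_def scal_def)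

text \<open>The anti-automorphism that turns diagrams upside down; it converts statements on left
  multiplication into statements on right multiplication.\<close>

definition flip :: "((nat \<Rightarrow> nat) \<Rightarrow> 'k) \<Rightarrow> (nat \<Rightarrow> nat) \<Rightarrow> 'k" where
  "flip a \<sigma> = (if \<sigma> \<in> perms then a (pinv \<sigma>) else 0)"

lemma flip_mul: "flip (mul a b) = mul (flip b) (flip a)"
proof
  fix \<rho>
  show "flip (mul a b) \<rho> = mul (flip b) (flip a) \<rho>"
  proof (cases "\<rho> \<in> perms")
    case False
    then show ?thesis using mul_supported[of "flip b" "flip a"] by (simp add: flip_def supported_def)
  next
    case True
    have bij: "bij_betw pinv perms perms"
      by (rule bij_betwI[where g = pinv]) (auto simp: inv_in_perms pinv_pinv)
    have "flip (mul a b) \<rho> = (\<Sum>\<sigma>\<in>perms. \<Sum>\<tau>\<in>perms. if star \<sigma> \<tau> = pinv \<rho> then a \<sigma> * b \<tau> * \<delta> ^ lp \<sigma> \<tau> else 0)"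
      using True by (simp add: flip_def mul_def)
    also have "\<dots> = (\<Sum>\<sigma>\<in>perms. \<Sum>\<tau>\<in>perms. if star (pinv \<sigma>) (pinv \<tau>) = pinv \<rho> then a (pinv \<sigma>) * b (pinv \<tau>) * \<delta> ^ lp (pinv \<sigma>) (pinv \<tau>) else 0)"
      unfolding sum.reindex_bij_betw[OF bij, of "\<lambda>\<tau>. if star _ \<tau> = pinv \<rho> then _ * b \<tau> * \<delta> ^ lp _ \<tau> else 0"]
      by (rule sum.reindex_bij_betw[OF bij, symmetric])
    also have "\<dots> = (\<Sum>\<sigma>\<in>perms. \<Sum>\<tau>\<in>perms. if star \<tau> \<sigma> = \<rho> then flip b \<tau> * flip a \<sigma> * \<delta> ^ lp \<tau> \<sigma> else 0)"
    proof (intro sum.cong refl)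
      fix \<sigma> \<tau> assume p: "\<sigma> \<in> perms" "\<tau> \<in> perms"
      have "star (pinv \<sigma>) (pinv \<tau>) = pinv \<rho> \<longleftrightarrow> star \<tau> \<sigma> = \<rho>"
        unfolding star_inv[OF p(2,1)] using pinv_pinv[OF star_in_perms[OF p(2,1)]] pinv_pinv[OF True] by metis
      then show "(if star (pinv \<sigma>) (pinv \<tau>) = pinv \<rho> then a (pinv \<sigma>) * b (pinv \<tau>) * \<delta> ^ lp (pinv \<sigma>) (pinv \<tau>) else 0) =
          (if star \<tau> \<sigma> = \<rho> then flip b \<tau> * flip a \<sigma> * \<delta> ^ lp \<tau> \<sigma> else 0)"
        using p by (simp add: lp_inv flip_def)
    qed
    also have "\<dots> = mul (flip b) (flip a) \<rho>"
      unfolding mul_def by (rule sum.swap)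
    finally show ?thesis .
  qed
qed

lemma flip_flip: "a \<in> supported \<Longrightarrow> flip (flip a) = a"
  by (auto simp: fun_eq_iff flip_def supported_def inv_in_perms pinv_pinv)

lemma flip_bas: "\<sigma> \<in> perms \<Longrightarrow> flip (bas \<sigma>) = bas (pinv \<sigma>)"
proof
  fix \<rho> assume s: "\<sigma> \<in> perms"
  show "flip (bas \<sigma>) \<rho> = bas (pinv \<sigma>) \<rho>"
  proof (cases "\<rho> \<in> perms")
    case True
    have "pinv \<rho> = \<sigma> \<longleftrightarrow> \<rho> = pinv \<sigma>" using pinv_pinv[OF s] pinv_pinv[OF True] by metis
    with True show ?thesis by (simp only: flip_def bas_def if_True)
  next
    case False
    then have "\<rho> \<noteq> pinv \<sigma>" using inv_in_perms[OF s] by metis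
    with False show ?thesis by (simp only: flip_def bas_def if_False)
  qed
qed

lemma flip_layer_ideal: "a \<in> layer_ideal m \<Longrightarrow> flip a \<in> layer_ideal m"
  by (auto simp: layer_ideal_def supported_def flip_def arcs_pinv)

end

text \<open>Somewhere along the fold the value becomes z, and the operator applied at that moment
  sends a vector other than z to z. This extracts an eigenvector from an annihilating
  polynomial.\<close>

lemma foldr_kernel:
  assumes "foldr F cs u = z" "u \<noteq> z"
  shows "\<exists>c\<in>set cs. \<exists>v. v \<noteq> z \<and> F c v = z"
  using assms
proof (induction cs)
  case (Cons c cs)
  show ?case
  proof (cases "foldr F cs u = z")
    case True
    with Cons show ?thesis by auto
  next
    case False
    then show ?thesis using Cons.prems by auto
  qed
qed simp

context walled_algebra
begin

lemma left_label_count: "card {v \<in> labels. v \<le> r} = r"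
proof -
  have "{v \<in> labels. v \<le> r} = {1..r}" by (auto simp: labels_def)
  then show ?thesis by simp
qed

lemma right_label_count: "card {v \<in> labels. v > r} = s"
proof -
  have "{v \<in> labels. v > r} = {r + 1..r + s}" by (auto simp: labels_def)
  then show ?thesis by simp
qed

text \<open>Each of the r left southern nodes ends either an arc or a line.\<close>

lemma arcs_sinks:
  assumes "\<sigma> \<in> perms"
  shows "arcs \<sigma> + card {v \<in> labels. v \<le> r \<and> pinv \<sigma> v \<le> r} = r"
proof -
  have "arcs \<sigma> + card {v \<in> labels. v \<le> r \<and> pinv \<sigma> v \<le> r} = card {v \<in> labels. v \<le> r}"
    unfolding arcs_pinv[OF assms, symmetric] unfolding arcs_def
    by (subst card_Un_disjoint[symmetric]) (auto intro: arg_cong[where f = card])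
  then show ?thesis by (simp add: left_label_count)
qed

lemma transpose_right_wall:
  assumes "v \<in> labels" "w \<in> labels" "v > r" "w > r"
  shows "transpose v w \<in> wall_perms"
  using transpose_in_perms[OF assms(1,2)] assms(3,4) by (simp add: wall_perms_def transpose_def)

lemma transpose_left_wall:
  assumes "v \<in> labels" "w \<in> labels" "v \<le> r" "w \<le> r"
  shows "transpose v w \<in> wall_perms"
  using transpose_in_perms[OF assms(1,2)] assms(3,4) by (simp add: wall_perms_def transpose_def)

text \<open>A vector killed by all hooks outside the fixed arcs \<open>a\<close> on \<open>K\<close> yields, after restriction to the
  diagrams with an arc ending in \<open>s0\<close> and a given set \<open>A\<close> of left southern ends of lines, the relation
  \<open>\<delta> + X + Y = 0\<close> for two Jucys-Murphy operators \<open>X\<close> and \<open>Y\<close>.\<close>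

lemma nondegenerate:
  assumes K: "K \<subseteq> {i \<in> labels. i \<le> r}" "card K < l"
    and a: "a ` K \<subseteq> {j \<in> labels. j > r}" "inj_on a K"
    and supp: "\<And>\<sigma>. y \<sigma> \<noteq> 0 \<Longrightarrow> \<sigma> \<in> perms \<and> l \<le> arcs \<sigma> \<and> (\<forall>i\<in>K. \<sigma> i = a i)"
    and \<sigma>0: "y \<sigma>0 \<noteq> 0" "arcs \<sigma>0 = l"
    and good: "\<And>c c'. c \<in> jm_values (s - card K) \<Longrightarrow> c' \<in> jm_values (r - l + 1) \<Longrightarrow>
        \<delta> + of_int c + of_int c' \<noteq> 0"
  shows "\<exists>i j \<sigma>. (i, j) \<in> hooks \<and> i \<notin> K \<and> j \<notin> a ` K \<and> arcs \<sigma> = l \<and> mul (bas (transpose i j)) y \<sigma> \<noteq> 0"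
proof (rule ccontr)
  assume contra: "\<not> ?thesis"
  have fK: "finite K" by (rule finite_subset[OF K(1)]) simp
  have p0: "\<sigma>0 \<in> perms" and \<sigma>0K: "\<And>i. i \<in> K \<Longrightarrow> \<sigma>0 i = a i" using supp[OF \<sigma>0(1)] by auto
  have "\<not> {i \<in> labels. i \<le> r \<and> \<sigma>0 i > r} \<subseteq> K"
    using card_mono[OF fK, of "{i \<in> labels. i \<le> r \<and> \<sigma>0 i > r}"] K(2) \<sigma>0(2) by (auto simp: arcs_def)
  \<comment> \<open>There are l northern arcs, more than the fixed ones on K.\<close>
  then obtain i0 where i0: "i0 \<in> labels" "i0 \<le> r" "\<sigma>0 i0 > r" "i0 \<notin> K" by auto
  define s0 where "s0 = \<sigma>0 i0"
  have s0: "s0 \<in> labels" "s0 > r" using permsD(1)[OF p0 i0(1)] i0 by (auto simp: s0_def)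
  have s0K: "s0 \<notin> a ` K" using permsD(3)[OF p0] \<sigma>0K i0(4) by (auto simp: s0_def) metis
  \<comment> \<open>R with \<open>s0\<close> carries a symmetric group on s - card K points, and A
    with \<open>s0\<close> one on r - l + 1 points; hence the arguments of \<open>jm_values\<close>
    in the hypothesis.\<close>
  define R where "R = {j \<in> labels. j > r} - a ` K - {s0}"
  define A where "A = {v \<in> labels. v \<le> r \<and> pinv \<sigma>0 v \<le> r}"
  have cardR: "Suc (card R) = s - card K"
  proof -
    have "card ({j \<in> labels. j > r} - a ` K) = s - card K"
      using card_Diff_subset[of "a ` K" "{j \<in> labels. j > r}"] a fK by (simp add: right_label_count card_image)
    moreover have "s0 \<in> {j \<in> labels. j > r} - a ` K" using s0 s0K by auto
    moreover have "finite ({j \<in> labels. j > r} - a ` K)" by simp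
    ultimately show ?thesis unfolding R_def using card.remove by metis
  qed
  have cardA: "Suc (card A) = r - l + 1" using arcs_sinks[OF p0] \<sigma>0(2) by (simp add: A_def)
  have RA: "finite R" "finite A" "s0 \<notin> R" "s0 \<notin> A" "R \<inter> A = {}" "R \<subseteq> labels" "A \<subseteq> labels"
    using s0 by (auto simp: R_def A_def)
  \<comment> \<open>The vectors with the given support that all hooks outside the fixed arcs kill at
    diagrams with l arcs, with \<open>mul_hook_apply\<close> written out. Unlike the line of y, this
    space is visibly stable under the operator of R.\<close>
  define M where "M = {y. (\<forall>\<sigma>. y \<sigma> \<noteq> 0 \<longrightarrow> \<sigma> \<in> perms \<and> l \<le> arcs \<sigma> \<and> (\<forall>i\<in>K. \<sigma> i = a i)) \<and>
      (\<forall>\<sigma>\<in>perms. \<forall>i\<in>labels. arcs \<sigma> = l \<longrightarrow> i \<le> r \<longrightarrow> i \<notin> K \<longrightarrow> \<sigma> i > r \<longrightarrow> \<sigma> i \<notin> a ` K \<longrightarrow>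
        \<delta> * y \<sigma> + (\<Sum>v\<in>labels - {\<sigma> i}. y (transpose v (\<sigma> i) \<circ> \<sigma>)) = 0)}"
  have yM: "y \<in> M"
  proof -
    have "\<delta> * y \<sigma> + (\<Sum>v\<in>labels - {\<sigma> i}. y (transpose v (\<sigma> i) \<circ> \<sigma>)) = 0"
      if "\<sigma> \<in> perms" "i \<in> labels" "arcs \<sigma> = l" "i \<le> r" "i \<notin> K" "\<sigma> i > r" "\<sigma> i \<notin> a ` K" for \<sigma> i
    proof -
      have h: "(i, \<sigma> i) \<in> hooks" using that permsD(1) by (auto simp: hooks_def)
      then have "mul (bas (transpose i (\<sigma> i))) y \<sigma> = 0" using contra that by blast
      then show ?thesis using mul_hook_apply[OF h that(1)] by simp
    qed
    then show ?thesis using supp by (simp add: M_def)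
  qed
  \<comment> \<open>The transposition renames the two right labels v and \<open>s0\<close>, neither
    of which ends a fixed arc, so it merely permutes the defining relations.\<close>
  have M_transp: "(\<lambda>\<sigma>. y (transpose v s0 \<circ> \<sigma>)) \<in> M" if y: "y \<in> M" and v: "v \<in> R" for y v
  proof -
    let ?t = "transpose v s0"
    have vl: "v \<in> labels" "v > r" "v \<notin> a ` K" using v by (auto simp: R_def)
    have tw: "?t \<in> wall_perms" by (rule transpose_right_wall) (use vl s0 in auto)
    have tt: "?t \<circ> (?t \<circ> \<sigma>) = \<sigma>" for \<sigma> by (simp add: comp_assoc[symmetric])
    have tp: "?t \<circ> \<sigma> \<in> perms \<longleftrightarrow> \<sigma> \<in> perms" for \<sigma>
      using comp_in_perms[OF wall_permsD(1)[OF tw]] tt by metis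
    have tarcs: "arcs (?t \<circ> \<sigma>) = arcs \<sigma>" if "\<sigma> \<in> perms" for \<sigma>
      using arcs_wall[OF tw id_wall_perms that] by simp
    have ta: "?t k = a i \<longleftrightarrow> k = a i" if "i \<in> K" for i k
      using that vl s0K by (auto simp: transpose_def)
    have "\<sigma> \<in> perms \<and> l \<le> arcs \<sigma> \<and> (\<forall>i\<in>K. \<sigma> i = a i)" if "y (?t \<circ> \<sigma>) \<noteq> 0" for \<sigma>
      using y that tp[of \<sigma>] tarcs[of \<sigma>] ta unfolding M_def by fastforce
    moreover have "\<delta> * y (?t \<circ> \<sigma>) + (\<Sum>w\<in>labels - {\<sigma> i}. y (?t \<circ> (transpose w (\<sigma> i) \<circ> \<sigma>))) = 0"
      if \<sigma>: "\<sigma> \<in> perms" "i \<in> labels" "arcs \<sigma> = l" "i \<le> r" "i \<notin> K" "\<sigma> i > r" "\<sigma> i \<notin> a ` K" for \<sigma> i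
    proof -
      have "(?t \<circ> \<sigma>) i > r" using wall_permsD(2)[OF tw, of "\<sigma> i"] \<sigma>(6) by (simp add: not_le[symmetric])
      moreover have "(?t \<circ> \<sigma>) i \<notin> a ` K" using ta \<sigma>(7) by auto
      ultimately have e: "\<delta> * y (?t \<circ> \<sigma>) + (\<Sum>w\<in>labels - {(?t \<circ> \<sigma>) i}. y (transpose w ((?t \<circ> \<sigma>) i) \<circ> (?t \<circ> \<sigma>))) = 0"
        using y \<sigma> tp[of \<sigma>] tarcs[of \<sigma>] unfolding M_def by blast
      have tl: "?t w \<in> labels \<longleftrightarrow> w \<in> labels" for w using vl s0 by (auto simp: transpose_def)
      have "(\<Sum>w\<in>labels - {\<sigma> i}. y (?t \<circ> (transpose w (\<sigma> i) \<circ> \<sigma>))) =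
          (\<Sum>w\<in>labels - {(?t \<circ> \<sigma>) i}. y (transpose w ((?t \<circ> \<sigma>) i) \<circ> (?t \<circ> \<sigma>)))"
      proof (rule sum.reindex_bij_witness[where i = ?t and j = ?t])
        fix w
        have ti: "?t u = ?t u' \<longleftrightarrow> u = u'" for u u' by (metis transpose_involutory)
        show "?t (?t w) = w" by simp
        show "?t (?t w) = w" by simp
        show "?t w \<in> labels - {(?t \<circ> \<sigma>) i}" if "w \<in> labels - {\<sigma> i}"
          using that tl ti[of w "\<sigma> i"] by (simp only: Diff_iff comp_apply singleton_iff not_False_eq_True)
        show "?t w \<in> labels - {\<sigma> i}" if "w \<in> labels - {(?t \<circ> \<sigma>) i}"
          using that tl ti[of "?t w" "\<sigma> i"]
          by (simp only: Diff_iff comp_apply singleton_iff not_False_eq_True transpose_involutory)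
        have "transpose (?t w) (?t (\<sigma> i)) (?t k) = ?t (transpose w (\<sigma> i) k)" for k
          using ti[of k w] ti[of k "\<sigma> i"]
          by (cases "k = w"; cases "k = \<sigma> i") (simp_all only: transpose_apply_first transpose_apply_second transpose_apply_other not_False_eq_True)
        then have "transpose (?t w) ((?t \<circ> \<sigma>) i) \<circ> (?t \<circ> \<sigma>) = ?t \<circ> (transpose w (\<sigma> i) \<circ> \<sigma>)"
          unfolding fun_eq_iff comp_apply by blast
        then show "y (transpose (?t w) ((?t \<circ> \<sigma>) i) \<circ> (?t \<circ> \<sigma>)) = y (?t \<circ> (transpose w (\<sigma> i) \<circ> \<sigma>))" by (rule arg_cong)
      qed
      then show ?thesis using e by simp
    qed
    ultimately show ?thesis by (simp add: M_def)
  qed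
  have M_lin: "(\<lambda>\<sigma>. k * y \<sigma> + k' * y' \<sigma>) \<in> M" if "y \<in> M" "y' \<in> M" for y y' k k'
  proof -
    have "\<sigma> \<in> perms \<and> l \<le> arcs \<sigma> \<and> (\<forall>i\<in>K. \<sigma> i = a i)" if "k * y \<sigma> + k' * y' \<sigma> \<noteq> 0" for \<sigma>
    proof -
      have "y \<sigma> \<noteq> 0 \<or> y' \<sigma> \<noteq> 0" using that by auto
      then show ?thesis using \<open>y \<in> M\<close> \<open>y' \<in> M\<close> unfolding M_def by blast
    qed
    moreover have "\<delta> * (k * y \<sigma> + k' * y' \<sigma>) + (\<Sum>v\<in>I. k * y (f v) + k' * y' (f v)) =
        k * (\<delta> * y \<sigma> + (\<Sum>v\<in>I. y (f v))) + k' * (\<delta> * y' \<sigma> + (\<Sum>v\<in>I. y' (f v)))" for \<sigma> I and f :: "nat \<Rightarrow> nat \<Rightarrow> nat"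
      by (simp add: sum.distrib sum_distrib_left algebra_simps)
    ultimately show ?thesis using that by (simp add: M_def)
  qed
  have M_zero: "(\<lambda>_. 0) \<in> M" by (simp add: M_def)
  have M_shift: "jm_shift R s0 c y \<in> M" if y: "y \<in> M" for c y
  proof -
    have "(\<lambda>\<sigma>. \<Sum>v\<in>S. y (transpose v s0 \<circ> \<sigma>)) \<in> M" if "finite S" "S \<subseteq> R" for S
      using that
    proof (induction S rule: finite_induct)
      case (insert v S)
      then have e: "(\<lambda>\<sigma>. \<Sum>v\<in>insert v S. y (transpose v s0 \<circ> \<sigma>)) =
          (\<lambda>\<sigma>. 1 * y (transpose v s0 \<circ> \<sigma>) + 1 * (\<Sum>v\<in>S. y (transpose v s0 \<circ> \<sigma>)))"
        by (simp only: sum.insert mult_1_left not_False_eq_True)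
      have IH: "(\<lambda>\<sigma>. \<Sum>v\<in>S. y (transpose v s0 \<circ> \<sigma>)) \<in> M" by (rule insert.IH) (use insert.prems in blast)
      have "v \<in> R" using insert.prems by blast
      show ?case unfolding e by (rule M_lin[OF M_transp[OF y \<open>v \<in> R\<close>] IH])
    qed (use M_zero in simp)
    from this[OF RA(1) subset_refl] show ?thesis
      using M_lin[of "jm_op R s0 y" y 1 "- of_int c"] y by (simp add: jm_shift_def[abs_def] jm_op_def[abs_def])
  qed
  \<comment> \<open>Only here does the relation reduce to R and A. The set is closed under the
    transpositions of A with \<open>s0\<close> but in general not under those of R, so vectors are
    restricted to it only after the operator of R has acted inside M.\<close>
  define \<Omega> where "\<Omega> = {\<sigma> \<in> perms. (\<forall>i\<in>K. \<sigma> i = a i) \<and> pinv \<sigma> s0 \<le> r \<and> {v \<in> labels. v \<le> r \<and> pinv \<sigma> v \<le> r} = A}"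
  have \<Omega>_arcs: "arcs \<sigma> = l" if "\<sigma> \<in> \<Omega>" for \<sigma>
    using arcs_sinks[of \<sigma>] that cardA arcs_sinks[OF p0] \<sigma>0(2) by (auto simp: \<Omega>_def A_def)
  have \<sigma>0\<Omega>: "\<sigma>0 \<in> \<Omega>" using p0 \<sigma>0K i0 by (simp add: \<Omega>_def A_def s0_def pinv_perms)
  have pinv_transp: "pinv (transpose v s0 \<circ> \<sigma>) k = pinv \<sigma> (transpose v s0 k)" if "\<sigma> \<in> perms" "v \<in> labels" for \<sigma> v k
    using pinv_unique[of "transpose v s0 \<circ> \<sigma>" "pinv \<sigma> \<circ> transpose v s0"] that by (simp add: fun_eq_iff pinv_perms)
  have \<Omega>_transp: "transpose v s0 \<circ> \<sigma> \<in> \<Omega>" if "\<sigma> \<in> \<Omega>" "v \<in> A" for \<sigma> v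
  proof -
    have \<sigma>: "\<sigma> \<in> perms" "\<And>i. i \<in> K \<Longrightarrow> \<sigma> i = a i" "pinv \<sigma> s0 \<le> r" "{v \<in> labels. v \<le> r \<and> pinv \<sigma> v \<le> r} = A"
      using that(1) by (auto simp: \<Omega>_def)
    have v: "v \<in> labels" "v \<le> r" "pinv \<sigma> v \<le> r" using that(2) \<sigma>(4) by auto
    have "transpose v s0 \<circ> \<sigma> \<in> perms" using comp_in_perms transpose_in_perms v s0 \<sigma>(1) by simp
    moreover have "(transpose v s0 \<circ> \<sigma>) i = a i" if "i \<in> K" for i
      using \<sigma>(2)[OF that] a(1) that v s0K by (auto simp: transpose_def)
    moreover have "pinv \<sigma> (transpose v s0 u) \<le> r \<longleftrightarrow> pinv \<sigma> u \<le> r" if "u \<le> r" for u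
      using v \<sigma>(3) s0 that by (auto simp: transpose_def)
    ultimately show ?thesis
      using \<sigma>(4) v by (auto simp: \<Omega>_def pinv_transp \<sigma>(1))
  qed
  define w where "w y = (\<lambda>\<sigma>. if \<sigma> \<in> \<Omega> then y \<sigma> else 0)" for y :: "(nat \<Rightarrow> nat) \<Rightarrow> 'k"
  have rel: "\<delta> * y \<sigma> + jm_op R s0 y \<sigma> + jm_op A s0 y \<sigma> = 0" if y: "y \<in> M" and \<sigma>\<Omega>: "\<sigma> \<in> \<Omega>" for y \<sigma>
  proof -
    have \<sigma>: "\<sigma> \<in> perms" "\<And>i. i \<in> K \<Longrightarrow> \<sigma> i = a i" "pinv \<sigma> s0 \<le> r" "{v \<in> labels. v \<le> r \<and> pinv \<sigma> v \<le> r} = A"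
      using \<sigma>\<Omega> by (auto simp: \<Omega>_def)
    define i where "i = pinv \<sigma> s0"
    have i: "i \<in> labels" "\<sigma> i = s0" "i \<le> r" using permsD(1)[OF inv_in_perms[OF \<sigma>(1)] s0(1)] \<sigma>(3)
      by (auto simp: i_def pinv_perms \<sigma>(1))
    have iK: "i \<notin> K" using \<sigma>(2) i(2) s0K by auto
    have "\<delta> * y \<sigma> + (\<Sum>v\<in>labels - {s0}. y (transpose v s0 \<circ> \<sigma>)) = 0"
      using y \<sigma>(1) i iK s0 s0K \<Omega>_arcs[OF \<sigma>\<Omega>] unfolding M_def by force
    \<comment> \<open>The remaining v contribute nothing: those on the right break a fixed arc,
      those on the left merge the arc at \<open>s0\<close> with a southern arc and push the number
      of arcs below l.\<close>
    moreover have "(\<Sum>v\<in>labels - {s0}. y (transpose v s0 \<circ> \<sigma>)) = (\<Sum>v\<in>R \<union> A. y (transpose v s0 \<circ> \<sigma>))"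
    proof (rule sum.mono_neutral_right)
      show "R \<union> A \<subseteq> labels - {s0}" using RA by auto
      show "\<forall>v\<in>labels - {s0} - (R \<union> A). y (transpose v s0 \<circ> \<sigma>) = 0"
      proof
        fix v assume v: "v \<in> labels - {s0} - (R \<union> A)"
        show "y (transpose v s0 \<circ> \<sigma>) = 0"
        proof (cases "v > r")
          case True
          then obtain i' where i': "i' \<in> K" "v = a i'" using v by (auto simp: R_def)
          then have "(transpose v s0 \<circ> \<sigma>) i' = s0" using \<sigma>(2) by simp
          then have "(transpose v s0 \<circ> \<sigma>) i' \<noteq> a i'" using i' s0K by auto
          then show ?thesis using y i' unfolding M_def by blast
        next
          case False
          then have v': "v \<le> r" "\<not> pinv \<sigma> v \<le> r" using v \<sigma>(4) by auto
          let ?\<sigma>' = "transpose v s0 \<circ> \<sigma>"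
          have "{k \<in> labels. k \<le> r \<and> ?\<sigma>' k > r} \<subseteq> {k \<in> labels. k \<le> r \<and> \<sigma> k > r} - {i}"
          proof
            fix k assume k: "k \<in> {k \<in> labels. k \<le> r \<and> ?\<sigma>' k > r}"
            have "k \<noteq> i" using k i v' by auto
            moreover have "\<sigma> k \<noteq> v" using k v' by (auto simp: pinv_perms \<sigma>(1))
            moreover have "\<sigma> k \<noteq> s0" using \<open>k \<noteq> i\<close> i(2) permsD(3)[OF \<sigma>(1)] by metis
            ultimately show "k \<in> {k \<in> labels. k \<le> r \<and> \<sigma> k > r} - {i}" using k by (simp add: transpose_def)
          qed
          then have "arcs ?\<sigma>' \<le> card ({k \<in> labels. k \<le> r \<and> \<sigma> k > r} - {i})"
            unfolding arcs_def by (intro card_mono) auto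
          also have "\<dots> < arcs \<sigma>" unfolding arcs_def
            by (rule psubset_card_mono) (use i s0 in auto)
          finally have "\<not> l \<le> arcs ?\<sigma>'" using \<Omega>_arcs[OF \<sigma>\<Omega>] by simp
          then show ?thesis using y unfolding M_def by blast
        qed
      qed
    qed simp
    moreover have "(\<Sum>v\<in>R \<union> A. y (transpose v s0 \<circ> \<sigma>)) = jm_op R s0 y \<sigma> + jm_op A s0 y \<sigma>"
      unfolding jm_op_def by (rule sum.union_disjoint) (use RA in auto)
    ultimately show ?thesis by (simp add: add.assoc)
  qed
  have w_op: "jm_op A s0 (w y) \<sigma> = (if \<sigma> \<in> \<Omega> then jm_op A s0 y \<sigma> else 0)" for y \<sigma>
  proof -
    have "transpose v s0 \<circ> \<sigma> \<in> \<Omega> \<longleftrightarrow> \<sigma> \<in> \<Omega>" if "v \<in> A" for v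
      using \<Omega>_transp[OF _ that, of \<sigma>] \<Omega>_transp[OF _ that, of "transpose v s0 \<circ> \<sigma>"] by (auto simp: comp_assoc[symmetric])
    then show ?thesis by (simp add: jm_op_def w_def)
  qed
  \<comment> \<open>By the relation, the shift of R by c turns after restriction to
    \<open>\<Omega>\<close> into this operator, which involves A only.\<close>
  define \<Psi> where "\<Psi> c u = (\<lambda>\<sigma>. - jm_op A s0 u \<sigma> - (\<delta> + of_int c) * u \<sigma>)" for c :: int and u :: "(nat \<Rightarrow> nat) \<Rightarrow> 'k"
  have w_shift: "w (jm_shift R s0 c y) = \<Psi> c (w y)" if y: "y \<in> M" for c y
  proof
    fix \<sigma>
    show "w (jm_shift R s0 c y) \<sigma> = \<Psi> c (w y) \<sigma>"
    proof (cases "\<sigma> \<in> \<Omega>")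
      case True
      have e: "jm_op R s0 y \<sigma> = - (\<delta> * y \<sigma>) - jm_op A s0 y \<sigma>" using rel[OF y True] by (simp add: eq_neg_iff_add_eq_0 algebra_simps)
      show ?thesis unfolding \<Psi>_def w_op using True by (simp add: w_def jm_shift_def e left_diff_distrib distrib_right)
    next
      case False
      then show ?thesis by (simp add: w_op \<Psi>_def) (simp add: w_def)
    qed
  qed
  obtain cs where cs: "set cs \<subseteq> jm_values (Suc (card R))" "\<And>y. foldr (jm_shift R s0) cs y = (\<lambda>_. 0 :: 'k)"
    using jm_op_annihilated[OF RA(1,3)] by blast
  have "foldr (jm_shift R s0) ds y \<in> M \<and> w (foldr (jm_shift R s0) ds y) = foldr \<Psi> ds (w y)" for ds
    by (induction ds) (use yM M_shift w_shift in auto)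
  \<comment> \<open>The annihilating polynomial for R thus kills the nonzero restriction of y, so
    one of its factors has a kernel, consisting of eigenvectors of the operator of A.\<close>
  from this[of cs] have "foldr \<Psi> cs (w y) = (\<lambda>_. 0)" by (auto simp: cs(2) w_def)
  moreover have "w y \<noteq> (\<lambda>_. 0)" using \<sigma>0\<Omega> \<sigma>0(1) by (auto simp: w_def fun_eq_iff)
  ultimately obtain c u where cu: "c \<in> set cs" "u \<noteq> (\<lambda>_. 0)" "\<Psi> c u = (\<lambda>_. 0)"
    using foldr_kernel[of \<Psi> cs "w y" "\<lambda>_. 0"] by blast
  have "jm_op A s0 u \<sigma> = - (\<delta> + of_int c) * u \<sigma>" for \<sigma>
  proof -
    have "- jm_op A s0 u \<sigma> = (\<delta> + of_int c) * u \<sigma>" using fun_cong[OF cu(3), of \<sigma>] by (simp add: \<Psi>_def)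
    then have "- (- jm_op A s0 u \<sigma>) = - ((\<delta> + of_int c) * u \<sigma>)" by (rule arg_cong)
    then show ?thesis by (simp only: minus_minus minus_mult_left)
  qed
  then obtain c' where c': "c' \<in> jm_values (Suc (card A))" "- (\<delta> + of_int c) = of_int c'"
    using jm_op_eigenvalue[OF RA(2,4) cu(2)] by blast
  then have "\<delta> + of_int c + of_int c' = 0" by (metis add.right_inverse)
  then show False using good[of c c'] cu(1) cs(1) c'(1) by (auto simp: cardR cardA)
qed

end

section \<open>Contraction to nested hooks\<close>

lemma vector_space_fun: "vector_space (\<lambda>(c :: 'k::field) f (x :: 'a). c * f x)"
  by unfold_locales (simp_all add: fun_eq_iff distrib_left distrib_right)

text \<open>A linear left inverse of the inclusion of L; it is the projection to be averaged in
  Maschke's argument.\<close>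

lemma subspace_projection:
  fixes L :: "('a \<Rightarrow> 'k::field) set"
  assumes "0 \<in> L" "\<And>x y. x \<in> L \<Longrightarrow> y \<in> L \<Longrightarrow> x + y \<in> L" "\<And>c x. x \<in> L \<Longrightarrow> (\<lambda>i. c * x i) \<in> L"
  shows "\<exists>P. (\<forall>x. P x \<in> L) \<and> (\<forall>x y. P (x + y) = P x + P y) \<and>
    (\<forall>c x. P (\<lambda>i. c * x i) = (\<lambda>i. c * P x i)) \<and> (\<forall>x\<in>L. P x = x)"
proof -
  define sc where "sc = (\<lambda>(c :: 'k) f (x :: 'a). c * f x)"
  interpret vs: vector_space sc unfolding sc_def by (rule vector_space_fun)
  interpret vp: vector_space_pair sc sc ..
  have "vs.subspace L" unfolding vs.subspace_def using assms by (simp add: sc_def)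
  moreover have "Vector_Spaces.linear sc sc id" unfolding Vector_Spaces.linear_iff by (simp add: vs.vector_space_axioms)
  ultimately obtain g where g: "g ` UNIV \<subseteq> L" "Vector_Spaces.linear sc sc g" "\<forall>v\<in>L. g (id v) = v"
    using vp.linear_exists_left_inverse_on[of id L] by auto
  have gl: "g (x + y) = g x + g y" "g (sc c x) = sc c (g x)" for x y c
    using g(2) unfolding Vector_Spaces.linear_iff by auto
  show ?thesis
  proof (intro exI[of _ g] conjI allI ballI)
    show "g x \<in> L" for x using g(1) by blast
    show "g x = x" if "x \<in> L" for x using g(3) that by simp
    show "g (x + y) = g x + g y" for x y by (rule gl)
    show "g (\<lambda>i. c * x i) = (\<lambda>i. c * g x i)" for c x using gl(2)[of c x] unfolding sc_def .
  qed
qed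

context walled_algebra
begin

text \<open>The diagram with k nested arcs around the wall in both rows. With this choice of labels
  it reflects the 2 k innermost labels, an explicit involution.\<close>

primrec nest :: "nat \<Rightarrow> nat \<Rightarrow> nat" where
  "nest 0 = id"
| "nest (Suc k) = transpose (r - k) (r + 1 + k) \<circ> nest k"

lemma nest_apply:
  assumes "k \<le> r"
  shows "nest k i = (if r - k < i \<and> i \<le> r + k then 2 * r + 1 - i else i)"
  using assms
proof (induction k)
  case (Suc k)
  then have "nest k i = (if r - k < i \<and> i \<le> r + k then 2 * r + 1 - i else i)" by simp
  with Suc.prems show ?case by (auto simp: transpose_def)
qed simp

lemma nest_hook: "k < r \<Longrightarrow> k < s \<Longrightarrow> (r - k, r + 1 + k) \<in> hooks"
  by (auto simp: hooks_def labels_def)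

lemma nest_in_perms: "k \<le> r \<Longrightarrow> k \<le> s \<Longrightarrow> nest k \<in> perms"
proof (induction k)
  case (Suc k)
  then have "k < r" "k < s" "nest k \<in> perms" by auto
  then show ?case unfolding nest.simps by (intro comp_in_perms hooksD(6)[OF nest_hook])
qed (simp add: id_in_perms)

lemma nest_nest:
  assumes "k \<le> r"
  shows "nest k (nest k i) = i"
  using assms by (auto simp: nest_apply)

lemma pinv_nest: "k \<le> r \<Longrightarrow> pinv (nest k) = nest k"
  by (rule pinv_unique) (auto simp: fun_eq_iff nest_nest)

lemma bas_nest_Suc:
  assumes "k < r" "k < s"
  shows "bas (nest (Suc k)) = mul (bas (transpose (r - k) (r + 1 + k))) (bas (nest k))"
proof -
  have n: "nest k (r - k) = r - k" "r - k \<noteq> r + 1 + k" using assms by (simp_all add: nest_apply)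
  have p: "nest k \<in> perms" "transpose (r - k) (r + 1 + k) \<in> perms"
    using nest_in_perms hooksD(6)[OF nest_hook[OF assms]] assms by auto
  have "star (transpose (r - k) (r + 1 + k)) (nest k) = nest (Suc k)" "lp (transpose (r - k) (r + 1 + k)) (nest k) = 0"
    using star_hook_left[OF nest_hook[OF assms] p(1)] n unfolding nest.simps by (simp_all only: if_False)
  then show ?thesis unfolding mul_bas[OF p(2,1)] by (simp only: scal_def power_0 mult_1_left)
qed

text \<open>The permutation diagrams that leave the nested labels alone, a copy of the product of
  the symmetric groups on r - k and s - k points.\<close>

definition nest_fix :: "nat \<Rightarrow> (nat \<Rightarrow> nat) set" where
  "nest_fix k = {\<kappa> \<in> wall_perms. \<forall>i. r - k < i \<longrightarrow> i \<le> r + k \<longrightarrow> \<kappa> i = i}"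

lemma star_nest:
  assumes \<kappa>: "\<kappa> \<in> nest_fix k" and k: "k \<le> r" "k \<le> s"
  shows "star \<kappa> (nest k) = \<kappa> \<circ> nest k" "star (nest k) \<kappa> = \<kappa> \<circ> nest k" "lp \<kappa> (nest k) = 0" "lp (nest k) \<kappa> = 0"
proof -
  have w: "\<kappa> \<in> wall_perms" and fx: "\<And>i. r - k < i \<Longrightarrow> i \<le> r + k \<Longrightarrow> \<kappa> i = i"
    using \<kappa> by (auto simp: nest_fix_def)
  note p = wall_permsD[OF w] and n = nest_in_perms[OF k]
  define B where "B i \<longleftrightarrow> r - k < i \<and> i \<le> r + k" for i
  have nB: "nest k i = i" if "\<not> B i" for i using that by (auto simp: nest_apply k B_def)
  have nB': "B (nest k i)" if "B i" for i
  proof -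
    have "nest k i = 2 * r + 1 - i" using that by (simp add: nest_apply[OF k(1)] B_def)
    then show ?thesis using that k unfolding B_def by linarith
  qed
  have \<kappa>B: "\<kappa> i = i" if "B i" for i using that fx by (auto simp: B_def)
  have \<kappa>B': "B (\<kappa> i) \<longleftrightarrow> B i" for i using \<kappa>B permsD(3)[OF p(1), of "\<kappa> i" i] by metis
  have lr: "lft \<kappa> i = i" "rgt \<kappa> i = i" if "B i" for i using \<kappa>B[OF that] by (auto simp: lft_def rgt_def)
  have lr': "\<not> B (lft \<kappa> i)" "\<not> B (rgt \<kappa> i)" if "\<not> B i" for i using that \<kappa>B'[of i] by (auto simp: lft_def rgt_def)
  have LR: "rgt \<kappa> (lft \<kappa> i) = \<kappa> i" "lft \<kappa> (rgt \<kappa> i) = \<kappa> i" for i using p(2)[of i] by (auto simp: lft_def rgt_def)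
  have "rgt \<kappa> (nest k (lft \<kappa> i)) = \<kappa> (nest k i)" "lft \<kappa> (nest k (rgt \<kappa> i)) = \<kappa> (nest k i)" for i
    by (cases "B i"; simp add: lr nB nB' lr' LR \<kappa>B)+
  then have "rgt \<kappa> \<circ> nest k \<circ> lft \<kappa> = \<kappa> \<circ> nest k" "lft \<kappa> \<circ> nest k \<circ> rgt \<kappa> = \<kappa> \<circ> nest k" by (auto simp: fun_eq_iff)
  then show "star \<kappa> (nest k) = \<kappa> \<circ> nest k" "star (nest k) \<kappa> = \<kappa> \<circ> nest k" "lp \<kappa> (nest k) = 0" "lp (nest k) \<kappa> = 0"
    using star_wall_left[OF w n] star_wall_right[OF w n] by auto
qed

lemma nest_fixD: "\<kappa> \<in> nest_fix k \<Longrightarrow> \<kappa> \<in> wall_perms" "\<kappa> \<in> nest_fix k \<Longrightarrow> \<kappa> \<in> perms"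
  using wall_permsD(1) by (simp_all add: nest_fix_def)

lemma mul_bas_nest_commute:
  assumes "\<kappa> \<in> nest_fix k" "k \<le> r" "k \<le> s"
  shows "mul (bas \<kappa>) (bas (nest k)) = mul (bas (nest k)) (bas \<kappa>)"
  using assms by (simp add: mul_bas star_nest nest_in_perms nest_fixD)

lemma star_wall_wall:
  assumes "\<pi> \<in> wall_perms" "\<rho> \<in> wall_perms"
  shows "star \<pi> \<rho> \<in> wall_perms" "mul (bas \<pi>) (bas \<rho>) = bas (star \<pi> \<rho>)"
proof -
  note p = wall_permsD[OF assms(1)] wall_permsD[OF assms(2)]
  show "star \<pi> \<rho> \<in> wall_perms"
    unfolding star_wall_left(1)[OF assms(1) p(3)]
    by (intro comp_wall_perms lft_rgt_wall assms)
  show "mul (bas \<pi>) (bas \<rho>) = bas (star \<pi> \<rho>)"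
    by (simp add: mul_bas p star_wall_left(2)[OF assms(1)] scal_def)
qed

lemma arcs_le:
  assumes "\<sigma> \<in> perms"
  shows "arcs \<sigma> \<le> r" "arcs \<sigma> \<le> s"
proof -
  show "arcs \<sigma> \<le> r" using arcs_sinks[OF assms] by simp
  have "arcs \<sigma> \<le> card {v \<in> labels. v > r}"
    unfolding arcs_right[OF assms, symmetric] by (rule card_mono) auto
  then show "arcs \<sigma> \<le> s" by (simp add: right_label_count)
qed

text \<open>Here l is the number of arcs of the leading diagrams and k the number of arcs already
  nested. The remaining s - k right labels supply the content c, the r - l left lines together with
  one arc end the content c'.\<close>

definition generic :: bool where
  "generic \<longleftrightarrow> (\<forall>k l. k < l \<longrightarrow> l \<le> r \<longrightarrow> l \<le> s \<longrightarrow>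
     (\<forall>c\<in>jm_values (s - k). \<forall>c'\<in>jm_values (r - l + 1). \<delta> + of_int c + of_int c' \<noteq> 0))"

lemma mul_bas_leftE:
  assumes "\<pi> \<in> perms" "mul (bas \<pi>) y \<sigma> \<noteq> 0"
  obtains \<tau> where "\<tau> \<in> perms" "star \<pi> \<tau> = \<sigma>"
proof -
  have "\<exists>\<tau>\<in>perms. star \<pi> \<tau> = \<sigma>"
  proof (rule ccontr)
    assume "\<not> ?thesis"
    then have "mul (bas \<pi>) y \<sigma> = 0"
      unfolding mul_bas_left_apply[OF assms(1)] by (intro sum.neutral) simp
    with assms(2) show False by simp
  qed
  then show ?thesis using that by blast
qed

text \<open>Nested arcs are produced one at a time. By \<open>nondegenerate\<close> some hook away
  from the k nested arcs does not kill the leading part, and a permutation \<open>\<kappa>\<close>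
  fixing these arcs moves it to the next nested position. Since \<open>\<kappa>\<close> commutes
  with \<open>bas (nest k)\<close>, it can be absorbed into \<open>\<tau>\<close>.\<close>

lemma contract_left:
  assumes gen: generic and y: "y \<in> layer_ideal l" and \<sigma>0: "y \<sigma>0 \<noteq> 0" "arcs \<sigma>0 = l" and "k \<le> l"
  shows "\<exists>\<tau>\<in>wall_perms. \<exists>\<sigma>. arcs \<sigma> = l \<and> mul (bas (nest k)) (mul (bas \<tau>) y) \<sigma> \<noteq> 0"
  using \<open>k \<le> l\<close>
proof (induction k)
  case 0
  have "y \<in> supported" using y by (simp add: layer_ideal_def)
  then have "mul (bas (nest 0)) (mul (bas id) y) = y" by (simp only: nest.simps mul_one)
  with \<sigma>0 have "arcs \<sigma>0 = l \<and> mul (bas (nest 0)) (mul (bas id) y) \<sigma>0 \<noteq> 0" by (simp only:) simp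
  with id_wall_perms show ?case by blast
next
  case (Suc k)
  have ls: "l \<le> r" "l \<le> s" using arcs_le[of \<sigma>0] \<sigma>0 y by (auto simp: layer_ideal_def supported_def)
  have k: "k < r" "k < s" "k \<le> r" "k \<le> s" using Suc.prems ls by auto
  obtain \<tau> \<sigma>1 where \<tau>: "\<tau> \<in> wall_perms" and \<sigma>1: "arcs \<sigma>1 = l" "mul (bas (nest k)) (mul (bas \<tau>) y) \<sigma>1 \<noteq> 0"
    using Suc by auto
  define y' where "y' = mul (bas (nest k)) (mul (bas \<tau>) y)"
  define K where "K = {i. r - k < i \<and> i \<le> r}"
  define a where "a i = 2 * r + 1 - i" for i
  have cardK: "card K = k"
  proof -
    have "K = {r - k + 1..r}" by (auto simp: K_def)
    then show ?thesis using k by simp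
  qed
  have aK: "a ` K = {r + 1..r + k}"
  proof (intro Set.set_eqI iffI)
    fix j assume "j \<in> {r + 1..r + k}"
    then show "j \<in> a ` K" using k by (intro image_eqI[of _ _ "2 * r + 1 - j"]) (auto simp: a_def K_def)
  qed (use k in \<open>auto simp: a_def K_def\<close>)
  have "\<exists>i j \<sigma>. (i, j) \<in> hooks \<and> i \<notin> K \<and> j \<notin> a ` K \<and> arcs \<sigma> = l \<and> mul (bas (transpose i j)) y' \<sigma> \<noteq> 0"
  proof (rule nondegenerate)
    show "K \<subseteq> {i \<in> labels. i \<le> r}" using k by (auto simp: K_def labels_def)
    show "card K < l" using cardK Suc.prems by simp
    show "a ` K \<subseteq> {j \<in> labels. j > r}" unfolding aK using k by (auto simp: labels_def)
    show "inj_on a K" by (auto simp: inj_on_def a_def K_def)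
    show "y' \<sigma>1 \<noteq> 0" "arcs \<sigma>1 = l" using \<sigma>1 by (auto simp: y'_def)
    show "\<delta> + of_int c + of_int c' \<noteq> 0" if "c \<in> jm_values (s - card K)" "c' \<in> jm_values (r - l + 1)" for c c'
      using gen that Suc_le_lessD[OF Suc.prems] ls unfolding generic_def cardK by blast
    fix \<sigma> assume nz: "y' \<sigma> \<noteq> 0"
    have "y' \<in> layer_ideal l" unfolding y'_def by (intro layer_ideal_mul y)
    then have "\<sigma> \<in> perms" "\<not> arcs \<sigma> < l" using nz by (auto simp: layer_ideal_def supported_def)
    moreover have "\<sigma> i = a i" if "i \<in> K" for i
    proof -
      obtain \<rho> where \<rho>: "\<rho> \<in> perms" "star (nest k) \<rho> = \<sigma>"
        using nz mul_bas_leftE[OF nest_in_perms[OF k(3,4)]] unfolding y'_def by metis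
      have "nest k i = a i" "i \<le> r" "i \<in> labels" "a i > r" using that k by (auto simp: nest_apply K_def a_def labels_def)
      then show ?thesis using star_top[OF nest_in_perms[OF k(3,4)] \<rho>(1)] \<rho>(2) by metis
    qed
    ultimately show "\<sigma> \<in> perms \<and> l \<le> arcs \<sigma> \<and> (\<forall>i\<in>K. \<sigma> i = a i)" by simp
  qed
  then obtain i j \<sigma> where ij: "(i, j) \<in> hooks" "i \<notin> K" "j \<notin> a ` K" and \<sigma>: "arcs \<sigma> = l" "mul (bas (transpose i j)) y' \<sigma> \<noteq> 0" by blast
  have \<sigma>p: "\<sigma> \<in> perms" using \<sigma>(2) mul_supported[of "bas (transpose i j)" y'] by (auto simp: supported_def simp del: mul_supported)
  note h = hooksD[OF ij(1)]
  define i' where "i' = r - k"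
  define j' where "j' = r + 1 + k"
  have h': "(i', j') \<in> hooks" unfolding i'_def j'_def by (rule nest_hook) (use k in auto)
  note h'D = hooksD[OF h']
  have iK: "i \<le> r - k" "j > r + k" using ij h aK by (auto simp: K_def)
  define \<kappa> where "\<kappa> = transpose i i' \<circ> transpose j j'"
  have \<kappa>w: "\<kappa> \<in> wall_perms" unfolding \<kappa>_def
    by (intro comp_wall_perms transpose_left_wall transpose_right_wall) (use h h'D in auto)
  have \<kappa>f: "\<kappa> \<in> nest_fix k" using \<kappa>w iK h by (auto simp: nest_fix_def \<kappa>_def i'_def j'_def transpose_def)
  have comm: "mul (bas \<kappa>) (bas (transpose i j)) = mul (bas (transpose i' j')) (bas \<kappa>)"
  proof -
    have "rgt \<kappa> = transpose j j'" "lft \<kappa> = transpose i i'"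
      using h h'D by (auto simp: fun_eq_iff rgt_def lft_def \<kappa>_def transpose_def)
    then have "star \<kappa> (transpose i j) = transpose j j' \<circ> transpose i j \<circ> transpose i i'" "lp \<kappa> (transpose i j) = 0"
      using star_wall_left[OF \<kappa>w h(6)] by auto
    moreover have "\<kappa> i' = i" using h h'D by (auto simp: \<kappa>_def transpose_def)
    then have "star (transpose i' j') \<kappa> = transpose i j' \<circ> \<kappa>" "lp (transpose i' j') \<kappa> = 0"
      using star_hook_left[OF h' wall_permsD(1)[OF \<kappa>w]] h h'D by auto
    moreover have "transpose j j' \<circ> transpose i j \<circ> transpose i i' = transpose i j' \<circ> \<kappa>"
      using h h'D by (auto simp: fun_eq_iff \<kappa>_def transpose_def)
    ultimately show ?thesis using wall_permsD(1)[OF \<kappa>w] h(6) h'D(6) by (simp add: mul_bas)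
  qed
  have "mul (bas (nest (Suc k))) (mul (bas (star \<kappa> \<tau>)) y) =
      mul (bas (transpose i' j')) (mul (bas (nest k)) (mul (bas \<kappa>) (mul (bas \<tau>) y)))"
    using bas_nest_Suc[OF k(1,2)] star_wall_wall(2)[OF \<kappa>w \<tau>] by (simp add: mul_assoc[symmetric] i'_def j'_def)
  also have "\<dots> = mul (bas (transpose i' j')) (mul (mul (bas (nest k)) (bas \<kappa>)) (mul (bas \<tau>) y))" by (simp add: mul_assoc)
  also have "\<dots> = mul (mul (bas (transpose i' j')) (bas \<kappa>)) y'"
    unfolding mul_bas_nest_commute[OF \<kappa>f k(3,4), symmetric] by (simp add: mul_assoc y'_def)
  also have "\<dots> = mul (bas \<kappa>) (mul (bas (transpose i j)) y')" unfolding comm[symmetric] by (simp add: mul_assoc)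
  finally have "mul (bas (nest (Suc k))) (mul (bas (star \<kappa> \<tau>)) y) (rgt \<kappa> \<circ> \<sigma> \<circ> lft \<kappa>) \<noteq> 0"
    using mul_wall_apply[OF \<kappa>w \<sigma>p] \<sigma>(2) by simp
  moreover have "arcs (rgt \<kappa> \<circ> \<sigma> \<circ> lft \<kappa>) = l" using arcs_wall lft_rgt_wall[OF \<kappa>w] \<sigma>p \<sigma>(1) by simp
  ultimately show ?case using star_wall_wall(1)[OF \<kappa>w \<tau>] by blast
qed

text \<open>The flip of \<open>contract_left\<close>; the nested diagram is its own mirror
  image.\<close>

lemma contract_right:
  assumes gen: generic and y: "y \<in> layer_ideal l" and \<sigma>0: "y \<sigma>0 \<noteq> 0" "arcs \<sigma>0 = l"
  shows "\<exists>\<tau>\<in>wall_perms. \<exists>\<sigma>. arcs \<sigma> = l \<and> mul (mul y (bas \<tau>)) (bas (nest l)) \<sigma> \<noteq> 0"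
proof -
  have ys: "y \<in> supported" using y by (simp add: layer_ideal_def)
  have p0: "\<sigma>0 \<in> perms" using ys \<sigma>0 by (auto simp: supported_def)
  have ls: "l \<le> r" "l \<le> s" using arcs_le[OF p0] \<sigma>0 by auto
  have "flip y (pinv \<sigma>0) \<noteq> 0" using \<sigma>0 p0 by (simp add: flip_def inv_in_perms pinv_pinv)
  moreover have "arcs (pinv \<sigma>0) = l" using \<sigma>0 p0 by (simp add: arcs_pinv)
  ultimately obtain \<tau> \<sigma> where \<tau>: "\<tau> \<in> wall_perms" and \<sigma>: "arcs \<sigma> = l" "mul (bas (nest l)) (mul (bas \<tau>) (flip y)) \<sigma> \<noteq> 0"
    using contract_left[OF gen flip_layer_ideal[OF y], of "pinv \<sigma>0" l] by auto
  have \<sigma>p: "\<sigma> \<in> perms" using \<sigma>(2) mul_supported[of "bas (nest l)" "mul (bas \<tau>) (flip y)"]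
    by (auto simp: supported_def simp del: mul_supported)
  have "flip (mul (bas (nest l)) (mul (bas \<tau>) (flip y))) = mul (mul y (bas (pinv \<tau>))) (bas (nest l))"
    using wall_permsD(1)[OF \<tau>] ls by (simp add: flip_mul flip_flip[OF ys] flip_bas nest_in_perms pinv_nest)
  then have "mul (mul y (bas (pinv \<tau>))) (bas (nest l)) (pinv \<sigma>) \<noteq> 0"
    using \<sigma>(2) \<sigma>p by (metis flip_def inv_in_perms pinv_pinv)
  moreover have "arcs (pinv \<sigma>) = l" using \<sigma> \<sigma>p by (simp add: arcs_pinv)
  ultimately show ?thesis using pinv_wall_perms[OF \<tau>] by blast
qed

section \<open>Maschke's theorem for the group algebra of the lines\<close>

definition line_algebra :: "nat \<Rightarrow> ((nat \<Rightarrow> nat) \<Rightarrow> 'k) set" where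
  "line_algebra k = {f. \<forall>\<sigma>. \<sigma> \<notin> nest_fix k \<longrightarrow> f \<sigma> = 0}"

lemma finite_nest_fix: "finite (nest_fix k)"
  by (rule finite_subset[OF _ finite_perms]) (use nest_fixD(2) in blast)

lemma line_algebra_supported: "f \<in> line_algebra k \<Longrightarrow> f \<in> supported"
  using nest_fixD(2) by (auto simp: line_algebra_def supported_def)

lemma line_algebra_closed:
  "0 \<in> line_algebra k" "f \<in> line_algebra k \<Longrightarrow> g \<in> line_algebra k \<Longrightarrow> f + g \<in> line_algebra k"
  "f \<in> line_algebra k \<Longrightarrow> g \<in> line_algebra k \<Longrightarrow> f - g \<in> line_algebra k"
  "f \<in> line_algebra k \<Longrightarrow> scal c f \<in> line_algebra k"
  by (simp_all add: line_algebra_def scal_def)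

lemma bas_line_algebra: "h \<in> nest_fix k \<Longrightarrow> bas h \<in> line_algebra k"
  unfolding line_algebra_def bas_def by auto

lemma line_algebra_expand:
  assumes "f \<in> line_algebra k"
  shows "f = (\<Sum>h\<in>nest_fix k. scal (f h) (bas h))"
proof
  fix \<rho>
  have "(\<Sum>h\<in>nest_fix k. scal (f h) (bas h)) \<rho> = (\<Sum>h\<in>nest_fix k. if \<rho> = h then f h else 0)"
    unfolding sum_apply by (intro sum.cong refl) (simp add: scal_def bas_def)
  also have "\<dots> = f \<rho>" using assms by (simp add: finite_nest_fix line_algebra_def)
  finally show "f \<rho> = (\<Sum>h\<in>nest_fix k. scal (f h) (bas h)) \<rho>" by simp
qed

lemma nest_fix_star:
  assumes "g \<in> nest_fix k" "h \<in> nest_fix k"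
  shows "star g h \<in> nest_fix k" "mul (bas g) (bas h) = bas (star g h)"
proof -
  note w = nest_fixD(1)[OF assms(1)] nest_fixD(1)[OF assms(2)]
  have "star g h i = i" if "r - k < i" "i \<le> r + k" for i
    using assms that unfolding star_wall_left(1)[OF w(1) wall_permsD(1)[OF w(2)]]
    by (auto simp: nest_fix_def lft_def rgt_def)
  then show "star g h \<in> nest_fix k" using star_wall_wall(1)[OF w] by (simp add: nest_fix_def)
  show "mul (bas g) (bas h) = bas (star g h)" by (rule star_wall_wall(2)[OF w])
qed

lemma nest_fix_pinv:
  assumes "h \<in> nest_fix k"
  shows "pinv h \<in> nest_fix k" "star h (pinv h) = id" "star (pinv h) h = id"
proof -
  note w = nest_fixD(1)[OF assms] and p = nest_fixD(2)[OF assms]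
  note w' = pinv_wall_perms[OF w]
  have fx: "h i = i" if "r - k < i" "i \<le> r + k" for i using assms that by (auto simp: nest_fix_def)
  have "pinv h i = i" if "r - k < i" "i \<le> r + k" for i using pinv_perms(2)[OF p, of i] fx[OF that] by metis
  then show "pinv h \<in> nest_fix k" using w' by (simp add: nest_fix_def)
  have *: "star h (pinv h) = id" if h: "h \<in> wall_perms" for h
  proof
    fix i
    note hp = wall_permsD[OF h] and h' = wall_permsD[OF pinv_wall_perms[OF h]]
    show "star h (pinv h) i = id i"
      unfolding star_wall_left(1)[OF h h'(1)]
      using hp(2)[of i] h'(2)[of i] pinv_perms[OF hp(1)] by (simp add: lft_def rgt_def)
  qed
  show "star h (pinv h) = id" by (rule *[OF w])
  show "star (pinv h) h = id" using *[OF w'] by (simp only: pinv_pinv[OF p])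
qed

lemma id_nest_fix: "id \<in> nest_fix k"
  using id_wall_perms by (simp add: nest_fix_def)

lemma line_algebra_mul:
  assumes "f \<in> line_algebra k" "g \<in> line_algebra k"
  shows "mul f g \<in> line_algebra k"
proof -
  have "mul f g \<rho> = 0" if \<rho>: "\<rho> \<notin> nest_fix k" for \<rho>
    unfolding mul_def
  proof (intro sum.neutral ballI)
    fix \<sigma> \<tau>
    have "f \<sigma> = 0 \<or> g \<tau> = 0" if "star \<sigma> \<tau> = \<rho>"
      using assms nest_fix_star(1)[of \<sigma> k \<tau>] that \<rho> by (auto simp: line_algebra_def)
    then show "(if star \<sigma> \<tau> = \<rho> then f \<sigma> * g \<tau> * \<delta> ^ lp \<sigma> \<tau> else 0) = 0" by auto
  qed
  then show ?thesis by (simp add: line_algebra_def)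
qed

text \<open>Maschke's averaging argument: if \<open>t\<close> generates a left ideal of square zero, an equivariant projection
  onto that ideal is right multiplication by some \<open>\<epsilon>\<close> in it, so that \<open>card H \<cdot> t = t \<epsilon> = 0\<close>.\<close>

lemma line_algebra_semiprime:
  assumes char: "(of_nat (card (nest_fix k)) :: 'k) \<noteq> 0"
    and t: "t \<in> line_algebra k" and sq: "\<And>b. b \<in> line_algebra k \<Longrightarrow> mul (mul t b) t = 0"
  shows "t = 0"
proof -
  define H where "H = nest_fix k"
  define L where "L = (\<lambda>b. mul b t) ` line_algebra k"
  have L_add: "x + y \<in> L" if "x \<in> L" "y \<in> L" for x y
  proof -
    obtain b c where "b \<in> line_algebra k" "c \<in> line_algebra k" "x = mul b t" "y = mul c t" using \<open>x \<in> L\<close> \<open>y \<in> L\<close> unfolding L_def by blast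
    then show ?thesis unfolding L_def by (intro image_eqI[of _ _ "b + c"]) (simp_all only: mul_add_left line_algebra_closed)
  qed
  have L_scal: "scal c x \<in> L" if "x \<in> L" for c x
  proof -
    obtain b where "b \<in> line_algebra k" "x = mul b t" using \<open>x \<in> L\<close> unfolding L_def by blast
    then show ?thesis unfolding L_def by (intro image_eqI[of _ _ "scal c b"]) (simp_all only: mul_scal line_algebra_closed)
  qed
  have L_zero: "0 \<in> L" unfolding L_def using line_algebra_closed(1) by (intro image_eqI[of _ _ 0]) simp_all
  have L_mul: "mul b x \<in> L" if "b \<in> line_algebra k" "x \<in> L" for b x
  proof -
    obtain c where "c \<in> line_algebra k" "x = mul c t" using \<open>x \<in> L\<close> unfolding L_def by blast
    then show ?thesis unfolding L_def using that(1)
      by (intro image_eqI[of _ _ "mul b c"]) (simp_all only: mul_assoc line_algebra_mul)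
  qed
  have L_sum: "(\<Sum>i\<in>I. f i) \<in> L" if "finite I" "\<And>i. i \<in> I \<Longrightarrow> f i \<in> L" for I :: "(nat \<Rightarrow> nat) set" and f
    using that
  proof (induction I rule: finite_induct)
    case (insert x F)
    show ?case unfolding sum.insert[OF insert.hyps(1,2)] by (rule L_add) (use insert in blast)+
  qed (simp add: L_zero)
  have L_scal': "(\<lambda>i. c * x i) \<in> L" if "x \<in> L" for c x using L_scal[OF that, of c] unfolding scal_def .
  have "\<exists>P. (\<forall>x. P x \<in> L) \<and> (\<forall>x y. P (x + y) = P x + P y) \<and>
    (\<forall>c x. P (\<lambda>i. c * x i) = (\<lambda>i. c * P x i)) \<and> (\<forall>x\<in>L. P x = x)"
    using L_zero L_add L_scal' by (rule subspace_projection)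
  then obtain P where P': "\<forall>x. P x \<in> L" "\<forall>x y. P (x + y) = P x + P y"
    "\<forall>c x. P (\<lambda>i. c * x i) = (\<lambda>i. c * P x i)" "\<forall>x\<in>L. P x = x" by (elim exE conjE)
  have P: "P x \<in> L" "P (x + y) = P x + P y" "P (scal c x) = scal c (P x)" "x \<in> L \<Longrightarrow> P x = x" for x y c
    using P' unfolding scal_def by simp_all
  have P_zero: "P 0 = 0" using P(4)[OF L_zero] .
  have P_sum: "P (\<Sum>i\<in>I. f i) = (\<Sum>i\<in>I. P (f i))" if "finite I" for I :: "(nat \<Rightarrow> nat) set" and f
    using that
  proof (induction I rule: finite_induct)
    case (insert x F)
    show ?case unfolding sum.insert[OF insert.hyps(1,2)] P(2) insert.IH ..
  qed (simp only: sum.empty P_zero)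
  \<comment> \<open>A sum over the group in place of the mean; the group order enters only at the
    end, as a factor of t.\<close>
  define Q where "Q x = (\<Sum>h\<in>H. mul (bas h) (P (mul (bas (pinv h)) x)))" for x
  define e where "e = Q (bas id)"
  have fH: "finite H" by (simp add: H_def finite_nest_fix)
  have eL: "e \<in> L" unfolding e_def Q_def
    by (intro L_sum fH L_mul P(1)) (simp add: H_def bas_line_algebra)
  \<comment> \<open>Q commutes with translations by the group, so it is right multiplication by its
    value at the unit.\<close>
  have equi: "mul (bas g) e = Q (bas g)" if g: "g \<in> H" for g
  proof -
    note gH = g[unfolded H_def]
    have one: "mul (bas x) (bas id) = bas x" if "x \<in> H" for x
      by (rule mul_one(2)[OF bas_supported]) (use that nest_fixD(2) in \<open>simp add: H_def\<close>)
    have "mul (bas g) e = (\<Sum>h\<in>H. mul (bas (star g h)) (P (bas (pinv h))))"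
      unfolding e_def Q_def mul_sum_right
    proof (intro sum.cong refl)
      fix h assume h: "h \<in> H"
      have "pinv h \<in> H" using h nest_fix_pinv(1) by (simp add: H_def)
      show "mul (bas g) (mul (bas h) (P (mul (bas (pinv h)) (bas id)))) = mul (bas (star g h)) (P (bas (pinv h)))"
        unfolding one[OF \<open>pinv h \<in> H\<close>] mul_assoc[symmetric] nest_fix_star(2)[OF gH h[unfolded H_def]] by (rule refl)
    qed
    also have "\<dots> = (\<Sum>h\<in>H. mul (bas h) (P (mul (bas (pinv h)) (bas g))))"
    proof (rule sum.reindex_bij_witness[where j = "\<lambda>h. star g h" and i = "\<lambda>h. star (pinv g) h"])
      fix h assume h: "h \<in> H"
      note hH = h[unfolded H_def]
      note p = nest_fixD(2)[OF gH] nest_fixD(2)[OF nest_fix_pinv(1)[OF gH]] nest_fixD(2)[OF hH]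
        nest_fixD(2)[OF nest_fix_pinv(1)[OF hH]]
      show "star (pinv g) (star g h) = h" "star g (star (pinv g) h) = h"
        by (simp_all only: star_assoc[OF p(2,1,3), symmetric] star_assoc[OF p(1,2,3), symmetric]
            nest_fix_pinv[OF gH] star_id[OF p(3)])
      show "star g h \<in> H" "star (pinv g) h \<in> H"
        unfolding H_def by (intro nest_fix_star nest_fix_pinv gH hH)+
      have "pinv (star g h) = star (pinv h) (pinv g)" by (rule star_inv[OF p(1,3), symmetric])
      then have "star (pinv (star g h)) g = star (pinv h) (star (pinv g) g)" using star_assoc[OF p(4,2,1)] by simp
      also have "\<dots> = pinv h" by (simp only: nest_fix_pinv(3)[OF gH] star_id[OF p(4)])
      finally have "mul (bas (pinv (star g h))) (bas g) = bas (pinv h)"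
        using nest_fix_star(2)[OF nest_fix_pinv(1)[OF nest_fix_star(1)[OF gH hH]] gH] by simp
      then show "mul (bas (star g h)) (P (mul (bas (pinv (star g h))) (bas g))) = mul (bas (star g h)) (P (bas (pinv h)))"
        by simp
    qed
    finally show ?thesis by (simp add: Q_def)
  qed
  have Q_scal: "Q (scal c x) = scal c (Q x)" for c x
  proof -
    have "scal c (\<Sum>h\<in>H. f h) = (\<Sum>h\<in>H. scal c (f h))" for f :: "(nat \<Rightarrow> nat) \<Rightarrow> (nat \<Rightarrow> nat) \<Rightarrow> 'k"
      by (simp add: scal_def sum_apply fun_eq_iff sum_distrib_left)
    then show ?thesis by (simp add: Q_def mul_scal P(3))
  qed
  have Q_sum: "Q (\<Sum>g\<in>H. f g) = (\<Sum>g\<in>H. Q (f g))" for f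
    unfolding Q_def mul_sum_right P_sum[OF fH] by (rule sum.swap)
  have "mul t e = (\<Sum>g\<in>H. scal (t g) (mul (bas g) e))"
    by (subst line_algebra_expand[OF t]) (simp add: mul_sum_left mul_scal H_def)
  also have "\<dots> = (\<Sum>g\<in>H. Q (scal (t g) (bas g)))"
    by (intro sum.cong refl) (simp only: equi Q_scal)
  also have "\<dots> = Q t" unfolding Q_sum[symmetric] using line_algebra_expand[OF t] by (simp add: H_def)
  \<comment> \<open>Every term equals t, as P fixes the left ideal generated by t.\<close>
  also have "\<dots> = (\<Sum>h\<in>H. t)"
    unfolding Q_def
  proof (intro sum.cong refl)
    fix h assume "h \<in> H"
    then have h: "h \<in> nest_fix k" by (simp add: H_def)
    note h' = nest_fix_pinv[OF h]
    have "mul (bas (pinv h)) t \<in> L" unfolding L_def using bas_line_algebra[OF h'(1)] by blast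
    then have "P (mul (bas (pinv h)) t) = mul (bas (pinv h)) t" by (rule P(4))
    then show "mul (bas h) (P (mul (bas (pinv h)) t)) = t"
      using nest_fix_star(2)[OF h h'(1)] h'(2) mul_one(1)[OF line_algebra_supported[OF t]]
      by (simp add: mul_assoc[symmetric])
  qed
  finally have te: "mul t e = (\<Sum>h\<in>H. t)" .
  obtain b where b: "b \<in> line_algebra k" "e = mul b t" using eL unfolding L_def by blast
  \<comment> \<open>Since e lies in the left ideal, t e has the form t b t.\<close>
  have "mul t e = 0" unfolding b(2) mul_assoc[symmetric] by (rule sq[OF b(1)])
  then have "(\<Sum>h\<in>H. t) \<sigma> = 0" for \<sigma> using te by simp
  then have "of_nat (card H) * t \<sigma> = 0" for \<sigma> by (simp add: sum_apply)
  then show ?thesis using char by (auto simp: H_def fun_eq_iff)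
qed

text \<open>The diagrams \<open>h \<circ> nest k\<close> are distinct for distinct h, so f can be
  read off from its product with the nested hooks.\<close>

lemma mul_line_nest:
  assumes f: "f \<in> line_algebra k" and k: "k \<le> r" "k \<le> s"
  shows "h \<in> nest_fix k \<Longrightarrow> mul f (bas (nest k)) (h \<circ> nest k) = f h"
    "(\<And>h. h \<in> nest_fix k \<Longrightarrow> \<rho> \<noteq> h \<circ> nest k) \<Longrightarrow> mul f (bas (nest k)) \<rho> = 0"
    "mul f (bas (nest k)) = mul (bas (nest k)) f"
proof -
  have *: "mul (bas h) (bas (nest k)) = bas (h \<circ> nest k)" "mul (bas (nest k)) (bas h) = bas (h \<circ> nest k)"
    if "h \<in> nest_fix k" for h
    unfolding mul_bas[OF nest_fixD(2)[OF that] nest_in_perms[OF k]] mul_bas[OF nest_in_perms[OF k] nest_fixD(2)[OF that]]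
      star_nest[OF that k] by (simp_all only: scal_def power_0 mult_1_left)
  have e: "mul f (bas (nest k)) = (\<Sum>h\<in>nest_fix k. scal (f h) (bas (h \<circ> nest k)))"
    by (subst line_algebra_expand[OF f]) (simp only: mul_sum_left mul_scal * cong: sum.cong)
  show "mul f (bas (nest k)) = mul (bas (nest k)) f"
  proof -
    have "mul (bas (nest k)) f = (\<Sum>h\<in>nest_fix k. scal (f h) (bas (h \<circ> nest k)))"
      by (subst line_algebra_expand[OF f]) (simp only: mul_sum_right mul_scal * cong: sum.cong)
    then show ?thesis by (simp only: e)
  qed
  show "mul f (bas (nest k)) (h \<circ> nest k) = f h" if h: "h \<in> nest_fix k"
  proof -
    have inj: "h \<circ> nest k = h' \<circ> nest k \<longleftrightarrow> h = h'" for h'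
      using nest_nest[OF k(1)] by (auto simp: fun_eq_iff) metis
    have "mul f (bas (nest k)) (h \<circ> nest k) = (\<Sum>h'\<in>nest_fix k. if h = h' then f h' else 0)"
      unfolding e sum_apply by (intro sum.cong refl) (simp only: scal_def bas_def inj, simp)
    then show ?thesis using h by (simp add: finite_nest_fix)
  qed
  show "mul f (bas (nest k)) \<rho> = 0" if "\<And>h. h \<in> nest_fix k \<Longrightarrow> \<rho> \<noteq> h \<circ> nest k"
    unfolding e sum_apply using that by (intro sum.neutral) (simp add: scal_def bas_def)
qed

section \<open>Diagrams framed by nested hooks\<close>

definition line_part :: "nat \<Rightarrow> ((nat \<Rightarrow> nat) \<Rightarrow> 'k) \<Rightarrow> (nat \<Rightarrow> nat) \<Rightarrow> 'k" where
  "line_part k w = (\<lambda>h. if h \<in> nest_fix k then w (h \<circ> nest k) else 0)"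

lemma line_part_in: "line_part k w \<in> line_algebra k"
  by (simp add: line_algebra_def line_part_def)

lemma arcs_nest:
  assumes k: "k \<le> r" "k \<le> s" and h: "h \<in> nest_fix k"
  shows "arcs (h \<circ> nest k) = k"
proof -
  have "arcs (h \<circ> nest k) = arcs (nest k)"
    using arcs_wall[OF nest_fixD(1)[OF h] id_wall_perms nest_in_perms[OF k]] by simp
  also have "{i \<in> labels. i \<le> r \<and> nest k i > r} = {r - k + 1..r}"
    using k by (auto simp: nest_apply labels_def)
  then have "arcs (nest k) = k" unfolding arcs_def using k by simp
  finally show ?thesis .
qed

text \<open>With e for the nested hooks, diagrams in e b e inherit the nested arcs in both rows; if
  they have exactly k arcs, all other labels are joined by lines. This replaces the corner algebra
  at an idempotent, which e need not supply when \<delta> = 0.\<close>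

lemma corner_line_part:
  fixes b :: "(nat \<Rightarrow> nat) \<Rightarrow> 'k"
  assumes k: "k \<le> r" "k \<le> s"
  defines "w \<equiv> mul (bas (nest k)) (mul b (bas (nest k)))"
  shows "w - mul (line_part k w) (bas (nest k)) \<in> layer_ideal (Suc k)"
proof -
  have n: "nest k \<in> perms" by (rule nest_in_perms[OF k])
  have nl: "bas (nest k) \<in> layer_ideal k"
    using arcs_nest[OF k id_nest_fix] bas_supported[OF n] by (auto simp: layer_ideal_def bas_def)
  have wl: "w \<in> layer_ideal k" unfolding w_def by (intro layer_ideal_mul nl)
  have vl: "mul (line_part k w) (bas (nest k)) \<in> layer_ideal k" by (intro layer_ideal_mul nl)
  have "w \<sigma> = mul (line_part k w) (bas (nest k)) \<sigma>" if \<sigma>k: "arcs \<sigma> = k" for \<sigma>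
  proof (cases "\<exists>h\<in>nest_fix k. \<sigma> = h \<circ> nest k")
    case True
    then obtain h where h: "h \<in> nest_fix k" "\<sigma> = h \<circ> nest k" by blast
    show ?thesis unfolding h(2) mul_line_nest(1)[OF line_part_in k h(1)] by (simp add: line_part_def h(1))
  next
    case False
    have "w \<sigma> = 0"
    proof (rule ccontr)
      assume nz: "w \<sigma> \<noteq> 0"
      then obtain \<tau> where \<tau>: "\<tau> \<in> perms" "star (nest k) \<tau> = \<sigma>" unfolding w_def using mul_bas_leftE[OF n] by metis
      then have \<sigma>: "\<sigma> \<in> perms" using star_in_perms n by blast
      have top: "\<sigma> i = nest k i" if "r - k < i" "i \<le> r" for i
        using star_top[OF n \<tau>(1), of i] \<tau>(2) that k by (simp add: nest_apply labels_def)
      \<comment> \<open>The flip turns the right factor into a left one, which yields the southern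
        arcs.\<close>
      have "mul (mul (bas (nest k)) b) (bas (nest k)) \<sigma> \<noteq> 0" using nz by (simp add: w_def mul_assoc)
      then have "flip (mul (mul (bas (nest k)) b) (bas (nest k))) (pinv \<sigma>) \<noteq> 0"
        using \<sigma> by (simp add: flip_def inv_in_perms pinv_pinv)
      then have "mul (bas (nest k)) (flip (mul (bas (nest k)) b)) (pinv \<sigma>) \<noteq> 0"
        by (simp add: flip_mul flip_bas n pinv_nest k)
      then obtain \<tau>' where \<tau>': "\<tau>' \<in> perms" "star (nest k) \<tau>' = pinv \<sigma>" using mul_bas_leftE[OF n] by metis
      have bot: "\<sigma> j = nest k j" if "r < j" "j \<le> r + k" for j
      proof -
        have "nest k j \<in> labels" "nest k j \<le> r" "nest k (nest k j) = j"
          using that k nest_nest[OF k(1)] by (auto simp: nest_apply labels_def)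
        then have "pinv \<sigma> (nest k j) = j" using star_top[OF n \<tau>'(1), of "nest k j"] \<tau>'(2) that by simp
        then show ?thesis using pinv_perms(1)[OF \<sigma>] by metis
      qed
      define h where "h = \<sigma> \<circ> nest k"
      have hp: "h \<in> perms" unfolding h_def by (rule comp_in_perms[OF \<sigma> n])
      have B: "\<sigma> i = nest k i" if "r - k < i" "i \<le> r + k" for i using top bot that by (cases "i \<le> r") auto
      have hB: "h i = i" if "r - k < i" "i \<le> r + k" for i
      proof -
        have "nest k i = 2 * r + 1 - i" using that by (simp add: nest_apply[OF k(1)])
        then have "r - k < nest k i" "nest k i \<le> r + k" using that k by linarith+
        then show ?thesis using B[of "nest k i"] nest_nest[OF k(1)] by (simp add: h_def)
      qed
      \<comment> \<open>With only k arcs the nested ones are all of them, so h respects the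
        wall.\<close>
      have eq: "{i \<in> labels. i \<le> r \<and> \<sigma> i > r} = {r - k + 1..r}"
      proof (rule card_subset_eq[symmetric])
        show "{r - k + 1..r} \<subseteq> {i \<in> labels. i \<le> r \<and> \<sigma> i > r}"
          using top k by (auto simp: nest_apply labels_def)
        show "card {r - k + 1..r} = card {i \<in> labels. i \<le> r \<and> \<sigma> i > r}" using \<sigma>k k unfolding arcs_def by simp
      qed simp
      have eq': "{j \<in> labels. j > r \<and> \<sigma> j \<le> r} = {r + 1..r + k}"
      proof (rule card_subset_eq[symmetric])
        show "{r + 1..r + k} \<subseteq> {j \<in> labels. j > r \<and> \<sigma> j \<le> r}"
          using bot k by (auto simp: nest_apply labels_def)
        show "card {r + 1..r + k} = card {j \<in> labels. j > r \<and> \<sigma> j \<le> r}" using \<sigma>k k arcs_right[OF \<sigma>] by simp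
      qed simp
      have "h i \<le> r \<longleftrightarrow> i \<le> r" if "i \<in> labels" for i
      proof (cases "r - k < i \<and> i \<le> r + k")
        case True
        then show ?thesis using hB by simp
      next
        case False
        then have hi: "h i = \<sigma> i"
          using nest_apply[OF k(1), of i] by (simp only: h_def comp_apply if_False)
        have "i \<notin> {r - k + 1..r}" "i \<notin> {r + 1..r + k}" using False by auto
        then show ?thesis unfolding hi eq[symmetric] eq'[symmetric] using that by auto
      qed
      then have "h \<in> nest_fix k" using hp hB by (simp add: nest_fix_def wall_perms_def)
      moreover have "\<sigma> = h \<circ> nest k" by (simp add: h_def fun_eq_iff nest_nest[OF k(1)])
      ultimately show False using False by blast
    qed
    moreover have "mul (line_part k w) (bas (nest k)) \<sigma> = 0"
      by (rule mul_line_nest(2)[OF line_part_in k]) (use False in blast)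
    ultimately show ?thesis by simp
  qed
  moreover have "w \<sigma> = mul (line_part k w) (bas (nest k)) \<sigma>" if "arcs \<sigma> < k" for \<sigma>
    using wl vl that by (simp add: layer_ideal_def)
  ultimately show ?thesis
    using layer_ideal_closed(2)[OF wl vl] by (auto simp: layer_ideal_def less_Suc_eq)
qed

text \<open>All diagrams in the product have exactly k arcs, so none of them survives in the higher
  layer.\<close>

lemma line_algebra_layer_zero:
  assumes k: "k \<le> r" "k \<le> s" and f: "f \<in> line_algebra k" and "mul f (bas (nest k)) \<in> layer_ideal (Suc k)"
  shows "f = 0"
proof
  fix h
  show "f h = 0 h"
  proof (cases "h \<in> nest_fix k")
    case True
    then show ?thesis using mul_line_nest(1)[OF f k True] arcs_nest[OF k True] assms(4) by (auto simp: layer_ideal_def)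
  qed (use f in \<open>simp add: line_algebra_def\<close>)
qed

end

section \<open>Semisimplicity for generic parameters\<close>

text \<open>The dimension, taken as the largest size of an independent set; finitely many basis
  functions span all spaces in question and bound it.\<close>

lemma subspace_measure_exists:
  fixes D :: "'a set"
  assumes "finite D"
  shows "\<exists>\<mu> :: ('a \<Rightarrow> 'k::field) set \<Rightarrow> nat. \<forall>I J. 0 \<in> I \<longrightarrow> (\<forall>x\<in>I. \<forall>y\<in>I. x + y \<in> I) \<longrightarrow>
    (\<forall>c. \<forall>x\<in>I. (\<lambda>i. c * x i) \<in> I) \<longrightarrow> J \<subseteq> {f. \<forall>x. x \<notin> D \<longrightarrow> f x = 0} \<longrightarrow> I \<subset> J \<longrightarrow> \<mu> I < \<mu> J"
proof -
  define sc where "sc = (\<lambda>(c :: 'k) f (x :: 'a). c * f x)"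
  interpret vs: vector_space sc unfolding sc_def by (rule vector_space_fun)
  define T where "T = (\<lambda>d x. if x = d then 1 else 0 :: 'k) ` D"
  have fT: "finite T" using assms by (simp add: T_def)
  have span: "f \<in> vs.span T" if "\<forall>x. x \<notin> D \<longrightarrow> f x = 0" for f
  proof -
    have sa: "(\<Sum>d\<in>E. g d) x = (\<Sum>d\<in>E. g d x)" for E :: "'a set" and g :: "'a \<Rightarrow> 'a \<Rightarrow> 'k" and x
      by (induction E rule: infinite_finite_induct) auto
    have "f = (\<Sum>d\<in>D. sc (f d) (\<lambda>x. if x = d then 1 else 0))"
    proof
      fix x
      have "(\<Sum>d\<in>D. sc (f d) (\<lambda>x. if x = d then 1 else 0)) x = (\<Sum>d\<in>D. if x = d then f d else 0)"
        unfolding sa by (intro sum.cong refl) (simp add: sc_def)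
      then show "f x = (\<Sum>d\<in>D. sc (f d) (\<lambda>x. if x = d then 1 else 0)) x" using that assms by simp
    qed
    moreover have "(\<Sum>d\<in>D. sc (f d) (\<lambda>x. if x = d then 1 else 0)) \<in> vs.span T"
      by (intro vs.span_sum vs.span_scale vs.span_base) (simp add: T_def)
    ultimately show ?thesis by simp
  qed
  define F where "F I = {n. \<exists>S. S \<subseteq> I \<and> vs.independent S \<and> finite S \<and> card S = n}" for I
  define \<mu> where "\<mu> I = Max (F I)" for I
  have bound: "finite S \<and> card S \<le> card T" if "S \<subseteq> I" "I \<subseteq> {f. \<forall>x. x \<notin> D \<longrightarrow> f x = 0}" "vs.independent S" for S I
    by (rule vs.independent_span_bound[OF fT that(3)]) (use that span in blast)
  have "\<mu> I < \<mu> J" if I: "0 \<in> I" "\<forall>x\<in>I. \<forall>y\<in>I. x + y \<in> I" "\<forall>c. \<forall>x\<in>I. (\<lambda>i. c * x i) \<in> I"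
    and J: "J \<subseteq> {f. \<forall>x. x \<notin> D \<longrightarrow> f x = 0}" and IJ: "I \<subset> J" for I J
  proof -
    have sub: "vs.subspace I" by (rule vs.subspaceI) (use I in \<open>auto simp: sc_def\<close>)
    have JI: "I \<subseteq> {f. \<forall>x. x \<notin> D \<longrightarrow> f x = 0}" using J IJ by blast
    have fin: "finite (F K)" if "K \<subseteq> {f. \<forall>x. x \<notin> D \<longrightarrow> f x = 0}" for K
      by (rule finite_subset[of _ "{..card T}"]) (use bound[OF _ that] in \<open>auto simp: F_def\<close>)
    have "0 \<in> F I" unfolding F_def using vs.independent_empty by (intro CollectI exI[of _ "{}"]) simp
    then have "\<mu> I \<in> F I" unfolding \<mu>_def using Max_in[OF fin[OF JI]] by blast
    then obtain S where S: "S \<subseteq> I" "vs.independent S" "finite S" "card S = \<mu> I" by (auto simp: F_def)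
    obtain v where v: "v \<in> J" "v \<notin> I" using IJ by blast
    have "vs.span S \<subseteq> I" by (rule vs.span_minimal[OF S(1) sub])
    then have vS: "v \<notin> vs.span S" using v by blast
    then have "vs.independent (insert v S)" by (rule vs.independent_insertI[OF _ S(2)])
    moreover have "v \<notin> S" using v S by blast
    ultimately have "Suc (\<mu> I) \<in> F J"
      unfolding F_def using S v IJ by (intro CollectI exI[of _ "insert v S"]) auto
    then have "Suc (\<mu> I) \<le> \<mu> J" unfolding \<mu>_def[of J] by (rule Max_ge[OF fin[OF J]])
    then show ?thesis by simp
  qed
  then show ?thesis by blast
qed

context walled_algebra
begin

definition layer_eq :: "nat \<Rightarrow> ((nat \<Rightarrow> nat) \<Rightarrow> 'k) \<Rightarrow> ((nat \<Rightarrow> nat) \<Rightarrow> 'k) \<Rightarrow> bool" where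
  "layer_eq m a b \<longleftrightarrow> a - b \<in> layer_ideal m"

lemma layer_eq_trans:
  assumes "layer_eq m a b" "layer_eq m b c"
  shows "layer_eq m a c"
proof -
  have "(a - b) + (b - c) = a - c" by (simp only: diff_add_cancel add_diff_eq)
  then show ?thesis
    using layer_ideal_closed(1)[OF assms[unfolded layer_eq_def]] unfolding layer_eq_def by (simp only:)
qed

lemma layer_eq_sym:
  assumes "layer_eq m a b"
  shows "layer_eq m b a"
proof -
  have "0 - (a - b) = b - a" by (simp only: diff_0 minus_diff_eq)
  then show ?thesis using layer_ideal_closed(2)[OF layer_ideal_closed(4) assms[unfolded layer_eq_def]]
    unfolding layer_eq_def by (simp only:)
qed

lemma layer_eq_mul:
  assumes "layer_eq m a b"
  shows "layer_eq m (mul c a) (mul c b)" "layer_eq m (mul a c) (mul b c)"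
  using layer_ideal_mul[OF assms[unfolded layer_eq_def]]
  unfolding layer_eq_def by (simp_all only: mul_diff_left mul_diff_right)

lemma layer_eq_zero: "layer_eq m a 0 \<longleftrightarrow> a \<in> layer_ideal m"
  unfolding layer_eq_def by (simp only: diff_zero)

text \<open>Let e be the nested hooks and write z as g e and e b e as f(b) e modulo more arcs. Then
  z b z = 0 gives g f(b) g = 0, but the values f(b) need not exhaust the group algebra, so nothing
  follows for g alone. As f is left linear over the group algebra, (f(b) g) c (f(b) g) = f(b) (g f(c
  b) g) = 0 for all c. Maschke's theorem gives f(b) g = 0, which says that e b z has more
  arcs.\<close>

lemma contracted_semiprime:
  assumes k: "k \<le> r" "k \<le> s"
    and char: "(of_nat (card (nest_fix k)) :: 'k) \<noteq> 0"
    and zz: "z = mul (bas (nest k)) (mul z' (bas (nest k)))"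
    and zbz: "\<And>b. mul (mul z b) z = 0"
  shows "mul (bas (nest k)) (mul b z) \<in> layer_ideal (Suc k)"
proof -
  let ?e = "bas (nest k)"
  define f where "f b = line_part k (mul ?e (mul b ?e))" for b
  have f: "f b \<in> line_algebra k" "layer_eq (Suc k) (mul ?e (mul b ?e)) (mul (f b) ?e)" for b
    using line_part_in corner_line_part[OF k] unfolding f_def layer_eq_def by auto
  define g where "g = f z'"
  have g: "g \<in> line_algebra k" "layer_eq (Suc k) z (mul g ?e)" using f[of z'] unfolding g_def zz by auto
  have comm: "mul h ?e = mul ?e h" if "h \<in> line_algebra k" for h by (rule mul_line_nest(3)[OF that k])
  have zero: "h = 0" if "h \<in> line_algebra k" "layer_eq (Suc k) (mul h ?e) 0" for h
    by (rule line_algebra_layer_zero[OF k that(1)]) (use that(2) in \<open>simp only: layer_eq_zero\<close>)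
  \<comment> \<open>Times e this agrees with z b z modulo more arcs.\<close>
  have gfg: "mul (mul g (f b)) g = 0" for b
  proof (rule zero)
    show "mul (mul g (f b)) g \<in> line_algebra k" by (intro line_algebra_mul g f)
    have "mul (mul (mul g (f b)) g) ?e = mul g (mul (mul (f b) ?e) g)"
      by (simp only: mul_assoc comm[OF g(1)])
    moreover have "layer_eq (Suc k) (mul g (mul (mul (f b) ?e) g)) (mul g (mul (mul ?e (mul b ?e)) g))"
      by (intro layer_eq_mul layer_eq_sym[OF f(2)])
    moreover have "mul g (mul (mul ?e (mul b ?e)) g) = mul (mul (mul g ?e) b) (mul g ?e)"
      by (simp only: mul_assoc) (simp only: comm[OF g(1)])
    moreover have "layer_eq (Suc k) (mul (mul (mul g ?e) b) (mul g ?e)) (mul (mul z b) (mul g ?e))"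
      by (intro layer_eq_mul layer_eq_sym[OF g(2)])
    moreover have "layer_eq (Suc k) (mul (mul z b) (mul g ?e)) (mul (mul z b) z)"
      by (intro layer_eq_mul layer_eq_sym[OF g(2)])
    ultimately show "layer_eq (Suc k) (mul (mul (mul g (f b)) g) ?e) 0"
      unfolding zbz by (metis layer_eq_trans)
  qed
  \<comment> \<open>c commutes with e, so e (c b) e = c (e b e).\<close>
  have fmul: "f (mul c b) = mul c (f b)" if c: "c \<in> line_algebra k" for c b
  proof -
    have e: "mul ?e (mul (mul c b) ?e) = mul c (mul ?e (mul b ?e))"
      by (simp only: mul_assoc[symmetric] comm[OF c])
    have "layer_eq (Suc k) (mul (f (mul c b)) ?e) (mul c (mul (f b) ?e))"
      by (rule layer_eq_trans[OF layer_eq_sym[OF f(2)]]) (unfold e, intro layer_eq_mul f)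
    then have "layer_eq (Suc k) (mul (f (mul c b) - mul c (f b)) ?e) 0"
      unfolding layer_eq_def by (simp only: mul_diff_left mul_assoc diff_zero)
    then have "f (mul c b) - mul c (f b) = 0"
      by (intro zero line_algebra_closed(3) f line_algebra_mul c)
    then show ?thesis by simp
  qed
  have "mul (f b) g = 0"
  proof (rule line_algebra_semiprime[OF char])
    show "mul (f b) g \<in> line_algebra k" by (intro line_algebra_mul f g)
    fix c assume c: "c \<in> line_algebra k"
    have "mul (mul (mul (f b) g) c) (mul (f b) g) = mul (f b) (mul (mul g (mul c (f b))) g)"
      by (simp only: mul_assoc)
    also have "\<dots> = 0" by (simp only: fmul[OF c, symmetric] gfg mul_zero)
    finally show "mul (mul (mul (f b) g) c) (mul (f b) g) = 0" .
  qed
  then have "mul (mul (f b) ?e) g = 0" by (metis comm[OF g(1)] mul_assoc mul_zero(1) comm[OF f(1)] mul_zero(2))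
  moreover have "layer_eq (Suc k) (mul (mul ?e (mul b ?e)) g) (mul (mul (f b) ?e) g)"
    by (intro layer_eq_mul f)
  moreover have "mul (mul ?e (mul b ?e)) g = mul ?e (mul b (mul g ?e))" by (simp only: mul_assoc comm[OF g(1)])
  moreover have "layer_eq (Suc k) (mul ?e (mul b z)) (mul ?e (mul b (mul g ?e)))"
    by (intro layer_eq_mul g)
  ultimately show ?thesis unfolding layer_eq_zero[symmetric] by (metis layer_eq_trans)
qed

text \<open>Contracting x on both sides gives an element z framed by nested hooks that is still
  nonzero at diagrams with the least number l of arcs and inherits z b z = 0. Contracting z once
  more from the left contradicts \<open>contracted_semiprime\<close>.\<close>

lemma generic_semiprime:
  assumes gen: generic
    and char: "\<And>k. k \<le> r \<Longrightarrow> k \<le> s \<Longrightarrow> (of_nat (card (nest_fix k)) :: 'k) \<noteq> 0"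
    and x: "x \<in> supported" and xbx: "\<And>b. mul (mul x b) x = 0"
  shows "x = 0"
proof (rule ccontr)
  assume "x \<noteq> 0"
  then obtain \<sigma>1 where \<sigma>1: "x \<sigma>1 \<noteq> 0" by (auto simp: fun_eq_iff)
  define Q where "Q n \<longleftrightarrow> (\<exists>\<sigma>. x \<sigma> \<noteq> 0 \<and> arcs \<sigma> = n)" for n
  define l where "l = (LEAST n. Q n)"
  have "Q (arcs \<sigma>1)" using \<sigma>1 by (auto simp: Q_def)
  then have "Q l" unfolding l_def by (rule LeastI)
  then obtain \<sigma>0 where \<sigma>0: "x \<sigma>0 \<noteq> 0" "arcs \<sigma>0 = l" by (auto simp: Q_def)
  have min: "x \<sigma> = 0" if "arcs \<sigma> < l" for \<sigma>
    using that not_less_Least[of "arcs \<sigma>" Q] unfolding l_def Q_def by blast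
  have xl: "x \<in> layer_ideal l" using x min by (simp add: layer_ideal_def)
  have "\<sigma>0 \<in> perms" using x \<sigma>0 by (auto simp: supported_def)
  then have l: "l \<le> r" "l \<le> s" using arcs_le[of \<sigma>0] \<sigma>0 by auto
  let ?e = "bas (nest l)"
  obtain \<tau> \<sigma>2 where 1: "arcs \<sigma>2 = l" "mul ?e (mul (bas \<tau>) x) \<sigma>2 \<noteq> 0"
    using contract_left[OF gen xl \<sigma>0, of l] by blast
  define u where "u = mul ?e (mul (bas \<tau>) x)"
  have ul: "u \<in> layer_ideal l" unfolding u_def by (intro layer_ideal_mul xl)
  obtain \<tau>' \<sigma>3 where 2: "arcs \<sigma>3 = l" "mul (mul u (bas \<tau>')) ?e \<sigma>3 \<noteq> 0"
    using contract_right[OF gen ul, of \<sigma>2] 1 unfolding u_def by blast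
  define z where "z = mul (mul u (bas \<tau>')) ?e"
  have zl: "z \<in> layer_ideal l" unfolding z_def by (intro layer_ideal_mul ul)
  have zz: "z = mul ?e (mul (mul (bas \<tau>) (mul x (bas \<tau>'))) ?e)" unfolding z_def u_def by (simp only: mul_assoc)
  have "mul (mul z b) z = 0" for b
  proof -
    define p q where "p = mul ?e (bas \<tau>)" and "q = mul (bas \<tau>') ?e"
    have z: "z = mul p (mul x q)" unfolding z_def u_def p_def q_def by (simp only: mul_assoc)
    have "mul (mul z b) z = mul p (mul (mul (mul x (mul q (mul b p))) x) q)" unfolding z by (simp only: mul_assoc)
    then show ?thesis by (simp only: xbx mul_zero)
  qed
  then have J: "mul ?e (mul b z) \<in> layer_ideal (Suc l)" for b
    by (rule contracted_semiprime[OF l char[OF l] zz])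
  obtain \<tau>3 \<sigma>4 where "arcs \<sigma>4 = l" "mul ?e (mul (bas \<tau>3) z) \<sigma>4 \<noteq> 0"
    using contract_left[OF gen zl, of \<sigma>3 l] 2 unfolding z_def by blast
  then show False using J[of "bas \<tau>3"] by (auto simp: layer_ideal_def)
qed

section \<open>Transfer to the ring of diagrams\<close>

definition on_perms :: "(node set set \<Rightarrow> 'k) \<Rightarrow> (nat \<Rightarrow> nat) \<Rightarrow> 'k" where
  "on_perms a = (\<lambda>\<sigma>. if \<sigma> \<in> perms then a (diag \<sigma>) else 0)"

definition from_perms :: "((nat \<Rightarrow> nat) \<Rightarrow> 'k) \<Rightarrow> node set set \<Rightarrow> 'k" where
  "from_perms y = (\<lambda>d. if d \<in> walled_diagrams r s then y (the_inv_into perms diag d) else 0)"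

abbreviation "B \<equiv> walled_brauer r s \<delta>"

lemma on_perms_supported: "on_perms a \<in> supported"
  by (simp add: on_perms_def supported_def)

lemma from_perms_carrier: "from_perms y \<in> carrier B"
  by (simp add: walled_brauer_def from_perms_def)

lemma on_perms_from_perms: "y \<in> supported \<Longrightarrow> on_perms (from_perms y) = y"
  using diag_walled by (auto simp: on_perms_def from_perms_def supported_def fun_eq_iff the_inv_into_f_f[OF inj_diag])

lemma on_perms_inj:
  assumes "a \<in> carrier B" "b \<in> carrier B" "on_perms a = on_perms b"
  shows "a = b"
proof
  fix d
  show "a d = b d"
  proof (cases "d \<in> walled_diagrams r s")
    case True
    then obtain \<sigma> where \<sigma>: "\<sigma> \<in> perms" "d = diag \<sigma>" using diag_surj by blast
    then show ?thesis using fun_cong[OF assms(3), of \<sigma>] by (simp add: on_perms_def)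
  next
    case False
    then show ?thesis using assms(1,2) by (simp add: walled_brauer_def)
  qed
qed

lemma on_perms_add: "on_perms (a \<oplus>\<^bsub>B\<^esub> b) = on_perms a + on_perms b"
  by (simp add: walled_brauer_def on_perms_def fun_eq_iff)

lemma on_perms_zero: "on_perms \<zero>\<^bsub>B\<^esub> = 0"
  by (simp add: walled_brauer_def on_perms_def fun_eq_iff)

lemma on_perms_one: "on_perms \<one>\<^bsub>B\<^esub> = bas id"
proof
  fix \<sigma>
  have "diag \<sigma> = diag id \<longleftrightarrow> \<sigma> = id" if "\<sigma> \<in> perms"
    using inj_diag id_in_perms that by (auto simp: inj_on_def)
  then show "on_perms \<one>\<^bsub>B\<^esub> \<sigma> = bas id \<sigma>"
    using id_in_perms by (auto simp: walled_brauer_def on_perms_def bas_def diag_id[symmetric])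
qed

lemma on_perms_mult:
  shows "on_perms (a \<otimes>\<^bsub>B\<^esub> b) = mul (on_perms a) (on_perms b)"
proof
  fix \<rho>
  show "on_perms (a \<otimes>\<^bsub>B\<^esub> b) \<rho> = mul (on_perms a) (on_perms b) \<rho>"
  proof (cases "\<rho> \<in> perms")
    case False
    then show ?thesis using mul_supported[of "on_perms a" "on_perms b"] by (simp add: on_perms_def supported_def)
  next
    case True
    define S where "S = {(\<sigma>, \<tau>). \<sigma> \<in> perms \<and> \<tau> \<in> perms \<and> star \<sigma> \<tau> = \<rho>}"
    define S' where "S' = {(A, D). A \<in> walled_diagrams r s \<and> D \<in> walled_diagrams r s \<and> concat_diagram A D = diag \<rho>}"
    have eq: "star \<sigma> \<tau> = \<rho> \<longleftrightarrow> concat_diagram (diag \<sigma>) (diag \<tau>) = diag \<rho>" if "\<sigma> \<in> perms" "\<tau> \<in> perms" for \<sigma> \<tau>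
      using diag_star[OF that] star_in_perms[OF that] True inj_diag by (metis inj_on_eq_iff)
    have "bij_betw (\<lambda>(\<sigma>, \<tau>). (diag \<sigma>, diag \<tau>)) S S'"
      unfolding bij_betw_def
    proof
      show "inj_on (\<lambda>(\<sigma>, \<tau>). (diag \<sigma>, diag \<tau>)) S"
        using inj_diag by (auto simp: inj_on_def S_def)
      show "(\<lambda>(\<sigma>, \<tau>). (diag \<sigma>, diag \<tau>)) ` S = S'"
      proof
        show "(\<lambda>(\<sigma>, \<tau>). (diag \<sigma>, diag \<tau>)) ` S \<subseteq> S'"
          using eq diag_walled by (auto simp: S_def S'_def)
        show "S' \<subseteq> (\<lambda>(\<sigma>, \<tau>). (diag \<sigma>, diag \<tau>)) ` S"
        proof
          fix p assume "p \<in> S'"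
          then obtain A D where p: "p = (A, D)" "A \<in> walled_diagrams r s" "D \<in> walled_diagrams r s"
            "concat_diagram A D = diag \<rho>" by (auto simp: S'_def)
          obtain \<sigma> \<tau> where st: "\<sigma> \<in> perms" "A = diag \<sigma>" "\<tau> \<in> perms" "D = diag \<tau>" using diag_surj p by blast
          then have "(\<sigma>, \<tau>) \<in> S" using eq p by (simp add: S_def)
          then show "p \<in> (\<lambda>(\<sigma>, \<tau>). (diag \<sigma>, diag \<tau>)) ` S" using p st by force
        qed
      qed
    qed
    then have "(\<Sum>(A, D)\<in>S'. a A * b D * \<delta> ^ loops A D) = (\<Sum>(\<sigma>, \<tau>)\<in>S. a (diag \<sigma>) * b (diag \<tau>) * \<delta> ^ lp \<sigma> \<tau>)"
      by (subst sum.reindex_bij_betw[symmetric]) (auto simp: lp_def case_prod_beta intro!: sum.cong)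
    also have "\<dots> = (\<Sum>(\<sigma>, \<tau>)\<in>perms \<times> perms. if star \<sigma> \<tau> = \<rho> then on_perms a \<sigma> * on_perms b \<tau> * \<delta> ^ lp \<sigma> \<tau> else 0)"
      by (rule sum.mono_neutral_cong_left) (auto simp: finite_perms S_def on_perms_def split: if_splits)
    also have "\<dots> = mul (on_perms a) (on_perms b) \<rho>"
      unfolding mul_def by (simp add: sum.cartesian_product)
    finally show ?thesis using True by (simp add: on_perms_def walled_brauer_def S'_def)
  qed
qed

lemma mult_carrier: "a \<otimes>\<^bsub>B\<^esub> b \<in> carrier B"
proof -
  have "{(A, D). A \<in> walled_diagrams r s \<and> D \<in> walled_diagrams r s \<and> concat_diagram A D = C} = {}"
    if "C \<notin> walled_diagrams r s" for C
    using that diag_surj concat_walled by blast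
  moreover have "(a \<otimes>\<^bsub>B\<^esub> b) C = (\<Sum>(A, D)\<in>{(A, D). A \<in> walled_diagrams r s \<and> D \<in> walled_diagrams r s \<and>
      concat_diagram A D = C}. a A * b D * \<delta> ^ loops A D)" for C
    by (simp add: walled_brauer_def)
  ultimately have "(a \<otimes>\<^bsub>B\<^esub> b) C = 0" if "C \<notin> walled_diagrams r s" for C
    using that by (metis (no_types, lifting) sum.empty)
  moreover have "x \<in> carrier B \<longleftrightarrow> (\<forall>d. d \<notin> walled_diagrams r s \<longrightarrow> x d = 0)" for x
    by (simp add: walled_brauer_def)
  ultimately show ?thesis by blast
qed

lemma ring_walled_brauer: "ring B"
proof -
  have add: "a \<oplus>\<^bsub>B\<^esub> b \<in> carrier B" if "a \<in> carrier B" "b \<in> carrier B" for a b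
    using that by (simp add: walled_brauer_def)
  have one: "\<one>\<^bsub>B\<^esub> \<in> carrier B"
    using diag_walled[OF id_in_perms] by (auto simp: walled_brauer_def diag_id)
  show ?thesis
  proof (rule ringI)
    show "abelian_group B"
    proof (rule abelian_groupI)
      fix a assume a: "a \<in> carrier B"
      show "\<exists>y\<in>carrier B. y \<oplus>\<^bsub>B\<^esub> a = \<zero>\<^bsub>B\<^esub>"
        using a by (intro bexI[of _ "\<lambda>d. - a d"]) (auto simp: walled_brauer_def)
    qed (simp_all add: walled_brauer_def add_ac)
    show "monoid B"
    proof (rule monoidI)
      show "a \<otimes>\<^bsub>B\<^esub> b \<otimes>\<^bsub>B\<^esub> c = a \<otimes>\<^bsub>B\<^esub> (b \<otimes>\<^bsub>B\<^esub> c)" for a b c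
        by (rule on_perms_inj) (simp_all only: mult_carrier on_perms_mult mul_assoc)
      show "\<one>\<^bsub>B\<^esub> \<otimes>\<^bsub>B\<^esub> a = a" "a \<otimes>\<^bsub>B\<^esub> \<one>\<^bsub>B\<^esub> = a" if "a \<in> carrier B" for a
        by (rule on_perms_inj; simp only: mult_carrier on_perms_mult on_perms_one mul_one[OF on_perms_supported] that)+
    qed (simp_all only: mult_carrier one)
    show "(a \<oplus>\<^bsub>B\<^esub> b) \<otimes>\<^bsub>B\<^esub> c = a \<otimes>\<^bsub>B\<^esub> c \<oplus>\<^bsub>B\<^esub> b \<otimes>\<^bsub>B\<^esub> c" for a b c
      by (rule on_perms_inj) (simp_all only: mult_carrier add on_perms_mult on_perms_add mul_add_left)
    show "c \<otimes>\<^bsub>B\<^esub> (a \<oplus>\<^bsub>B\<^esub> b) = c \<otimes>\<^bsub>B\<^esub> a \<oplus>\<^bsub>B\<^esub> c \<otimes>\<^bsub>B\<^esub> b" for a b c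
      by (rule on_perms_inj) (simp_all only: mult_carrier add on_perms_mult on_perms_add mul_add_right)
  qed
qed

lemma finite_walled_diagrams: "finite (walled_diagrams r s)"
  using bij_diag finite_perms bij_betw_finite by blast

text \<open>Scalars act through multiples of the unit, so left ideals are subspaces and the
  dimension serves as the measure in \<open>semiprime_imp_semisimple\<close>.\<close>

lemma semisimpleI:
  assumes "\<And>x. x \<in> supported \<Longrightarrow> (\<And>b. mul (mul x b) x = 0) \<Longrightarrow> x = 0"
  shows "semisimple_ring B"
proof -
  obtain \<mu> :: "(node set set \<Rightarrow> 'k) set \<Rightarrow> nat" where
    \<mu>: "\<forall>I J. 0 \<in> I \<longrightarrow> (\<forall>x\<in>I. \<forall>y\<in>I. x + y \<in> I) \<longrightarrow> (\<forall>c. \<forall>x\<in>I. (\<lambda>i. c * x i) \<in> I) \<longrightarrow>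
      J \<subseteq> {f. \<forall>x. x \<notin> walled_diagrams r s \<longrightarrow> f x = 0} \<longrightarrow> I \<subset> J \<longrightarrow> \<mu> I < \<mu> J"
    using subspace_measure_exists[OF finite_walled_diagrams] by blast
  show ?thesis
  proof (rule semiprime_imp_semisimple[OF ring_walled_brauer])
    fix I J assume I: "left_ideal B I" and J: "left_ideal B J" and IJ: "I \<subset> J"
    note I' = left_idealD[OF ring_walled_brauer I]
    have "(\<lambda>i. c * x i) \<in> I" if x: "x \<in> I" for c x
    proof -
      have xB: "x \<in> carrier B" using x I'(1) by blast
      have cx: "on_perms (\<lambda>i. c * x i) = scal c (on_perms x)" by (simp add: on_perms_def scal_def fun_eq_iff)
      have "(\<lambda>i. c * x i) = from_perms (scal c (bas id)) \<otimes>\<^bsub>B\<^esub> x"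
      proof (rule on_perms_inj)
        show "(\<lambda>i. c * x i) \<in> carrier B" using xB by (simp add: walled_brauer_def)
        have "scal c (bas id) \<in> supported" using bas_supported[OF id_in_perms] by (simp add: supported_def scal_def)
        then show "on_perms (\<lambda>i. c * x i) = on_perms (from_perms (scal c (bas id)) \<otimes>\<^bsub>B\<^esub> x)"
          by (simp only: cx on_perms_mult on_perms_from_perms mul_scal mul_one[OF on_perms_supported])
      qed (rule mult_carrier)
      then show ?thesis using I'(5)[OF from_perms_carrier x] by simp
    qed
    moreover have "0 \<in> I" using I'(2) by (simp add: walled_brauer_def zero_fun_def)
    moreover have "x + y \<in> I" if "x \<in> I" "y \<in> I" for x y
      using I'(3)[OF that] by (simp add: walled_brauer_def plus_fun_def)
    moreover have "J \<subseteq> {f. \<forall>x. x \<notin> walled_diagrams r s \<longrightarrow> f x = 0}"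
      using left_idealD(1)[OF ring_walled_brauer J] by (simp add: walled_brauer_def)
    ultimately show "\<mu> I < \<mu> J" using \<mu> IJ by simp
  next
    fix x assume x: "x \<in> carrier B" "x \<noteq> \<zero>\<^bsub>B\<^esub>"
    show "\<exists>b\<in>carrier B. x \<otimes>\<^bsub>B\<^esub> b \<otimes>\<^bsub>B\<^esub> x \<noteq> \<zero>\<^bsub>B\<^esub>"
    proof (rule ccontr)
      assume A: "\<not> ?thesis"
      have "mul (mul (on_perms x) b) (on_perms x) = 0" for b
      proof -
        \<comment> \<open>The product reads only values at permutations, so b may be cut down to an
          element of the algebra.\<close>
        define b' where "b' = (\<lambda>\<sigma>. if \<sigma> \<in> perms then b \<sigma> else 0)"
        have b': "b' \<in> supported" by (simp add: b'_def supported_def)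
        have "mul (on_perms x) b = mul (on_perms x) b'"
          unfolding mul_def b'_def by (intro ext sum.cong refl) simp
        moreover have "x \<otimes>\<^bsub>B\<^esub> from_perms b' \<otimes>\<^bsub>B\<^esub> x = \<zero>\<^bsub>B\<^esub>" using A from_perms_carrier by blast
        then have "mul (mul (on_perms x) b') (on_perms x) = 0"
          using on_perms_zero on_perms_mult on_perms_from_perms[OF b'] by metis
        ultimately show ?thesis by simp
      qed
      then have "on_perms x = 0" by (rule assms[OF on_perms_supported])
      then have "x = \<zero>\<^bsub>B\<^esub>"
        by (intro on_perms_inj x) (simp_all only: on_perms_zero, simp add: walled_brauer_def)
      with x show False by simp
    qed
  qed
qed

text \<open>\<open>semisimple_imp_semiprime_mod\<close> for the ideal of diagrams with at least m
  arcs: nilpotency need only be checked modulo that ideal.\<close>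

lemma semisimpleD:
  assumes ss: "semisimple_ring B" and y: "y \<in> supported"
    and yby: "\<And>b. b \<in> supported \<Longrightarrow> mul (mul y b) y \<in> layer_ideal m"
  shows "y \<in> layer_ideal m"
proof -
  define J where "J = {a \<in> carrier B. on_perms a \<in> layer_ideal m}"
  note R = ring_walled_brauer
  interpret R: ring B by (rule R)
  have lJ: "left_ideal B J"
  proof (rule left_idealI[OF R])
    show "\<zero>\<^bsub>B\<^esub> \<in> J" using on_perms_zero layer_ideal_closed(4) by (simp add: J_def)
    show "a \<oplus>\<^bsub>B\<^esub> b \<in> J" if "a \<in> J" "b \<in> J" for a b
      using that layer_ideal_closed(1) by (simp add: J_def on_perms_add)
    show "a \<otimes>\<^bsub>B\<^esub> x \<in> J" if "a \<in> carrier B" "x \<in> J" for a x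
      using that layer_ideal_mul(2) mult_carrier by (simp add: J_def on_perms_mult)
  qed (auto simp: J_def)
  have "ideal J B"
  proof (rule idealI[OF R])
    show "subgroup J (add_monoid B)" using lJ by (simp add: left_ideal_def additive_subgroup_def)
    show "x \<otimes>\<^bsub>B\<^esub> a \<in> J" if "a \<in> J" "x \<in> carrier B" for a x
      using lJ that by (simp add: left_ideal_def)
    show "a \<otimes>\<^bsub>B\<^esub> x \<in> J" if "a \<in> J" "x \<in> carrier B" for a x
      using that layer_ideal_mul(1) mult_carrier by (simp add: J_def on_perms_mult)
  qed
  then have "from_perms y \<in> J"
  proof (rule semisimple_imp_semiprime_mod[OF R ss _ from_perms_carrier])
    fix b assume "b \<in> carrier B"
    show "from_perms y \<otimes>\<^bsub>B\<^esub> b \<otimes>\<^bsub>B\<^esub> from_perms y \<in> J"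
      using yby[OF on_perms_supported] mult_carrier by (simp add: J_def on_perms_mult on_perms_from_perms[OF y])
  qed
  then show ?thesis by (simp add: J_def on_perms_from_perms[OF y])
qed

end

section \<open>Eigenvectors of Jucys-Murphy elements\<close>

text \<open>The Jucys-Murphy element with centre \<open>z\<close> acts on functions of permutations by translation.\<close>

definition jm_eigen :: "nat set \<Rightarrow> nat \<Rightarrow> int \<Rightarrow> ((nat \<Rightarrow> nat) \<Rightarrow> 'k::field) \<Rightarrow> bool" where
  "jm_eigen S z c f \<longleftrightarrow> (\<forall>\<pi>. \<pi> permutes S \<longrightarrow> (\<Sum>v\<in>S - {z}. f (transpose v z \<circ> \<pi>)) = of_int c * f \<pi>) \<and>
    (\<exists>\<pi>. \<pi> permutes S \<and> f \<pi> \<noteq> 0)"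

lemma transpose_comp_perm:
  assumes "\<pi> permutes S"
  shows "transpose v z \<circ> \<pi> = \<pi> \<circ> transpose (pinv \<pi> v) (pinv \<pi> z)"
  using permutes_inverses[OF assms] permutes_inj[OF assms] by (auto simp: fun_eq_iff transpose_def inj_eq)

text \<open>The antisymmetriser of \<open>c + 1\<close> points containing \<open>z\<close> belongs to a column whose last box has content \<open>-c\<close>.\<close>

lemma jm_eigen_negative:
  assumes S: "finite S" "z \<in> S" and c: "1 \<le> c" "c < card S" and two: "(2 :: 'k::field) \<noteq> 0"
  shows "\<exists>f :: (nat \<Rightarrow> nat) \<Rightarrow> 'k. jm_eigen S z (- int c) f"
proof -
  have "c \<le> card (S - {z})" using c S by simp
  then obtain T where T: "T \<subseteq> S - {z}" "card T = c" "finite T" by (rule obtain_subset_with_card_n)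
  define K where "K = insert z T"
  have K: "K \<subseteq> S" "finite K" "card K = Suc c" "z \<in> K" using T S by (auto simp: K_def card_insert_if)
  have "T \<noteq> {}" using T c by auto
  then obtain p where "p \<in> T" by blast
  then have p: "p \<in> K" "p \<noteq> z" using T by (auto simp: K_def)
  \<comment> \<open>The condition leaves p free. If z is the image of a point outside K, the sum
    over K loses the condition at z as well and becomes symmetric in z and p, so that antisymmetry
    makes it vanish.\<close>
  define g where "g \<pi> \<rho> \<longleftrightarrow> (\<forall>t\<in>K - {p}. \<pi> (\<rho> t) = t)" for \<pi> \<rho> :: "nat \<Rightarrow> nat"
  define f where "f \<pi> = (\<Sum>\<rho> | \<rho> permutes K. of_int (sign \<rho>) * (if g \<pi> \<rho> then 1 else 0 :: 'k))" for \<pi>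
  have perm: "permutation \<rho>" if "\<rho> permutes K" for \<rho> using that K(2) permutation_permutes by blast
  have alt: "f (\<pi> \<circ> \<kappa>) = of_int (sign \<kappa>) * f \<pi>" if \<kappa>: "\<kappa> permutes K" for \<pi> \<kappa>
  proof -
    have ss: "of_int (sign \<kappa>) * of_int (sign (\<kappa> \<circ> \<rho>)) = (of_int (sign \<rho>) :: 'k)" if "\<rho> permutes K" for \<rho>
    proof -
      have "sign \<kappa> * sign (\<kappa> \<circ> \<rho>) = sign \<rho>"
        using sign_compose[OF perm[OF \<kappa>] perm[OF that]] by (simp add: sign_def)
      then show ?thesis by (metis of_int_mult)
    qed
    have "f \<pi> = (\<Sum>\<rho> | \<rho> permutes K. of_int (sign (\<kappa> \<circ> \<rho>)) * (if g \<pi> (\<kappa> \<circ> \<rho>) then 1 else 0))"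
      unfolding f_def by (rule setum_permutations_compose_left[OF \<kappa>])
    then have "of_int (sign \<kappa>) * f \<pi> =
        of_int (sign \<kappa>) * (\<Sum>\<rho> | \<rho> permutes K. of_int (sign (\<kappa> \<circ> \<rho>)) * (if g \<pi> (\<kappa> \<circ> \<rho>) then 1 else 0))"
      by (rule arg_cong)
    also have "\<dots> = f (\<pi> \<circ> \<kappa>)"
      unfolding f_def sum_distrib_left mult.assoc[symmetric]
      by (intro sum.cong refl) (simp add: ss g_def)
    finally show ?thesis by simp
  qed
  have van: "f \<pi> = 0" if "u \<notin> K" "\<pi> u = z" "inj \<pi>" for \<pi> u
  proof -
    have "\<not> g \<pi> \<rho>" if \<rho>: "\<rho> permutes K" for \<rho>
    proof
      assume "g \<pi> \<rho>"
      then have "\<pi> (\<rho> z) = z" using K p by (auto simp: g_def)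
      then have "\<rho> z = u" using \<open>\<pi> u = z\<close> \<open>inj \<pi>\<close> by (metis inj_eq)
      then show False using permutes_in_image[OF \<rho>, of z] K \<open>u \<notin> K\<close> by simp
    qed
    then show ?thesis unfolding f_def by (intro sum.neutral) simp
  qed
  have eig: "(\<Sum>v\<in>S - {z}. f (transpose v z \<circ> \<pi>)) = of_int (- int c) * f \<pi>" if \<pi>: "\<pi> permutes S" for \<pi>
  proof -
    define u where "u = pinv \<pi> z"
    have u: "u \<in> S" "\<pi> u = z" unfolding u_def
      using permutes_in_image[OF permutes_inv[OF \<pi>]] permutes_inverses[OF \<pi>] S by auto
    have inj: "inj \<pi>" by (rule permutes_inj[OF \<pi>])
    have injt: "inj (\<pi> \<circ> transpose q u)" for q using inj by (intro inj_compose) auto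
    have "(\<Sum>v\<in>S - {z}. f (transpose v z \<circ> \<pi>)) = (\<Sum>q\<in>S - {u}. f (\<pi> \<circ> transpose q u))"
    proof (rule sum.reindex_bij_witness[where j = "pinv \<pi>" and i = \<pi>])
      fix v assume v: "v \<in> S - {z}"
      show "\<pi> (pinv \<pi> v) = v" using permutes_inverses[OF \<pi>] by simp
      show "pinv \<pi> v \<in> S - {u}" using v permutes_in_image[OF permutes_inv[OF \<pi>], of v] permutes_inverses[OF \<pi>] u by auto
      show "f (\<pi> \<circ> transpose (pinv \<pi> v) u) = f (transpose v z \<circ> \<pi>)"
        unfolding transpose_comp_perm[OF \<pi>] u_def ..
    next
      fix q assume q: "q \<in> S - {u}"
      show "pinv \<pi> (\<pi> q) = q" using permutes_inverses[OF \<pi>] by simp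
      show "\<pi> q \<in> S - {z}" using q permutes_in_image[OF \<pi>, of q] inj u by (auto simp: inj_eq)
    qed
    \<comment> \<open>A transposition with a point outside K moves the preimage of z out of K, where
      f vanishes.\<close>
    also have "\<dots> = (\<Sum>q\<in>K - {u}. f (\<pi> \<circ> transpose q u))"
    proof (rule sum.mono_neutral_right)
      show "\<forall>q\<in>S - {u} - (K - {u}). f (\<pi> \<circ> transpose q u) = 0"
      proof
        fix q assume "q \<in> S - {u} - (K - {u})"
        then show "f (\<pi> \<circ> transpose q u) = 0" by (intro van[of q, OF _ _ injt]) (use u in auto)
      qed
    qed (use S K in auto)
    also have "\<dots> = of_int (- int c) * f \<pi>"
    proof (cases "u \<in> K")
      case True
      \<comment> \<open>By antisymmetry each of the c transpositions contributes -1.\<close>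
      have "f (\<pi> \<circ> transpose q u) = - f \<pi>" if "q \<in> K - {u}" for q
        using alt[of "transpose q u" \<pi>] permutes_swap_id[of q K u] that True by (simp add: sign_swap_id)
      then have "(\<Sum>q\<in>K - {u}. f (\<pi> \<circ> transpose q u)) = (\<Sum>q\<in>K - {u}. - f \<pi>)" by (rule sum.cong[OF refl])
      also have "\<dots> = of_int (- int c) * f \<pi>" using True K by simp
      finally show ?thesis .
    next
      case False
      define h where "h \<rho> \<longleftrightarrow> (\<forall>t\<in>K - {p, z}. \<pi> (\<rho> t) = t)" for \<rho> :: "nat \<Rightarrow> nat"
      define \<tau> where "\<tau> = transpose z p"
      have \<tau>: "\<tau> permutes K" unfolding \<tau>_def using K p by (intro permutes_swap_id) auto
      \<comment> \<open>The condition at z singles out one q for each \<open>\<rho>\<close>.\<close>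
      have gh: "g (\<pi> \<circ> transpose q u) \<rho> \<longleftrightarrow> q = \<rho> z \<and> h \<rho>" if \<rho>: "\<rho> permutes K" for q \<rho>
      proof -
        have \<rho>K: "\<rho> t \<in> K" if "t \<in> K" for t using permutes_in_image[OF \<rho>] that by simp
        have \<rho>u: "\<rho> t \<noteq> u" if "t \<in> K" for t using \<rho>K[OF that] False by auto
        have \<rho>i: "\<rho> t = \<rho> t' \<longleftrightarrow> t = t'" for t t' using permutes_inj[OF \<rho>] by (simp add: inj_eq)
        have z: "\<pi> (transpose q u (\<rho> z)) = z \<longleftrightarrow> q = \<rho> z"
        proof -
          have "\<pi> (transpose q u (\<rho> z)) = z \<longleftrightarrow> transpose q u (\<rho> z) = u" using u(2) inj by (metis inj_eq)
          also have "\<dots> \<longleftrightarrow> q = \<rho> z" using \<rho>u[OF K(4)] by (auto simp: transpose_def)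
          finally show ?thesis .
        qed
        have t: "\<pi> (transpose (\<rho> z) u (\<rho> t)) = \<pi> (\<rho> t)" if "t \<in> K" "t \<noteq> z" for t
          using \<rho>u[OF that(1)] \<rho>i[of t z] that by (simp add: transpose_def)
        have Kp: "K - {p} = insert z (K - {p, z})" using K p by auto
        have "g (\<pi> \<circ> transpose q u) \<rho> \<longleftrightarrow> q = \<rho> z \<and> (\<forall>t\<in>K - {p, z}. \<pi> (transpose q u (\<rho> t)) = t)"
          unfolding g_def Kp ball_simps comp_apply z ..
        also have "\<dots> \<longleftrightarrow> q = \<rho> z \<and> h \<rho>"
        proof (cases "q = \<rho> z")
          case True
          have "(\<forall>t\<in>K - {p, z}. \<pi> (transpose (\<rho> z) u (\<rho> t)) = t) \<longleftrightarrow> (\<forall>t\<in>K - {p, z}. \<pi> (\<rho> t) = t)"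
            by (intro ball_cong refl) (simp add: t)
          then show ?thesis unfolding h_def True by blast
        qed simp
        finally show ?thesis .
      qed
      have KK: "K - {u} = K" using False by simp
      have "(\<Sum>q\<in>K - {u}. f (\<pi> \<circ> transpose q u)) =
          (\<Sum>\<rho> | \<rho> permutes K. \<Sum>q\<in>K. of_int (sign \<rho>) * (if g (\<pi> \<circ> transpose q u) \<rho> then 1 else 0))"
        unfolding f_def KK by (rule sum.swap)
      also have "\<dots> = (\<Sum>\<rho> | \<rho> permutes K. of_int (sign \<rho>) * (if h \<rho> then 1 else 0))"
      proof (intro sum.cong refl)
        fix \<rho> assume "\<rho> \<in> {\<rho>. \<rho> permutes K}"
        then have \<rho>: "\<rho> permutes K" by simp
        have "(\<Sum>q\<in>K. of_int (sign \<rho>) * (if g (\<pi> \<circ> transpose q u) \<rho> then 1 else 0 :: 'k)) =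
            (\<Sum>q\<in>K. if q = \<rho> z then of_int (sign \<rho>) * (if h \<rho> then 1 else 0) else 0)"
          by (intro sum.cong refl) (simp add: gh[OF \<rho>])
        then show "(\<Sum>q\<in>K. of_int (sign \<rho>) * (if g (\<pi> \<circ> transpose q u) \<rho> then 1 else 0 :: 'k)) =
            of_int (sign \<rho>) * (if h \<rho> then 1 else 0)"
          using permutes_in_image[OF \<rho>, of z] K by simp
      qed
      also have "\<dots> = 0"
      proof -
        define A where "A = (\<Sum>\<rho> | \<rho> permutes K. of_int (sign \<rho>) * (if h \<rho> then 1 else 0 :: 'k))"
        have "A = (\<Sum>\<rho> | \<rho> permutes K. of_int (sign (\<rho> \<circ> \<tau>)) * (if h (\<rho> \<circ> \<tau>) then 1 else 0))"
          unfolding A_def by (rule sum_permutations_compose_right[OF \<tau>])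
        also have "\<dots> = (\<Sum>\<rho> | \<rho> permutes K. - (of_int (sign \<rho>) * (if h \<rho> then 1 else 0)))"
        proof (intro sum.cong refl)
          fix \<rho> assume "\<rho> \<in> {\<rho>. \<rho> permutes K}"
          then have "sign (\<rho> \<circ> \<tau>) = - sign \<rho>"
            using sign_compose[OF perm perm[OF \<tau>], of \<rho>] p by (simp add: \<tau>_def sign_swap_id)
          moreover have "h (\<rho> \<circ> \<tau>) \<longleftrightarrow> h \<rho>" unfolding h_def \<tau>_def by (auto simp: transpose_def)
          ultimately show "of_int (sign (\<rho> \<circ> \<tau>)) * (if h (\<rho> \<circ> \<tau>) then 1 else 0 :: 'k) = - (of_int (sign \<rho>) * (if h \<rho> then 1 else 0))"
            by simp
        qed
        also have "\<dots> = - A" unfolding A_def by (rule sum_negf)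
        finally have "A + A = A + - A" by (rule arg_cong)
        then have "2 * A = 0" unfolding mult_2 by (simp only: add.right_inverse)
        then show ?thesis using two unfolding A_def by simp
      qed
      also have "f \<pi> = 0" by (rule van[OF False u(2) inj])
      then have "0 = of_int (- int c) * f \<pi>" by simp
      finally show ?thesis .
    qed
    finally show ?thesis .
  qed
  have "f id = 1"
  proof -
    have gid: "g id \<rho> \<longleftrightarrow> \<rho> = id" if \<rho>: "\<rho> permutes K" for \<rho>
    proof
      assume "g id \<rho>"
      then have "\<rho> permutes {p}" using permutes_superset[OF \<rho>, of "{p}"] by (auto simp: g_def)
      then show "\<rho> = id" by simp
    qed (simp add: g_def)
    have "f id = (\<Sum>\<rho> | \<rho> permutes K. if \<rho> = id then 1 else 0)"
      unfolding f_def by (intro sum.cong refl) (simp add: gid)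
    then show ?thesis using finite_permutations[OF K(2)] permutes_id by simp
  qed
  then have "id permutes S \<and> f id \<noteq> 0" by (simp add: permutes_id)
  then have "jm_eigen S z (- int c) f" unfolding jm_eigen_def using eig by blast
  then show ?thesis by blast
qed

text \<open>Twisting by the sign transposes partitions, and a transposed box has the negative
  content.\<close>

lemma jm_eigen_sign:
  assumes S: "finite S" "z \<in> S" and f: "jm_eigen S z c f"
  shows "jm_eigen S z (- c) (\<lambda>\<pi>. of_int (sign \<pi>) * f \<pi>)"
proof -
  have perm: "permutation \<pi>" if "\<pi> permutes S" for \<pi> using that S(1) permutation_permutes by blast
  have sum: "(\<Sum>v\<in>S - {z}. of_int (sign (transpose v z \<circ> \<pi>)) * f (transpose v z \<circ> \<pi>)) = of_int (- c) * (of_int (sign \<pi>) * f \<pi>)"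
    if \<pi>: "\<pi> permutes S" for \<pi>
  proof -
    have "sign (transpose v z \<circ> \<pi>) = - sign \<pi>" if "v \<in> S - {z}" for v
      using sign_compose[OF permutation_swap_id perm[OF \<pi>], of v z] that by (simp add: sign_swap_id)
    then have "(\<Sum>v\<in>S - {z}. of_int (sign (transpose v z \<circ> \<pi>)) * f (transpose v z \<circ> \<pi>)) =
        - of_int (sign \<pi>) * (\<Sum>v\<in>S - {z}. f (transpose v z \<circ> \<pi>))"
      unfolding sum_distrib_left by (intro sum.cong refl) simp
    then show ?thesis using f \<pi> by (simp add: jm_eigen_def)
  qed
  obtain \<pi> where "\<pi> permutes S" "f \<pi> \<noteq> 0" using f by (auto simp: jm_eigen_def)
  moreover have "of_int (sign \<pi>) \<noteq> (0 :: 'a)" by (simp add: sign_def)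
  ultimately have "\<pi> permutes S \<and> of_int (sign \<pi>) * f \<pi> \<noteq> 0" by simp
  then show ?thesis unfolding jm_eigen_def using sum by blast
qed

text \<open>For at least four points, the content zero is that of the second box on the diagonal of the
  shape \<open>(n - 2, 2)\<close>; \<open>w\<close> is an eigenvector in the permutation module on unordered pairs.\<close>

lemma jm_eigen_zero:
  assumes S: "finite S" "z \<in> S" and card: "card S = 1 \<or> card S \<ge> 4"
  shows "\<exists>f :: (nat \<Rightarrow> nat) \<Rightarrow> 'k::field. jm_eigen S z 0 f"
proof (cases "card S = 1")
  case True
  then have "S = {z}" using S by (auto simp: card_1_singleton_iff)
  then have "jm_eigen S z 0 (\<lambda>_. 1 :: 'k)" using permutes_id by (auto simp: jm_eigen_def)
  then show ?thesis by blast
next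
  case False
  then have c4: "card S \<ge> 4" using card by simp
  then have "3 \<le> card (S - {z})" using S by simp
  then obtain T where T: "T \<subseteq> S - {z}" "card T = 3" by (rule obtain_subset_with_card_n)
  then obtain a b d where abd: "T = {a, b, d}" "a \<noteq> b" "b \<noteq> d" "a \<noteq> d" by (auto simp: card_3_iff)
  have abdS: "a \<in> S - {z}" "b \<in> S - {z}" "d \<in> S - {z}" using T abd by auto
  define m where "m = (of_nat (card S) :: 'k)"
  \<comment> \<open>A weight of total 0 on the points other than z.\<close>
  define \<phi> where "\<phi> x = (if x = a then 1 else if x = b then - 1 else 0 :: 'k)" for x
  \<comment> \<open>With m points, the factor 3 - m on pairs containing z is the one for which the
    sums over v cancel in both cases below.\<close>
  define w where "w x y = (if x = z then (3 - m) * \<phi> y else if y = z then (3 - m) * \<phi> x else \<phi> x + \<phi> y)" for x y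
  have \<phi>S: "(\<Sum>v\<in>S - {z}. \<phi> v) = 0"
  proof -
    have "(\<Sum>v\<in>S - {z}. \<phi> v) = (\<Sum>v\<in>{a, b}. \<phi> v)"
      by (rule sum.mono_neutral_right) (use S abdS in \<open>auto simp: \<phi>_def\<close>)
    then show ?thesis using abd by (simp add: \<phi>_def)
  qed
  have wsym: "w x y = w y x" if "x \<noteq> y" for x y using that by (simp add: w_def add.commute)
  have case1: "(\<Sum>v\<in>S - {z}. w (transpose v z z) (transpose v z y)) = 0" if y: "y \<in> S" "y \<noteq> z" for y
  proof -
    have "(\<Sum>v\<in>S - {z}. w (transpose v z z) (transpose v z y)) =
        w y z + (\<Sum>v\<in>S - {z} - {y}. w (transpose v z z) (transpose v z y))"
      using S y by (subst sum.remove[of _ y]) auto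
    also have "(\<Sum>v\<in>S - {z} - {y}. w (transpose v z z) (transpose v z y)) = (\<Sum>v\<in>S - {z} - {y}. \<phi> v + \<phi> y)"
      using y by (intro sum.cong refl) (auto simp: w_def transpose_def)
    also have "\<dots> = (\<Sum>v\<in>S - {z} - {y}. \<phi> v) + of_nat (card (S - {z} - {y})) * \<phi> y" by (simp add: sum.distrib)
    also have "(\<Sum>v\<in>S - {z} - {y}. \<phi> v) = - \<phi> y" using sum.remove[of "S - {z}" y \<phi>] S y \<phi>S by (simp add: eq_neg_iff_add_eq_0 add.commute)
    also have "of_nat (card (S - {z} - {y})) = m - 2"
    proof -
      have "card (S - {z} - {y}) + 2 = card S" using S y c4 by simp
      then have "of_nat (card (S - {z} - {y})) + 2 = m" unfolding m_def by (metis of_nat_add of_nat_numeral)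
      then show ?thesis by (simp add: eq_diff_eq)
    qed
    also have "w y z + (- \<phi> y + (m - 2) * \<phi> y) = 0" using y by (simp add: w_def algebra_simps)
    finally show ?thesis .
  qed
  have case2: "(\<Sum>v\<in>S - {z}. w (transpose v z x) (transpose v z y)) = 0" if xy: "x \<in> S" "y \<in> S" "x \<noteq> z" "y \<noteq> z" "x \<noteq> y" for x y
  proof -
    have "(\<Sum>v\<in>S - {z}. w (transpose v z x) (transpose v z y)) =
        w z y + (w x z + (\<Sum>v\<in>S - {z} - {x} - {y}. w (transpose v z x) (transpose v z y)))"
      using S xy by (subst sum.remove[of _ x], simp, simp, subst sum.remove[of _ y]) auto
    also have "(\<Sum>v\<in>S - {z} - {x} - {y}. w (transpose v z x) (transpose v z y)) = (\<Sum>v\<in>S - {z} - {x} - {y}. w x y)"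
      using xy by (intro sum.cong refl) (auto simp: transpose_def)
    also have "\<dots> = (m - 3) * w x y"
    proof -
      have "card (S - {z} - {x} - {y}) + 3 = card S" using S xy c4 by simp
      then have "of_nat (card (S - {z} - {x} - {y})) + 3 = m" unfolding m_def by (metis of_nat_add of_nat_numeral)
      then show ?thesis by (simp add: eq_diff_eq[symmetric])
    qed
    also have "w z y + (w x z + (m - 3) * w x y) = 0" using xy by (simp add: w_def algebra_simps)
    finally show ?thesis .
  qed
  \<comment> \<open>The point d has weight 0, so the value at the identity is that of the weight at
    a, which is 1.\<close>
  define f where "f \<pi> = w (\<pi> a) (\<pi> d)" for \<pi> :: "nat \<Rightarrow> nat"
  have "(\<Sum>v\<in>S - {z}. f (transpose v z \<circ> \<pi>)) = of_int 0 * f \<pi>" if \<pi>: "\<pi> permutes S" for \<pi>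
  proof -
    have xy: "\<pi> a \<in> S" "\<pi> d \<in> S" "\<pi> a \<noteq> \<pi> d"
      using permutes_in_image[OF \<pi>] permutes_inj[OF \<pi>] abdS abd by (auto simp: inj_eq)
    consider "\<pi> a = z" | "\<pi> d = z" | "\<pi> a \<noteq> z" "\<pi> d \<noteq> z" by blast
    then have "(\<Sum>v\<in>S - {z}. w (transpose v z (\<pi> a)) (transpose v z (\<pi> d))) = 0"
    proof cases
      case 1
      then show ?thesis using case1[of "\<pi> d"] xy by auto
    next
      case 2
      have "(\<Sum>v\<in>S - {z}. w (transpose v z (\<pi> a)) (transpose v z (\<pi> d))) = (\<Sum>v\<in>S - {z}. w (transpose v z (\<pi> d)) (transpose v z (\<pi> a)))"
        using xy by (intro sum.cong refl wsym) (metis transpose_involutory)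
      then show ?thesis using case1[of "\<pi> a"] xy 2 by auto
    qed (use case2 xy in auto)
    then show ?thesis by (simp add: f_def)
  qed
  moreover have "f id \<noteq> 0" using abdS abd by (simp add: f_def w_def \<phi>_def)
  ultimately have "jm_eigen S z 0 f" unfolding jm_eigen_def using permutes_id by blast
  then show ?thesis by blast
qed

context walled_algebra
begin

section \<open>Nilpotent ideals\<close>

lemma arcs_eq_0_iff:
  assumes "\<sigma> \<in> perms"
  shows "arcs \<sigma> = 0 \<longleftrightarrow> \<sigma> \<in> wall_perms"
proof
  assume 0: "arcs \<sigma> = 0"
  have fin: "finite {i \<in> labels. Q i}" for Q by simp
  have "{i \<in> labels. i \<le> r \<and> \<sigma> i > r} = {}"
    using 0 unfolding arcs_def card_0_eq[OF fin] .
  moreover have "{j \<in> labels. j > r \<and> \<sigma> j \<le> r} = {}"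
    using 0 unfolding arcs_right[OF assms, symmetric] card_0_eq[OF fin] .
  ultimately have "\<sigma> i \<le> r \<longleftrightarrow> i \<le> r" if "i \<in> labels" for i
    using that not_le unfolding Collect_empty_eq by blast
  then show "\<sigma> \<in> wall_perms" using assms by (simp add: wall_perms_def)
next
  assume \<sigma>: "\<sigma> \<in> wall_perms"
  have "\<not> \<sigma> i > r" if "i \<le> r" for i using wall_permsD(2)[OF \<sigma>, of i] that by simp
  then have "{i \<in> labels. i \<le> r \<and> \<sigma> i > r} = {}" by simp
  then show "arcs \<sigma> = 0" unfolding arcs_def by (simp only: card.empty)
qed

lemma layer_ideal_sum: "(\<And>i. i \<in> I \<Longrightarrow> f i \<in> layer_ideal m) \<Longrightarrow> (\<Sum>i\<in>I. f i) \<in> layer_ideal m"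
proof (induction I rule: infinite_finite_induct)
  case (insert x F)
  then show ?case by (simp only: sum.insert layer_ideal_closed(1) insert_iff simp_thms not_False_eq_True)
qed (simp_all only: sum.infinite sum.empty layer_ideal_closed(4) not_False_eq_True)

lemma mul_expand_left:
  assumes "a \<in> supported"
  shows "mul a x = (\<Sum>\<sigma>\<in>perms. scal (a \<sigma>) (mul (bas \<sigma>) x))"
proof -
  have "mul a x = mul (\<Sum>\<sigma>\<in>perms. scal (a \<sigma>) (bas \<sigma>)) x"
    by (rule arg_cong[where f = "\<lambda>z. mul z x", OF supported_expand[OF assms]])
  then show ?thesis unfolding mul_sum_left mul_scal .
qed

lemma nest_fix_0: "nest_fix 0 = wall_perms"
  by (auto simp: nest_fix_def)

lemma finite_wall_perms: "finite wall_perms"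
  using finite_nest_fix[of 0] by (simp add: nest_fix_0)

text \<open>Permutation diagrams fix their sum \<open>x\<close>, so \<open>x x\<close> is \<open>x\<close> times the number of terms, which is zero here.\<close>

lemma not_semisimple_card_zero:
  assumes card: "(of_nat (card wall_perms) :: 'k) = 0"
  shows "\<not> semisimple_ring B"
proof
  assume ss: "semisimple_ring B"
  define x where "x = (\<Sum>h\<in>wall_perms. bas h)"
  have xW: "x \<sigma> = (if \<sigma> \<in> wall_perms then 1 else 0)" for \<sigma>
    unfolding x_def sum_apply bas_def by (rule sum.delta'[OF finite_wall_perms])
  have xs: "x \<in> supported" using wall_permsD(1) by (simp add: supported_def xW)
  have xid: "x id = 1" using id_wall_perms by (simp only: xW if_True)
  have gx: "mul (bas g) x = x" if g: "g \<in> wall_perms" for g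
  proof -
    note g' = nest_fix_pinv[of g 0, unfolded nest_fix_0, OF g]
    have "mul (bas g) x = (\<Sum>h\<in>wall_perms. bas (star g h))"
      unfolding x_def mul_sum_right by (intro sum.cong refl star_wall_wall(2) g)
    also have "\<dots> = x" unfolding x_def
    proof (rule sum.reindex_bij_witness[where i = "star (pinv g)" and j = "star g"])
      fix h assume h: "h \<in> wall_perms"
      note p = wall_permsD(1)[OF h] wall_permsD(1)[OF g] wall_permsD(1)[OF g'(1)]
      show "star (pinv g) (star g h) = h" unfolding star_assoc[OF p(3,2,1), symmetric] g'(3) by (rule star_id(1)[OF p(1)])
      show "star g (star (pinv g) h) = h" unfolding star_assoc[OF p(2,3,1), symmetric] g'(2) by (rule star_id(1)[OF p(1)])
      show "star g h \<in> wall_perms" "star (pinv g) h \<in> wall_perms" using star_wall_wall(1) g g'(1) h by auto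
    qed simp
    finally show ?thesis .
  qed
  have xx: "mul x x = 0"
  proof -
    have "mul x x = (\<Sum>h\<in>wall_perms. mul (bas h) x)" unfolding x_def by (rule mul_sum_left)
    also have "\<dots> = (\<Sum>h\<in>wall_perms. x)" by (intro sum.cong refl gx)
    also have "\<dots> = 0"
    proof
      fix \<sigma> show "(\<Sum>h\<in>wall_perms. x) \<sigma> = 0 \<sigma>" unfolding sum_apply by (simp add: card)
    qed
    finally show ?thesis .
  qed
  \<comment> \<open>A permutation diagram in b is absorbed by x, leaving x x = 0; any other diagram
    has an arc.\<close>
  have "mul (mul x b) x \<in> layer_ideal 1" if b: "b \<in> supported" for b
  proof -
    have "mul (mul x b) x = mul x (mul b x)" by (rule mul_assoc)
    also have "mul b x = (\<Sum>\<sigma>\<in>perms. scal (b \<sigma>) (mul (bas \<sigma>) x))"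
      by (rule mul_expand_left[OF b])
    finally have "mul (mul x b) x = (\<Sum>\<sigma>\<in>perms. scal (b \<sigma>) (mul x (mul (bas \<sigma>) x)))"
      by (simp only: mul_sum_right mul_scal)
    moreover have "mul x (mul (bas \<sigma>) x) \<in> layer_ideal 1" if \<sigma>: "\<sigma> \<in> perms" for \<sigma>
    proof (cases "\<sigma> \<in> wall_perms")
      case True
      show ?thesis unfolding gx[OF True] xx by (rule layer_ideal_closed(4))
    next
      case False
      then have "bas \<sigma> \<in> layer_ideal 1"
        using arcs_eq_0_iff[OF \<sigma>] bas_supported[OF \<sigma>] by (auto simp: layer_ideal_def bas_def)
      then show ?thesis by (intro layer_ideal_mul)
    qed
    ultimately show ?thesis by (elim ssubst) (intro layer_ideal_sum layer_ideal_closed(3))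
  qed
  then have "x \<in> layer_ideal 1" by (rule semisimpleD[OF ss xs])
  moreover have "arcs id = 0" using arcs_eq_0_iff[OF id_in_perms] id_wall_perms by simp
  ultimately show False using xid by (simp add: layer_ideal_def)
qed

text \<open>A diagram with an arc is some diagram times a hook, without a loop. So if the hooks kill
  x modulo m arcs, then every diagram with an arc does. As x b consists of such diagrams, x b x
  vanishes modulo m arcs for every b, although x does not.\<close>

lemma not_semisimpleI:
  assumes x: "x \<in> layer_ideal 1" "x \<notin> layer_ideal m"
    and hook: "\<And>i j. (i, j) \<in> hooks \<Longrightarrow> mul (bas (transpose i j)) x \<in> layer_ideal m"
  shows "\<not> semisimple_ring B"
proof
  assume ss: "semisimple_ring B"
  have bx: "mul (bas \<sigma>) x \<in> layer_ideal m" if \<sigma>: "\<sigma> \<in> perms" and arcs: "arcs \<sigma> \<noteq> 0" for \<sigma>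
  proof -
    have "{j \<in> labels. j > r \<and> \<sigma> j \<le> r} \<noteq> {}" using arcs unfolding arcs_right[OF \<sigma>, symmetric] by (metis card.empty)
    then obtain j where j: "j \<in> labels" "j > r" "\<sigma> j \<le> r" by blast
    define i where "i = \<sigma> j"
    have ij: "(i, j) \<in> hooks" using j permsD(1)[OF \<sigma> j(1)] by (simp add: hooks_def i_def)
    note h = hooksD[OF ij]
    \<comment> \<open>As \<open>\<tau>\<close> fixes j, its product with the hook closes no
      loop.\<close>
    define \<tau> where "\<tau> = transpose i j \<circ> \<sigma>"
    have \<tau>: "\<tau> \<in> perms" unfolding \<tau>_def by (rule comp_in_perms[OF h(6) \<sigma>])
    have "\<tau> j = j" by (simp add: \<tau>_def i_def)
    moreover have "transpose i j \<circ> \<tau> = \<sigma>" by (simp add: \<tau>_def fun_eq_iff)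
    ultimately have "star \<tau> (transpose i j) = \<sigma>" "lp \<tau> (transpose i j) = 0"
      using star_hook_right[OF ij \<tau>] h(5) by auto
    then have "bas \<sigma> = mul (bas \<tau>) (bas (transpose i j))" unfolding mul_bas[OF \<tau> h(6)] by (simp add: scal_def)
    then have "mul (bas \<sigma>) x = mul (bas \<tau>) (mul (bas (transpose i j)) x)" by (simp only: mul_assoc)
    then show ?thesis using layer_ideal_mul(2)[OF hook[OF ij]] by simp
  qed
  have ax: "mul a x \<in> layer_ideal m" if a: "a \<in> layer_ideal 1" for a
  proof -
    have as: "a \<in> supported" using a by (simp add: layer_ideal_def)
    have "mul a x = (\<Sum>\<sigma>\<in>perms. scal (a \<sigma>) (mul (bas \<sigma>) x))"
      by (rule mul_expand_left[OF as])
    also have "\<dots> \<in> layer_ideal m"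
    proof (rule layer_ideal_sum)
      fix \<sigma> assume \<sigma>: "\<sigma> \<in> perms"
      show "scal (a \<sigma>) (mul (bas \<sigma>) x) \<in> layer_ideal m"
      proof (cases "arcs \<sigma> = 0")
        case True
        then have "a \<sigma> = 0" using a by (simp add: layer_ideal_def)
        then have "scal (a \<sigma>) (mul (bas \<sigma>) x) = 0" by (simp add: scal_def fun_eq_iff)
        then show ?thesis by (simp only: layer_ideal_closed(4))
      qed (intro layer_ideal_closed(3) bx \<sigma>)
    qed
    finally show ?thesis .
  qed
  have "x \<in> supported" using x by (simp add: layer_ideal_def)
  then have "x \<in> layer_ideal m" by (rule semisimpleD[OF ss]) (rule ax[OF layer_ideal_mul(1)[OF x(1)]])
  then show False using x(2) by contradiction
qed

lemma wall_product:
  assumes p: "p permutes {1..r}" and q: "q permutes {r + 1..r + s}"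
  shows "p \<circ> q \<in> wall_perms" "lft (p \<circ> q) = p" "rgt (p \<circ> q) = q"
proof -
  have pl: "p permutes labels" "q permutes labels"
    by (rule permutes_subset[OF p] permutes_subset[OF q], simp add: labels_def subset_eq)+
  have pr: "p i = i" if "i > r" for i using permutes_not_in[OF p] that by simp
  have ql: "q i = i" if "i \<le> r" for i using permutes_not_in[OF q] that by simp
  have p0: "p i \<le> r" if "i \<le> r" for i using permutes_in_image[OF p, of i] permutes_not_in[OF p, of i] that
    by (cases "i \<in> {1..r}") auto
  have q0: "q i > r" if "i > r" for i using permutes_in_image[OF q, of i] permutes_not_in[OF q, of i] that
    by (cases "i \<in> {r + 1..r + s}") auto
  have "(p \<circ> q) i \<le> r \<longleftrightarrow> i \<le> r" for i
    using pr[OF q0, of i] q0[of i] p0[of i] ql[of i] by (cases "i \<le> r") simp_all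
  then show "p \<circ> q \<in> wall_perms" using permutes_compose[OF pl(2,1)] by (simp add: wall_perms_def perms_def)
  show "lft (p \<circ> q) = p" by (auto simp: fun_eq_iff lft_def ql pr)
  show "rgt (p \<circ> q) = q" by (auto simp: fun_eq_iff rgt_def ql pr q0)
qed

lemma lft_rgt_permutes:
  assumes "\<pi> \<in> wall_perms"
  shows "lft \<pi> permutes {1..r}" "rgt \<pi> permutes {r + 1..r + s}"
proof -
  have l: "lft \<pi> permutes labels" "rgt \<pi> permutes labels"
    using lft_rgt_wall[OF assms, THEN wall_permsD(1)] by (simp_all add: perms_def)
  show "lft \<pi> permutes {1..r}" by (rule permutes_superset[OF l(1)]) (auto simp: labels_def lft_def)
  show "rgt \<pi> permutes {r + 1..r + s}" by (rule permutes_superset[OF l(2)]) (auto simp: labels_def rgt_def)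
qed

text \<open>Here r and s meet the characteristic: k = 0 gives the product of the factorials of r and
  s, and the other orders divide it.\<close>

lemma card_nest_fix:
  assumes k: "k \<le> r" "k \<le> s"
  shows "card (nest_fix k) = fact (r - k) * fact (s - k)"
proof -
  let ?P = "{p. p permutes {1..r - k}}" and ?Q = "{q. q permutes {r + k + 1..r + s}}"
  have "bij_betw (\<lambda>h. (lft h, rgt h)) (nest_fix k) (?P \<times> ?Q)"
  proof (rule bij_betw_byWitness[where f' = "\<lambda>(p, q). p \<circ> q"])
    show "\<forall>h\<in>nest_fix k. (case (lft h, rgt h) of (p, q) \<Rightarrow> p \<circ> q) = h"
    proof
      fix h assume "h \<in> nest_fix k"
      then have "lft h \<circ> rgt h = h" by (intro lft_rgt_comp(4)[of h h] nest_fixD(1)[of h k])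
      then show "(case (lft h, rgt h) of (p, q) \<Rightarrow> p \<circ> q) = h" by (simp only: prod.case)
    qed
    have big: "p permutes {1..r}" "q permutes {r + 1..r + s}" if "p \<in> ?P" "q \<in> ?Q" for p q
      using permutes_subset[of p "{1..r - k}" "{1..r}"] permutes_subset[of q "{r + k + 1..r + s}" "{r + 1..r + s}"] that by auto
    show "\<forall>pq\<in>?P \<times> ?Q. (lft (case pq of (p, q) \<Rightarrow> p \<circ> q), rgt (case pq of (p, q) \<Rightarrow> p \<circ> q)) = pq"
    proof
      fix pq assume "pq \<in> ?P \<times> ?Q"
      then obtain p q where pq: "pq = (p, q)" "p \<in> ?P" "q \<in> ?Q" by (rule SigmaE)
      show "(lft (case pq of (p, q) \<Rightarrow> p \<circ> q), rgt (case pq of (p, q) \<Rightarrow> p \<circ> q)) = pq"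
        unfolding pq(1) prod.case wall_product(2,3)[OF big[OF pq(2,3)]] ..
    qed
    show "(\<lambda>h. (lft h, rgt h)) ` nest_fix k \<subseteq> ?P \<times> ?Q"
    proof (rule image_subsetI)
      fix h assume h: "h \<in> nest_fix k"
      note lr = lft_rgt_permutes[OF nest_fixD(1)[OF h]]
      have fx: "h i = i" if "r - k < i" "i \<le> r + k" for i using h that by (auto simp: nest_fix_def)
      have "lft h permutes {1..r - k}" by (rule permutes_superset[OF lr(1)]) (auto simp: lft_def fx)
      moreover have "rgt h permutes {r + k + 1..r + s}" by (rule permutes_superset[OF lr(2)]) (auto simp: rgt_def fx)
      ultimately show "(lft h, rgt h) \<in> ?P \<times> ?Q" by simp
    qed
    show "(\<lambda>(p, q). p \<circ> q) ` (?P \<times> ?Q) \<subseteq> nest_fix k"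
    proof (rule image_subsetI)
      fix pq assume "pq \<in> ?P \<times> ?Q"
      then obtain p q where pq: "pq = (p, q)" "p \<in> ?P" "q \<in> ?Q" by (rule SigmaE)
      have "(p \<circ> q) i = i" if "r - k < i" "i \<le> r + k" for i
        using pq(2,3) that permutes_not_in[of p "{1..r - k}" i] permutes_not_in[of q "{r + k + 1..r + s}" i] by simp
      then show "(case pq of (p, q) \<Rightarrow> p \<circ> q) \<in> nest_fix k"
        using wall_product(1)[OF big[OF pq(2,3)]] by (simp add: pq(1) nest_fix_def)
    qed
  qed
  then have "card (nest_fix k) = card (?P \<times> ?Q)" by (rule bij_betw_same_card)
  also have "\<dots> = fact (r - k) * fact (s - k)"
    using k by (simp add: card_cartesian_product card_permutations[OF refl finite_atLeastAtMost])
  finally show ?thesis .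
qed

text \<open>Here \<open>1\<close> and \<open>-1\<close> are not sums of two contents of Jucys-Murphy elements, as the content zero
  does not occur for two points.\<close>

lemma not_semisimple_22:
  assumes rs: "r = 2" "s = 2" and \<delta>: "\<delta> * \<delta> = 1"
  shows "\<not> semisimple_ring B"
proof (rule not_semisimpleI)
  have "r + s = 4" using rs by simp
  then have lab: "labels = {1, 2, 3, 4}" unfolding labels_def by auto
  \<comment> \<open>Both southern arcs are fixed, and the two choices of northern arcs get the
    coefficients 1 and -\<delta>. A hook adds \<delta> times one coefficient to the other, which
    gives 0 because \<delta>^2 = 1. No diagram has three arcs, so vanishing modulo
    \<open>layer_ideal 3\<close> is plain vanishing.\<close>
  define x :: "(nat \<Rightarrow> nat) \<Rightarrow> 'k" where
    "x \<sigma> = (if \<sigma> \<in> perms \<and> \<sigma> 3 = 1 \<and> \<sigma> 4 = 2 then if \<sigma> 1 = 3 then 1 else - \<delta> else 0)" for \<sigma>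
  show "x \<in> layer_ideal 1"
  proof -
    have a: "arcs \<sigma> \<noteq> 0" if "\<sigma> \<in> perms" "\<sigma> 3 = 1" for \<sigma>
      using arcs_eq_0_iff[OF that(1)] wall_permsD(2)[of \<sigma> 3] that(2) rs by auto
    have "x \<sigma> = 0" if "arcs \<sigma> < 1" for \<sigma>
    proof -
      have "\<not> (\<sigma> \<in> perms \<and> \<sigma> 3 = 1)" using a[of \<sigma>] that by linarith
      then show ?thesis by (auto simp: x_def)
    qed
    then show ?thesis by (simp add: layer_ideal_def supported_def) (simp add: x_def)
  qed
  have x0: "x \<sigma> = 0" if "\<not> (\<sigma> 3 = 1 \<and> \<sigma> 4 = 2)" for \<sigma> using that by (auto simp: x_def)
  define \<sigma>0 :: "nat \<Rightarrow> nat" where "\<sigma>0 = transpose 1 3 \<circ> transpose 2 4"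
  have \<sigma>0: "\<sigma>0 \<in> perms" unfolding \<sigma>0_def by (intro comp_in_perms transpose_in_perms) (simp_all add: lab)
  have "x \<sigma>0 = 1" using \<sigma>0 by (simp add: x_def) (simp add: \<sigma>0_def transpose_def)
  moreover have "arcs \<sigma>0 < 3" using arcs_le(1)[OF \<sigma>0] rs by simp
  ultimately have "arcs \<sigma>0 < 3 \<and> x \<sigma>0 \<noteq> 0" by simp
  then show "x \<notin> layer_ideal 3" unfolding layer_ideal_def by blast
  fix i j assume ij: "(i, j) \<in> hooks"
  note h = hooksD[OF ij]
  have "mul (bas (transpose i j)) x \<rho> = 0" if \<rho>: "\<rho> \<in> perms" "\<rho> i = j" for \<rho>
  proof -
    have "i \<in> {1, 2, 3, 4}" "i \<le> 2" "j \<in> {1, 2, 3, 4}" "2 < j" using h(1,2)[unfolded lab] h(3,4)[unfolded rs(1)] by simp_all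
    then have i: "i = 1 \<or> i = 2" and j: "j = 3 \<or> j = 4" by auto
    define i' j' where "i' = 3 - i" and "j' = 7 - j"
    have i'j': "{i, i'} = {1, 2}" "{j, j'} = {3, 4}" "labels - {j} = {1, 2, j'}" "j' \<noteq> 1" "j' \<noteq> 2" "j' \<noteq> j" "i' \<noteq> i"
      using i j by (auto simp: i'_def j'_def lab)
    have tp: "transpose v j \<circ> \<rho> \<in> perms" if "v \<in> labels" for v
      by (rule comp_in_perms[OF transpose_in_perms[OF that h(2)] \<rho>(1)])
    have "\<rho> 3 \<noteq> \<rho> i" "\<rho> 4 \<noteq> \<rho> i" unfolding permsD(3)[OF \<rho>(1)] using i by auto
    then have \<rho>34: "\<rho> 3 \<noteq> j" "\<rho> 4 \<noteq> j" unfolding \<rho>(2) .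
    have sum: "mul (bas (transpose i j)) x \<rho> = \<delta> * x \<rho> + (x (transpose 1 j \<circ> \<rho>) + (x (transpose 2 j \<circ> \<rho>) + x (transpose j' j \<circ> \<rho>)))"
      unfolding mul_hook_apply[OF ij \<rho>(1)] i'j'(3) using \<rho>(2) i'j'(4,5) by simp
    have x1: "x (transpose v j \<circ> \<rho>) = 0" if "v = 1 \<or> v = 2" for v
    proof -
      have "transpose v j (\<rho> 3) \<noteq> v" "transpose v j (\<rho> 4) \<noteq> v" using \<rho>34 j that by (auto simp: transpose_def split: if_splits)
      then show ?thesis using that by (intro x0) auto
    qed
    show ?thesis
    proof (cases "\<rho> 3 = 1 \<and> \<rho> 4 = 2")
      case False
      have "\<not> (transpose j' j (\<rho> 3) = 1 \<and> transpose j' j (\<rho> 4) = 2)"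
        using False j i'j' by (auto simp: transpose_def split: if_splits)
      then have "x (transpose j' j \<circ> \<rho>) = 0" by (intro x0) simp
      then show ?thesis unfolding sum x0[OF False] using x1[of 1] x1[of 2] by simp
    next
      case True
      have j'l: "j' \<in> labels" using i'j' by auto
      have "\<rho> i' \<in> labels" using permsD(1)[OF \<rho>(1), of i'] i i'j' by (auto simp: lab)
      moreover have "\<rho> i' \<noteq> \<rho> i" "\<rho> i' \<noteq> \<rho> 3" "\<rho> i' \<noteq> \<rho> 4" using permsD(3)[OF \<rho>(1), of i' i] permsD(3)[OF \<rho>(1), of i' 3] permsD(3)[OF \<rho>(1), of i' 4] i i'_def by auto
      ultimately have \<rho>i': "\<rho> i' = j'" using True \<rho>(2) j by (auto simp: lab j'_def)
      have xj: "x (transpose j' j \<circ> \<rho>) = (if \<rho> 1 = 3 then - \<delta> else 1)"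
      proof -
        have "transpose j' j (\<rho> 3) = 1" "transpose j' j (\<rho> 4) = 2" using True j i'j' by (auto simp: transpose_def)
        moreover have "transpose j' j (\<rho> 1) = 3 \<longleftrightarrow> \<rho> 1 \<noteq> 3"
          using i j \<rho>(2) \<rho>i' by (auto simp: transpose_def i'_def j'_def)
        ultimately show ?thesis using tp[OF j'l] by (simp add: x_def)
      qed
      have "x \<rho> = (if \<rho> 1 = 3 then 1 else - \<delta>)" using True \<rho>(1) by (simp add: x_def)
      then show ?thesis unfolding sum xj using x1[of 1] x1[of 2] \<delta> by simp
    qed
  qed
  moreover have "mul (bas (transpose i j)) x \<rho> = 0" if "\<rho> \<in> perms" "\<rho> i \<noteq> j" for \<rho>
    unfolding mul_hook_apply[OF ij that(1)] using that(2) by simp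
  moreover have "mul (bas (transpose i j)) x \<rho> = 0" if "\<rho> \<notin> perms" for \<rho>
    using mul_supported[of "bas (transpose i j)" x] that by (simp add: supported_def)
  ultimately have "mul (bas (transpose i j)) x \<rho> = 0" for \<rho> by blast
  then show "mul (bas (transpose i j)) x \<in> layer_ideal 3" using mul_supported by (simp add: layer_ideal_def)
qed

lemma pinv_rgt_transpose:
  assumes \<pi>: "\<pi> \<in> wall_perms" and v: "v \<in> labels" "v > r" and j: "j \<in> labels" "j > r"
  shows "pinv (rgt (transpose v j \<circ> \<pi>)) = transpose (pinv (rgt \<pi>) v) (pinv (rgt \<pi>) j) \<circ> pinv (rgt \<pi>)"
    "lft (transpose v j \<circ> \<pi>) = lft \<pi>"
proof -
  have pr: "rgt \<pi> \<in> perms" by (rule wall_permsD(1)[OF lft_rgt_wall(2)[OF \<pi>]])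
  have inj: "pinv (rgt \<pi>) a = pinv (rgt \<pi>) b \<longleftrightarrow> a = b" for a b by (rule permsD(3)[OF inv_in_perms[OF pr]])
  have "rgt (transpose v j \<circ> \<pi>) = transpose v j \<circ> rgt \<pi>"
    using v j by (auto simp: fun_eq_iff rgt_def transpose_def)
  moreover have "pinv (transpose v j) = transpose v j" by (rule pinv_unique) (simp_all add: fun_eq_iff)
  ultimately have "pinv (rgt (transpose v j \<circ> \<pi>)) = pinv (rgt \<pi>) \<circ> transpose v j"
    using pinv_comp[OF transpose_in_perms[OF v(1) j(1)] pr] by simp
  also have "\<dots> = transpose (pinv (rgt \<pi>) v) (pinv (rgt \<pi>) j) \<circ> pinv (rgt \<pi>)"
    by (rule ext) (simp add: transpose_def inj)
  finally show "pinv (rgt (transpose v j \<circ> \<pi>)) = transpose (pinv (rgt \<pi>) v) (pinv (rgt \<pi>) j) \<circ> pinv (rgt \<pi>)" .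
  have "transpose v j (\<pi> a) = \<pi> a" if "a \<le> r" for a
  proof -
    have "\<pi> a \<le> r" using wall_permsD(2)[OF \<pi>] that by simp
    then show ?thesis using v j by (simp add: transpose_def)
  qed
  then show "lft (transpose v j \<circ> \<pi>) = lft \<pi>" by (auto simp: fun_eq_iff lft_def)
qed

lemma lft_transpose:
  assumes \<pi>: "\<pi> \<in> wall_perms" and v: "v \<le> r" and j: "j \<le> r"
  shows "lft (transpose v j \<circ> \<pi>) = transpose v j \<circ> lft \<pi>" "rgt (transpose v j \<circ> \<pi>) = rgt \<pi>"
proof -
  show "lft (transpose v j \<circ> \<pi>) = transpose v j \<circ> lft \<pi>"
    using v j by (auto simp: fun_eq_iff lft_def transpose_def)
  have "transpose v j (\<pi> a) = \<pi> a" if "\<not> a \<le> r" for a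
  proof -
    have "\<not> \<pi> a \<le> r" using wall_permsD(2)[OF \<pi>] that by simp
    then show ?thesis using v j by (auto simp: transpose_def)
  qed
  then show "rgt (transpose v j \<circ> \<pi>) = rgt \<pi>" by (auto simp: fun_eq_iff rgt_def)
qed

text \<open>The vector x lives on one-arc diagrams whose southern arc joins r and r + 1. Each is
  \<open>transpose r j \<circ> \<pi>\<close> for one permutation diagram \<open>\<pi>\<close> with
  \<open>\<pi> (r + 1) = j\<close>, and its coefficient is a product of values of the two
  eigenfunctions. Up to two arcs, the hook formula then produces the factor \<delta> + c1 +
  c2.\<close>

lemma not_semisimple_jm_eigen:
  fixes f1 f2 :: "(nat \<Rightarrow> nat) \<Rightarrow> 'k"
  assumes rs: "0 < r" "0 < s"
    and f1: "jm_eigen {1..r} r c1 f1" and f2: "jm_eigen {r + 1..r + s} (r + 1) c2 f2"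
    and \<delta>: "\<delta> + of_int c1 + of_int c2 = 0"
  shows "\<not> semisimple_ring B"
proof (rule not_semisimpleI)
  let ?R = "{r + 1..r + s}"
  have inR: "v \<in> ?R \<longleftrightarrow> v \<in> labels \<and> v > r" for v by (auto simp: labels_def)
  have rl: "r \<in> labels" "r + 1 \<in> labels" using rs by (auto simp: labels_def)
  \<comment> \<open>On the right the hook formula has transpositions centred at the moving label j;
    passing to the inverse moves the centre to the fixed label r + 1.\<close>
  define y where "y \<pi> = f1 (lft \<pi>) * f2 (pinv (rgt \<pi>))" for \<pi>
  \<comment> \<open>At most one term is nonzero, the one with j the right end of the northern
    arc.\<close>
  define x where "x \<sigma> = (if \<sigma> \<in> perms \<and> \<sigma> (r + 1) = r
    then \<Sum>j\<in>?R. if transpose r j \<circ> \<sigma> \<in> wall_perms then y (transpose r j \<circ> \<sigma>) else 0 else 0)" for \<sigma>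
  have xval: "x (transpose r j \<circ> \<pi>) = y \<pi>" if \<pi>: "\<pi> \<in> wall_perms" and j: "\<pi> (r + 1) = j" for \<pi> j
  proof -
    note p = wall_permsD[OF \<pi>]
    have "j \<in> labels" "j > r" using permsD(1)[OF p(1) rl(2)] p(2)[of "r + 1"] unfolding j by simp_all
    then have jl: "j \<in> ?R" "j > r" "j \<in> labels" using inR by blast+
    have P: "transpose r j \<circ> \<pi> \<in> perms" by (rule comp_in_perms[OF transpose_in_perms[OF rl(1) jl(3)] p(1)])
    have inv: "transpose r j \<circ> (transpose r j \<circ> \<pi>) = \<pi>" by (simp add: fun_eq_iff)
    have ne: "transpose r j' \<circ> (transpose r j \<circ> \<pi>) \<notin> wall_perms" if "j' \<noteq> j" for j'
    proof
      assume W: "transpose r j' \<circ> (transpose r j \<circ> \<pi>) \<in> wall_perms"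
      have u: "\<pi> (pinv \<pi> r) = r" by (rule pinv_perms(1)[OF p(1)])
      then have "pinv \<pi> r \<le> r" using p(2)[of "pinv \<pi> r"] by simp
      then have "transpose r j' (transpose r j (\<pi> (pinv \<pi> r))) \<le> r" using wall_permsD(2)[OF W, of "pinv \<pi> r"] by simp
      then show False unfolding u using that jl(2) by (simp add: transpose_def)
    qed
    have "x (transpose r j \<circ> \<pi>) = (\<Sum>j'\<in>?R. if j' = j then y \<pi> else 0)"
    proof -
      have "(if transpose r j' \<circ> (transpose r j \<circ> \<pi>) \<in> wall_perms then y (transpose r j' \<circ> (transpose r j \<circ> \<pi>)) else 0)
          = (if j' = j then y \<pi> else 0)" for j'
      proof (cases "j' = j")
        case True
        show ?thesis unfolding True inv using \<pi> by simp
      next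
        case False
        show ?thesis using ne[OF False] False by (simp only: if_False)
      qed
      moreover have "(transpose r j \<circ> \<pi>) (r + 1) = r" using j by simp
      ultimately show ?thesis unfolding x_def using P by (simp only: if_True simp_thms)
    qed
    also have "\<dots> = y \<pi>" using jl(1) by (simp only: sum.delta finite_atLeastAtMost if_True)
    finally show ?thesis .
  qed
  show "x \<in> layer_ideal 1"
  proof -
    have "x \<sigma> = 0" if "arcs \<sigma> < 1" for \<sigma>
    proof -
      have "\<not> (\<sigma> \<in> perms \<and> \<sigma> (r + 1) = r)"
      proof
        assume \<sigma>: "\<sigma> \<in> perms \<and> \<sigma> (r + 1) = r"
        then have "\<sigma> \<in> wall_perms" using arcs_eq_0_iff[of \<sigma>] that by simp
        then show False using wall_permsD(2)[of \<sigma> "r + 1"] \<sigma> by simp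
      qed
      then show ?thesis unfolding x_def by (simp only: if_False)
    qed
    then show ?thesis by (simp add: layer_ideal_def supported_def) (simp add: x_def)
  qed
  show "x \<notin> layer_ideal 2"
  proof -
    obtain p where p: "p permutes {1..r}" "f1 p \<noteq> 0" using f1 unfolding jm_eigen_def by blast
    obtain q where q: "q permutes ?R" "f2 q \<noteq> 0" using f2 unfolding jm_eigen_def by blast
    define \<pi> where "\<pi> = p \<circ> pinv q"
    note w = wall_product[OF p(1) permutes_inv[OF q(1)], folded \<pi>_def]
    note P = wall_permsD[OF w(1)]
    have "y \<pi> = f1 p * f2 q" unfolding y_def w(2,3) permutes_inv_inv[OF q(1)] ..
    then have y: "y \<pi> \<noteq> 0" using p q by simp
    define \<sigma> where "\<sigma> = transpose r (\<pi> (r + 1)) \<circ> \<pi>"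
    have "x \<sigma> \<noteq> 0" unfolding \<sigma>_def xval[OF w(1) refl] by (rule y)
    moreover have "arcs \<sigma> < 2"
    proof -
      have "i = pinv \<pi> r" if "i \<le> r" "\<sigma> i > r" for i
      proof (rule ccontr)
        assume "i \<noteq> pinv \<pi> r"
        then have "\<pi> i \<noteq> r" using pinv_perms(2)[OF P(1), of i] by auto
        moreover have "\<pi> i \<noteq> \<pi> (r + 1)" unfolding permsD(3)[OF P(1)] using that by simp
        ultimately have "\<sigma> i = \<pi> i" by (simp add: \<sigma>_def transpose_def)
        then show False using P(2)[of i] that by simp
      qed
      then have "{i \<in> labels. i \<le> r \<and> \<sigma> i > r} \<subseteq> {pinv \<pi> r}" by blast
      then have "arcs \<sigma> \<le> card {pinv \<pi> r}" unfolding arcs_def by (rule card_mono[rotated]) simp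
      then show ?thesis by simp
    qed
    ultimately have "arcs \<sigma> < 2 \<and> x \<sigma> \<noteq> 0" by simp
    then show ?thesis unfolding layer_ideal_def by blast
  qed
  fix i j assume ij: "(i, j) \<in> hooks"
  note h = hooksD[OF ij]
  have jR: "j \<in> ?R" using h inR by blast
  have zero: "mul (bas (transpose i j)) x \<rho> = 0" if \<rho>: "\<rho> \<in> perms" "\<rho> i = j" and arcs: "arcs \<rho> < 2" for \<rho>
  proof (cases "\<rho> (r + 1) = r")
    \<comment> \<open>Neither \<open>\<rho>\<close> nor any
      \<open>transpose v j \<circ> \<rho>\<close> has the southern arc required by x.\<close>
    case False
    have r1: "\<rho> (r + 1) \<noteq> j" unfolding \<rho>(2)[symmetric] permsD(3)[OF \<rho>(1)] using h by simp
    have "x (transpose v j \<circ> \<rho>) = 0" for v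
    proof -
      have "transpose v j (\<rho> (r + 1)) \<noteq> r" using r1 False h by (simp add: transpose_def)
      then show ?thesis by (simp add: x_def)
    qed
    moreover have "x \<rho> = 0" using False by (simp add: x_def)
    ultimately show ?thesis unfolding mul_hook_apply[OF ij \<rho>(1)] by simp
  next
    case True
    have arcs1: "card {k \<in> labels. k \<le> r \<and> \<rho> k > r} \<le> Suc 0" "card {k \<in> labels. k > r \<and> \<rho> k \<le> r} \<le> Suc 0"
      using arcs unfolding arcs_right[OF \<rho>(1)] unfolding arcs_def by simp_all
    have fin: "finite {k \<in> labels. Q k}" for Q by simp
    \<comment> \<open>With one arc in each row, i and r + 1 are the only labels sent across the
      wall.\<close>
    have left: "k = i" if "k \<in> labels" "k \<le> r" "\<rho> k > r" for k
      using arcs1(1) that h \<rho>(2) unfolding card_le_Suc0_iff_eq[OF fin] by blast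
    have right: "k = r + 1" if "k \<in> labels" "k > r" "\<rho> k \<le> r" for k
    proof -
      have "r + 1 \<in> {k \<in> labels. k > r \<and> \<rho> k \<le> r}" using rl True by simp
      moreover have "k \<in> {k \<in> labels. k > r \<and> \<rho> k \<le> r}" using that by simp
      ultimately show ?thesis using arcs1(2) unfolding card_le_Suc0_iff_eq[OF fin] by blast
    qed
    define \<pi> where "\<pi> = transpose r j \<circ> \<rho>"
    have \<pi>P: "\<pi> \<in> perms" unfolding \<pi>_def by (rule comp_in_perms[OF transpose_in_perms[OF rl(1) h(2)] \<rho>(1)])
    have "\<pi> k \<le> r \<longleftrightarrow> k \<le> r" if k: "k \<in> labels" for k
    proof -
      consider "k = i" | "k = r + 1" | "k \<noteq> i" "k \<noteq> r + 1" by blast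
      then show ?thesis
      proof cases
        case 1
        then show ?thesis using \<rho>(2) h by (simp add: \<pi>_def)
      next
        case 2
        then show ?thesis using True h by (simp add: \<pi>_def)
      next
        case 3
        have "\<rho> k \<noteq> \<rho> i" "\<rho> k \<noteq> \<rho> (r + 1)" unfolding permsD(3)[OF \<rho>(1)] using 3 by simp_all
        then have "\<pi> k = \<rho> k" unfolding \<rho>(2) True by (simp add: \<pi>_def transpose_def)
        moreover have "\<rho> k \<le> r \<longleftrightarrow> k \<le> r" using left[OF k] right[OF k] 3 by (meson not_le)
        ultimately show ?thesis by simp
      qed
    qed
    then have \<pi>: "\<pi> \<in> wall_perms" using \<pi>P by (simp add: wall_perms_def)
    have \<pi>1: "\<pi> (r + 1) = j" using True by (simp add: \<pi>_def)
    have \<rho>\<pi>: "\<rho> = transpose r j \<circ> \<pi>" by (simp add: \<pi>_def fun_eq_iff)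
    define p q where "p = lft \<pi>" and "q = pinv (rgt \<pi>)"
    have p: "p permutes {1..r}" unfolding p_def by (rule lft_rgt_permutes(1)[OF \<pi>])
    have q: "q permutes ?R" unfolding q_def by (rule permutes_inv[OF lft_rgt_permutes(2)[OF \<pi>]])
    have rgtP: "rgt \<pi> \<in> perms" by (rule wall_permsD(1)[OF lft_rgt_wall(2)[OF \<pi>]])
    have rq: "rgt \<pi> (q a) = a" "q (rgt \<pi> a) = a" for a unfolding q_def by (rule pinv_perms[OF rgtP])+
    have r1: "rgt \<pi> (r + 1) = j" using \<pi>1 by (simp add: rgt_def)
    then have qj: "q j = r + 1" using rq(2)[of "r + 1"] by simp
    have xR: "x (transpose v j \<circ> \<rho>) = f1 p * f2 (transpose (q v) (r + 1) \<circ> q)" if v: "v \<in> ?R - {j}" for v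
    proof -
      have vl: "v \<in> labels" "v > r" "v \<noteq> j" using v inR by auto
      have W: "transpose v j \<circ> \<pi> \<in> wall_perms"
        by (intro comp_wall_perms transpose_right_wall vl h \<pi>)
      have e: "transpose v j \<circ> \<rho> = transpose r v \<circ> (transpose v j \<circ> \<pi>)"
        unfolding \<rho>\<pi> using vl h(4) by (auto simp: fun_eq_iff transpose_def)
      have "x (transpose v j \<circ> \<rho>) = y (transpose v j \<circ> \<pi>)" unfolding e by (rule xval[OF W]) (use \<pi>1 in simp)
      then show ?thesis
        unfolding y_def pinv_rgt_transpose[OF \<pi> vl(1,2) h(2,4)] p_def[symmetric] q_def[symmetric] qj .
    qed
    have xL: "x (transpose v j \<circ> \<rho>) = f1 (transpose v r \<circ> p) * f2 q" if v: "v \<in> {1..r} - {r}" for v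
    proof -
      have vl: "v \<in> labels" "v \<le> r" "v \<noteq> r" using v by (auto simp: labels_def)
      have W: "transpose v r \<circ> \<pi> \<in> wall_perms"
        by (intro comp_wall_perms transpose_left_wall vl rl \<pi> order_refl)
      have e: "transpose v j \<circ> \<rho> = transpose r j \<circ> (transpose v r \<circ> \<pi>)"
        unfolding \<rho>\<pi> using vl h(4) by (auto simp: fun_eq_iff transpose_def)
      have "x (transpose v j \<circ> \<rho>) = y (transpose v r \<circ> \<pi>)" unfolding e by (rule xval[OF W]) (use \<pi>1 vl h(4) in simp)
      then show ?thesis
        unfolding y_def lft_transpose[OF \<pi> vl(2) order_refl] p_def[symmetric] q_def[symmetric] .
    qed
    \<comment> \<open>For v = r both arcs are resolved into lines, and x vanishes on permutation
      diagrams.\<close>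
    have x0: "x (transpose r j \<circ> \<rho>) = 0" unfolding \<pi>_def[symmetric] using \<pi>1 h(4) by (simp add: x_def)
    have "x \<rho> = y \<pi>" unfolding \<rho>\<pi> by (rule xval[OF \<pi> \<pi>1])
    then have x\<rho>: "x \<rho> = f1 p * f2 q" unfolding y_def p_def q_def .
    \<comment> \<open>q carries the labels other than j to those other than r + 1, over which the
      eigenvalue equation sums.\<close>
    have "(\<Sum>v\<in>?R - {j}. f2 (transpose (q v) (r + 1) \<circ> q)) = (\<Sum>u\<in>?R - {r + 1}. f2 (transpose u (r + 1) \<circ> q))"
    proof (rule sum.reindex_bij_witness[where j = q and i = "rgt \<pi>"])
      fix v assume v: "v \<in> ?R - {j}"
      have "q v \<noteq> r + 1" using rq(1)[of v] r1 v by auto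
      then show "q v \<in> ?R - {r + 1}" using permutes_in_image[OF q, of v] v by blast
    next
      fix u assume u: "u \<in> ?R - {r + 1}"
      have "rgt \<pi> u \<noteq> j" using rq(2)[of u] qj u by auto
      then show "rgt \<pi> u \<in> ?R - {j}" using permutes_in_image[OF lft_rgt_permutes(2)[OF \<pi>], of u] u by blast
    qed (simp_all only: rq)
    also have "\<dots> = of_int c2 * f2 q" using f2 q unfolding jm_eigen_def by blast
    finally have sR: "(\<Sum>v\<in>?R - {j}. x (transpose v j \<circ> \<rho>)) = f1 p * (of_int c2 * f2 q)"
      by (simp only: xR sum_distrib_left[symmetric] cong: sum.cong)
    have "(\<Sum>v\<in>{1..r} - {r}. f1 (transpose v r \<circ> p)) = of_int c1 * f1 p" using f1 p unfolding jm_eigen_def by blast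
    then have sL: "(\<Sum>v\<in>{1..r} - {r}. x (transpose v j \<circ> \<rho>)) = of_int c1 * f1 p * f2 q"
      by (simp only: xL sum_distrib_right[symmetric] cong: sum.cong)
    have lab: "labels - {j} = insert r ((?R - {j}) \<union> ({1..r} - {r}))" using rl jR by (auto simp: labels_def)
    have "(\<Sum>v\<in>labels - {j}. x (transpose v j \<circ> \<rho>)) =
        x (transpose r j \<circ> \<rho>) + (\<Sum>v\<in>(?R - {j}) \<union> ({1..r} - {r}). x (transpose v j \<circ> \<rho>))"
      unfolding lab by (rule sum.insert) auto
    also have "(\<Sum>v\<in>(?R - {j}) \<union> ({1..r} - {r}). x (transpose v j \<circ> \<rho>)) =
        f1 p * (of_int c2 * f2 q) + of_int c1 * f1 p * f2 q"
      unfolding sR[symmetric] sL[symmetric] by (rule sum.union_disjoint) auto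
    finally have "mul (bas (transpose i j)) x \<rho> =
        \<delta> * (f1 p * f2 q) + (0 + (f1 p * (of_int c2 * f2 q) + of_int c1 * f1 p * f2 q))"
      unfolding mul_hook_apply[OF ij \<rho>(1)] x0 x\<rho> using \<rho>(2) by (simp only: if_True simp_thms)
    also have "\<dots> = (\<delta> + of_int c1 + of_int c2) * (f1 p * f2 q)" by (simp add: algebra_simps)
    finally show ?thesis unfolding \<delta> by simp
  qed
  have "mul (bas (transpose i j)) x \<rho> = 0" if "arcs \<rho> < 2" for \<rho>
  proof (cases "\<rho> \<in> perms")
    case True
    show ?thesis
    proof (cases "\<rho> i = j")
      case False
      then show ?thesis unfolding mul_hook_apply[OF ij True] by simp
    qed (rule zero[OF True _ that])
  next
    case False
    then show ?thesis using mul_supported[of "bas (transpose i j)" x] unfolding supported_def by blast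
  qed
  then show "mul (bas (transpose i j)) x \<in> layer_ideal 2" using mul_supported unfolding layer_ideal_def by blast
qed

end

section \<open>The criterion\<close>

text \<open>Antisymmetrisers supply the negative contents, the sign twist turns them into positive
  ones, and 0 is treated separately.\<close>

lemma jm_eigen_exists:
  assumes S: "finite S" "z \<in> S" and c: "\<bar>c\<bar> < int (card S)" and c0: "c \<noteq> 0 \<or> card S = 1 \<or> card S \<ge> 4"
    and two: "c \<noteq> 0 \<Longrightarrow> (2 :: 'k::field) \<noteq> 0"
  shows "\<exists>f :: (nat \<Rightarrow> nat) \<Rightarrow> 'k. jm_eigen S z c f"
proof (cases "c = 0")
  case True
  then show ?thesis using jm_eigen_zero[OF S] c0 by simp
next
  case False
  have n: "1 \<le> nat \<bar>c\<bar>" "nat \<bar>c\<bar> < card S" using False c by simp_all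
  obtain f :: "(nat \<Rightarrow> nat) \<Rightarrow> 'k" where f: "jm_eigen S z (- int (nat \<bar>c\<bar>)) f"
    using jm_eigen_negative[OF S n two[OF False]] by blast
  show ?thesis
  proof (cases "c < 0")
    case True
    then show ?thesis using f by auto
  next
    case False
    then show ?thesis using jm_eigen_sign[OF S f] by auto
  qed
qed

text \<open>The content 0 is available only for one point or at least four. The splittings avoid it
  otherwise, and the excluded cases are those where no splitting is left.\<close>

lemma content_split_nonneg:
  fixes a b t :: int
  assumes ab: "1 \<le> a" "1 \<le> b" and t: "0 \<le> t" "t \<le> a + b - 2"
    and ex: "\<not> (a = 2 \<and> b = 2 \<and> t = 1)" "\<not> (t = 0 \<and> (a, b) \<in> {(1, 2), (1, 3), (2, 1), (3, 1)})"
  shows "\<exists>c d. c + d = t \<and> \<bar>c\<bar> < a \<and> \<bar>d\<bar> < b \<and> (c \<noteq> 0 \<or> a = 1 \<or> a \<ge> 4) \<and> (d \<noteq> 0 \<or> b = 1 \<or> b \<ge> 4)"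
proof -
  have ex': "\<not> (t = 0 \<and> (a = 1 \<and> (b = 2 \<or> b = 3) \<or> b = 1 \<and> (a = 2 \<or> a = 3)))" using ex(2) by auto
  consider "a = 1" | "b = 1" "a \<noteq> 1" | "a \<ge> 2" "b \<ge> 2" "t \<ge> 2" | "a \<ge> 2" "b \<ge> 2" "t = 0"
    | "a \<ge> 3" "b \<ge> 2" "t = 1" | "a = 2" "b \<ge> 3" "t = 1" using ab t ex(1) by linarith
  then show ?thesis
  proof cases
    case 1
    then have "t \<noteq> 0 \<or> b = 1 \<or> b \<ge> 4" "t < b" using ab t ex' by linarith+
    then show ?thesis using 1 t(1) by (intro exI[of _ 0] exI[of _ t]) simp
  next
    case 2
    then have "t \<noteq> 0 \<or> a \<ge> 4" "t < a" using ab t ex' by linarith+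
    then show ?thesis using 2 t(1) by (intro exI[of _ t] exI[of _ 0]) simp
  next
    case 3
    show ?thesis
    \<comment> \<open>The splitting 1 + (t - 1) works as long as t - 1 is a content for b points;
      beyond that the second content is maximal and the first absorbs the rest.\<close>
    proof (cases "t \<le> b")
      case True
      then show ?thesis using 3 by (intro exI[of _ 1] exI[of _ "t - 1"]) simp
    next
      case False
      then show ?thesis using 3 t(2) by (intro exI[of _ "t - (b - 1)"] exI[of _ "b - 1"]) simp
    qed
  next
    case 4
    then show ?thesis by (intro exI[of _ 1] exI[of _ "- 1"]) simp
  next
    case 5
    then show ?thesis by (intro exI[of _ 2] exI[of _ "- 1"]) simp
  next
    case 6
    then show ?thesis by (intro exI[of _ "- 1"] exI[of _ 2]) simp
  qed
qed

lemma content_split: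
  fixes a b t :: int
  assumes ab: "1 \<le> a" "1 \<le> b" and t: "\<bar>t\<bar> \<le> a + b - 2"
    and ex: "\<not> (a = 2 \<and> b = 2 \<and> \<bar>t\<bar> = 1)" "\<not> (t = 0 \<and> (a, b) \<in> {(1, 2), (1, 3), (2, 1), (3, 1)})"
  shows "\<exists>c d. c + d = t \<and> \<bar>c\<bar> < a \<and> \<bar>d\<bar> < b \<and> (c \<noteq> 0 \<or> a = 1 \<or> a \<ge> 4) \<and> (d \<noteq> 0 \<or> b = 1 \<or> b \<ge> 4)"
proof -
  have "0 \<le> \<bar>t\<bar>" "\<not> (\<bar>t\<bar> = 0 \<and> (a, b) \<in> {(1, 2), (1, 3), (2, 1), (3, 1)})" using ex(2) by simp_all
  from content_split_nonneg[OF ab this(1) t ex(1) this(2)] obtain c d where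
    cd: "c + d = \<bar>t\<bar>" "\<bar>c\<bar> < a" "\<bar>d\<bar> < b" "c \<noteq> 0 \<or> a = 1 \<or> a \<ge> 4" "d \<noteq> 0 \<or> b = 1 \<or> b \<ge> 4" by blast
  show ?thesis
  proof (cases "t \<ge> 0")
    case True
    then show ?thesis using cd by (intro exI[of _ c] exI[of _ d]) simp
  next
    case False
    then show ?thesis using cd by (intro exI[of _ "- c"] exI[of _ "- d"]) simp
  qed
qed

text \<open>The characteristic is 0 or prime, and a prime divides n! exactly if it is at most
  n.\<close>

lemma of_nat_fact_mult_eq_0_iff:
  "(of_nat (fact m * fact n) :: 'k::field) = 0 \<longleftrightarrow> CHAR('k) \<noteq> 0 \<and> CHAR('k) \<le> max m n"
proof (cases "CHAR('k) = 0")
  case True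
  then show ?thesis by (simp add: of_nat_eq_0_iff_char_dvd)
next
  case False
  then have "prime CHAR('k)" using prime_CHAR_semidom[where 'a = 'k] by simp
  then show ?thesis using False
    unfolding of_nat_eq_0_iff_char_dvd by (auto simp: prime_dvd_mult_iff prime_dvd_fact_iff)
qed

context walled_algebra
begin

text \<open>As l is at least 1, the two contents add up to an integer of absolute value at most r +
  s - 2. Only (iv) remains, with k = 0 and l = 1: one content is 0 and the other is 1 or 2 up to
  sign, nonzero because the characteristic is not 2.\<close>

lemma generic_if:
  assumes char: "CHAR('k) = 0 \<or> CHAR('k) > max r s"
    and cond: "(\<forall>m::int. \<bar>m\<bar> \<le> int r + int s - 2 \<longrightarrow> of_int m \<noteq> \<delta>) \<or> r = 0 \<or> s = 0 \<or>
      (\<delta> = 0 \<and> (r, s) \<in> {(1, 2), (1, 3), (2, 1), (3, 1)})"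
  shows generic
  unfolding generic_def
proof (intro allI impI ballI notI)
  fix k l c c'
  assume kl: "k < l" "l \<le> r" "l \<le> s" and c: "c \<in> jm_values (s - k)" and c': "c' \<in> jm_values (r - l + 1)"
    and eq: "\<delta> + of_int c + of_int c' = 0"
  have "of_int (- c - c') = \<delta> - (\<delta> + of_int c + of_int c')" by simp
  then have "of_int (- c - c') = \<delta>" unfolding eq by simp
  moreover have "\<bar>- c - c'\<bar> \<le> int r + int s - 2"
    using jm_values_subset[OF c] jm_values_subset[OF c'] kl by (simp add: of_nat_diff)
  ultimately have \<delta>: "\<delta> = 0" and rs: "(r, s) \<in> {(1, 2), (1, 3), (2, 1), (3, 1)}" using cond kl by auto
  have "2 \<le> max r s" using rs by auto
  then have "\<not> CHAR('k) dvd 2" using char by (auto dest: dvd_imp_le)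
  then have two: "(2 :: 'k) \<noteq> 0" using of_nat_eq_0_iff_char_dvd[of 2, where 'a = 'k] by simp
  have "l = 1" "k = 0" using rs kl by auto
  then have "(c = 0 \<and> c' \<in> {- 2, - 1, 1, 2}) \<or> (c' = 0 \<and> c \<in> {- 2, - 1, 1, 2})"
    using rs c c' by (auto simp: jm_values_def)
  then have "of_int (c + c') \<noteq> (0 :: 'k)" using two by auto
  then show False using eq \<delta> by simp
qed

lemma semisimple_if:
  assumes char: "CHAR('k) = 0 \<or> CHAR('k) > max r s" and generic
  shows "semisimple_ring B"
proof (rule semisimpleI)
  fix x assume x: "x \<in> supported" "\<And>b. mul (mul x b) x = 0"
  have "(of_nat (card (nest_fix k)) :: 'k) \<noteq> 0" if "k \<le> r" "k \<le> s" for k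
    using char unfolding card_nest_fix[OF that] of_nat_fact_mult_eq_0_iff by auto
  then show "x = 0" using generic_semiprime[OF \<open>generic\<close> _ x] by blast
qed

lemma semisimple_imp_char:
  assumes "semisimple_ring B"
  shows "CHAR('k) = 0 \<or> CHAR('k) > max r s"
proof (rule ccontr)
  assume "\<not> ?thesis"
  then have "(of_nat (card wall_perms) :: 'k) = 0"
    unfolding nest_fix_0[symmetric] card_nest_fix[OF le0 le0] of_nat_fact_mult_eq_0_iff by auto
  then show False using not_semisimple_card_zero assms by simp
qed

lemma not_semisimple_of_int:
  assumes char: "CHAR('k) = 0 \<or> CHAR('k) > max r s" and rs: "0 < r" "0 < s"
    and m: "\<bar>m\<bar> \<le> int r + int s - 2" "of_int m = \<delta>"
    and ex: "\<not> (\<delta> = 0 \<and> (r, s) \<in> {(1, 2), (1, 3), (2, 1), (3, 1)})"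
  shows "\<not> semisimple_ring B"
\<comment> \<open>Here \<open>content_split\<close> offers no two contents, and diagrams with two
  arcs are used instead.\<close>
proof (cases "r = 2 \<and> s = 2 \<and> \<bar>m\<bar> = 1")
  case True
  then have "m = 1 \<or> m = - 1" by auto
  then have "\<delta> * \<delta> = 1" using m(2) by auto
  then show ?thesis using not_semisimple_22 True by simp
next
  case False
  have "\<exists>c d. c + d = - m \<and> \<bar>c\<bar> < int r \<and> \<bar>d\<bar> < int s \<and>
      (c \<noteq> 0 \<or> int r = 1 \<or> int r \<ge> 4) \<and> (d \<noteq> 0 \<or> int s = 1 \<or> int s \<ge> 4)"
    by (rule content_split) (use rs m ex False in auto)
  then obtain c d where cd: "c + d = - m" "\<bar>c\<bar> < int r" "\<bar>d\<bar> < int s"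
    "c \<noteq> 0 \<or> r = 1 \<or> r \<ge> 4" "d \<noteq> 0 \<or> s = 1 \<or> s \<ge> 4" by auto
  have two: "(2 :: 'k) \<noteq> 0" if "2 \<le> max r s"
  proof -
    have "\<not> CHAR('k) dvd 2" using char that by (auto dest: dvd_imp_le)
    then show ?thesis using of_nat_eq_0_iff_char_dvd[of 2, where 'a = 'k] by simp
  qed
  obtain f1 :: "(nat \<Rightarrow> nat) \<Rightarrow> 'k" where f1: "jm_eigen {1..r} r c f1"
    using jm_eigen_exists[of "{1..r}" r c, where 'k = 'k] cd(2,4) rs two by auto
  obtain f2 :: "(nat \<Rightarrow> nat) \<Rightarrow> 'k" where f2: "jm_eigen {r + 1..r + s} (r + 1) d f2"
    using jm_eigen_exists[of "{r + 1..r + s}" "r + 1" d, where 'k = 'k] cd(3,5) rs two by auto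
  have "\<delta> + of_int c + of_int d = of_int (m + (c + d))" unfolding m(2)[symmetric] by simp
  then have "\<delta> + of_int c + of_int d = 0" unfolding cd(1) by simp
  then show ?thesis by (rule not_semisimple_jm_eigen[OF rs f1 f2])
qed

end

theorem theorem6p3:
  fixes \<delta> :: "'k::alg_closed_field" and r s :: nat
  shows "semisimple_ring (walled_brauer r s \<delta>) \<longleftrightarrow>
    (CHAR('k) = 0 \<or> CHAR('k) > max r s) \<and>
    (\<delta> \<notin> \<int> \<or>
     (\<delta> \<in> \<int> \<and> (\<forall>m::int. \<bar>m\<bar> \<le> int r + int s - 2 \<longrightarrow> of_int m \<noteq> \<delta>)) \<or>
     (r = 0 \<or> s = 0) \<or>
     (\<delta> = 0 \<and> (r, s) \<in> {(1, 2), (1, 3), (2, 1), (3, 1)}))"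
    (is "?ss \<longleftrightarrow> ?char \<and> ?cond")
proof -
  interpret walled_algebra r s \<delta> .
  \<comment> \<open>Since every \<open>of_int m\<close> lies in \<open>\<int>\<close>, (i) and (ii)
    merge into the condition that \<delta> is not the image of a small integer.\<close>
  have cond: "?cond \<longleftrightarrow> (\<forall>m::int. \<bar>m\<bar> \<le> int r + int s - 2 \<longrightarrow> of_int m \<noteq> \<delta>) \<or> r = 0 \<or> s = 0 \<or>
      (\<delta> = 0 \<and> (r, s) \<in> {(1, 2), (1, 3), (2, 1), (3, 1)})"
    using Ints_of_int[where 'a = 'k] by blast
  show ?thesis
  proof (intro iffI conjI)
    assume ss: ?ss
    then show char: ?char by (rule semisimple_imp_char)
    show ?cond
    proof (rule ccontr)
      assume n: "\<not> ?cond"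
      then obtain m :: int where "\<bar>m\<bar> \<le> int r + int s - 2" "of_int m = \<delta>" unfolding cond by blast
      then show False using not_semisimple_of_int[OF char] n ss unfolding cond by blast
    qed
  next
    assume A: "?char \<and> ?cond"
    then have generic unfolding cond by (intro generic_if) simp_all
    then show ?ss using A semisimple_if by blast
  qed
qed

end
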